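(* Let $H$ be a monoid such that the associated reduced monoid $H_{\mathrm{red}}$ is finitely generated. (1) The set of catenary degrees $\mathsf{Ca}(H)$ and the set of distances $\Delta(H)$ are finite, and $\rho(H)\in\mathbb{Q}$. If $H$ is cancellative, then the elasticity is accepted and there is some $r\in\mathbb{R}_{\ge 1}$ such that $\{q\in\mathbb{Q} : r\le q\le\rho(H)\}\subset\mathcal{R}(H)$; moreover, $r$ is the only possible limit point of the set $\{\rho(L) : L\in\mathcal{L}(H)\text{ with }\rho(L)<r\}$. (2) There is $M\in\mathbb{N}_0$ such that, for all $k\in\mathbb{N}$, the unions $\mathcal{U}_k(H)$ are finite AAPs with difference $\min\Delta(H)$ and bound $M$. (3) If $H$ is cancellative, then there is $M\in\mathbb{N}_0$ such that every $L\in\mathcal{L}(H)$ is an AAMP with difference $d\in\Delta(H)$ and bound $M$.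
   Context: $\mathbb{N}$ is the set of positive integers, $\mathbb{N}_0=\mathbb{N}\cup\{0\}$, and $[a,b]=\{x\in\mathbb{Z}: a\le x\le b\}$. A monoid is a commutative semigroup with identity element that is unit-cancellative: $a=au$ implies $u\in H^\times$, where $H^\times$ is the group of invertible elements. $H$ is cancellative if $au=bu$ implies $a=b$. $H_{\mathrm{red}}=\{aH^\times : a\in H\}$. An atom is a non-invertible $a\in H$ such that $a=bc$ implies $b\in H^\times$ or $c\in H^\times$; $\mathcal{A}(H)$ is the set of atoms. $\mathsf{Z}(H)$ is the free abelian monoid with basis $\mathcal{A}(H_{\mathrm{red}})$, $|z|$ is the length of $z\in\mathsf{Z}(H)$ (number of atoms counted with multiplicity), and $\pi:\mathsf{Z}(H)\to H_{\mathrm{red}}$ is the homomorphism that is the identity on atoms. For $a\in H$: $\mathsf{Z}(a)=\pi^{-1}(aH^\times)$, $\mathsf{L}(a)=\{|z|: z\in\mathsf{Z}(a)\}\subset\mathbb{N}_0$, and $\mathcal{L}(H)=\{\mathsf{L}(a): a\in H\}$. For $A\subset\mathbb{Z}$, $\Delta(A)$ is the set of all $d\in\mathbb{N}$ for which there is $a\in A$ with $A\cap[a,a+d]=\{a,a+d\}$. For $A\subset\mathbb{N}_0$, $\rho(A)=\sup(A\cap\mathbb{N})/\min(A\cap\mathbb{N})$, with $\rho(A)=1$ if $A\cap\mathbb{N}=\emptyset$. Set $\Delta(H)=\bigcup_{L\in\mathcal{L}(H)}\Delta(L)$, $\mathcal{R}(H)=\{\rho(L): L\in\mathcal{L}(H)\}$,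 $\rho(H)=\sup\mathcal{R}(H)$, and $\mathcal{U}_k(H)=\bigcup_{k\in L\in\mathcal{L}(H)}L$. The elasticity is accepted if $\rho(L)=\rho(H)$ for some $L\in\mathcal{L}(H)$. Distance: write $z,z'\in\mathsf{Z}(H)$ as $z=u_1\cdots u_\ell v_1\cdots v_m$, $z'=u_1\cdots u_\ell w_1\cdots w_n$ with all $u_i,v_j,w_k\in\mathcal{A}(H_{\mathrm{red}})$ and $\{v_1,\dots,v_m\}\cap\{w_1,\dots,w_n\}=\emptyset$; then $\mathsf{d}(z,z')=\max\{m,n\}$. For $a\in H$, $\mathsf{c}(a)$ is the smallest $N\in\mathbb{N}_0\cup\{\infty\}$ such that for any $z,z'\in\mathsf{Z}(a)$ there are $z=z_0,z_1,\dots,z_k=z'$ in $\mathsf{Z}(a)$ with $\mathsf{d}(z_{i-1},z_i)\le N$ for all $i$. $\mathsf{Ca}(H)=\{\mathsf{c}(a): a\in H,\ \mathsf{c}(a)>0\}$. AAP: for $d\in\mathbb{N}$, $M\in\mathbb{N}_0$, a set $L\subset\mathbb{Z}$ is an almost arithmetical progression (AAP) with difference $d$ and bound $M$ if $L=y+(L'\cup L^*\cup L'')\subset y+d\mathbb{Z}$, where $y\in\mathbb{Z}$, $L^*$ is a nonempty arithmetical progression with difference $d$ and $\min L^*=0$, $L'\subset[-M,-1]$, and $L''\subset\sup L^*+[1,M]$ (with $L''=\emptyset$ if $L^*$ is infinite). AAMP (almost arithmetical multiprogression): for $d\in\mathbb{N}$, $M\in\mathbb{N}_0$ and $\{0,d\}\subset\mathcal{D}\subset[0,d]$,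 a set $L\subset\mathbb{Z}$ is an AAMP with difference $d$, period $\mathcal{D}$ and bound $M$ if $L=y+(L'\cup L^*\cup L'')\subset y+\mathcal{D}+d\mathbb{Z}$, where $y\in\mathbb{Z}$, $L^*$ is finite nonempty with $\min L^*=0$ and $L^*=(\mathcal{D}+d\mathbb{Z})\cap[0,\max L^*]$, $L'\subset[-M,-1]$, and $L''\subset\max L^*+[1,M]$. "AAMP with difference $d$ and bound $M$" means this holds for some period $\mathcal{D}$.
   Formalization: Part (2) assumes H is not a group (otherwise all U_k(H), k ≥ 1, are empty and not AAPs); if Δ(H) is empty, so that min Δ(H) and d ∈ Δ(H) have no meaning, (2) and (3) are stated for every difference d ≥ 1 instead. *)

theory Defs
  imports
    "HOL-Algebra.Divisibility"
    "HOL-Algebra.FiniteProduct"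
    "HOL-Analysis.Elementary_Topology"
    "HOL-Library.Extended_Real"
    "HOL-Library.Extended_Nat"
    "HOL.Hull"
begin

section \<open>Unit-cancellative monoids\<close>

locale unit_cancel_comm_monoid = comm_monoid +
  assumes unit_cancel: "\<lbrakk>a \<in> carrier G; u \<in> carrier G; a = a \<otimes> u\<rbrakk> \<Longrightarrow> u \<in> Units G"

text \<open>
  The quotient construction \<^const>\<open>FactGroup\<close> is normally applied to groups, but its definition
  also makes sense for a commutative monoid and its group of units: the elements are the cosets
  of the units, multiplied elementwise, and the identity is the group of units itself.
\<close>

definition reduced_monoid :: "('a, 'b) monoid_scheme \<Rightarrow> 'a set monoid" where
  "reduced_monoid H = H Mod Units H"

definition fin_gen_monoid :: "('a, 'b) monoid_scheme \<Rightarrow> bool" where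
  "fin_gen_monoid H \<longleftrightarrow>
     (\<exists>E. finite E \<and> E \<subseteq> carrier H \<and> (\<lambda>S. submonoid S H) hull E = carrier H)"

definition monoid_atoms :: "('a, 'b) monoid_scheme \<Rightarrow> 'a set" where
  "monoid_atoms H =
     {a \<in> carrier H - Units H.
        \<forall>b\<in>carrier H. \<forall>c\<in>carrier H. a = b \<otimes>\<^bsub>H\<^esub> c \<longrightarrow> b \<in> Units H \<or> c \<in> Units H}"


section \<open>Factorizations and sets of lengths\<close>

text \<open>The free abelian monoid on a set of atoms is the set of finite multisets of such atoms;
  the length of a factorization is the size of the multiset.\<close>

definition factorization_monoid :: "('a, 'b) monoid_scheme \<Rightarrow> 'a set multiset set" where
  "factorization_monoid H = {z. set_mset z \<subseteq> monoid_atoms (reduced_monoid H)}"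

definition factorization_hom :: "('a, 'b) monoid_scheme \<Rightarrow> 'a set multiset \<Rightarrow> 'a set" where
  "factorization_hom H z =
     finprod (reduced_monoid H) (\<lambda>u. u [^]\<^bsub>reduced_monoid H\<^esub> count z u) (set_mset z)"

definition factorizations :: "('a, 'b) monoid_scheme \<Rightarrow> 'a \<Rightarrow> 'a set multiset set" where
  "factorizations H a =
     {z \<in> factorization_monoid H. factorization_hom H z = Units H #>\<^bsub>H\<^esub> a}"

definition length_set :: "('a, 'b) monoid_scheme \<Rightarrow> 'a \<Rightarrow> nat set" where
  "length_set H a = size ` factorizations H a"

definition length_sets :: "('a, 'b) monoid_scheme \<Rightarrow> nat set set" where
  "length_sets H = length_set H ` carrier H"

definition union_of_lengths :: "('a, 'b) monoid_scheme \<Rightarrow> nat \<Rightarrow> nat set" where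
  "union_of_lengths H k = \<Union> {L \<in> length_sets H. k \<in> L}"


section \<open>Distances and elasticities\<close>

definition set_distances :: "int set \<Rightarrow> nat set" where
  "set_distances A = {d. 0 < d \<and> (\<exists>a\<in>A. A \<inter> {a..a + int d} = {a, a + int d})}"

definition monoid_distances :: "('a, 'b) monoid_scheme \<Rightarrow> nat set" where
  "monoid_distances H = (\<Union>L\<in>length_sets H. set_distances (int ` L))"

definition set_elasticity :: "nat set \<Rightarrow> ereal" where
  "set_elasticity A =
     (if A \<inter> {0<..} = {} then 1
      else (SUP n\<in>A \<inter> {0<..}. ereal (real n)) / ereal (real (LEAST n. n \<in> A \<inter> {0<..})))"

definition elasticity_set :: "('a, 'b) monoid_scheme \<Rightarrow> ereal set" where
  "elasticity_set H = set_elasticity ` length_sets H"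

definition monoid_elasticity :: "('a, 'b) monoid_scheme \<Rightarrow> ereal" where
  "monoid_elasticity H = Sup (elasticity_set H)"

definition accepted_elasticity :: "('a, 'b) monoid_scheme \<Rightarrow> bool" where
  "accepted_elasticity H \<longleftrightarrow> (\<exists>L\<in>length_sets H. set_elasticity L = monoid_elasticity H)"


section \<open>Catenary degrees\<close>

text \<open>For multisets, the differences in both directions are what remains after cancelling the
  greatest common divisor; see the lemma below.\<close>

definition factorization_dist :: "'c multiset \<Rightarrow> 'c multiset \<Rightarrow> nat" where
  "factorization_dist z z' = max (size (z - z')) (size (z' - z))"

lemma factorization_dist_eq:
  assumes "z = u + v" and "z' = u + w" and "set_mset v \<inter> set_mset w = {}"
  shows "factorization_dist z z' = max (size v) (size w)"
proof -
  have "v \<inter># w = {#}"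
    using assms(3) by (simp flip: set_mset_eq_empty_iff)
  then have "v - w = v" and "w - v = w"
    by (metis diff_intersect_left_idem diff_empty, metis diff_intersect_right_idem diff_empty)
  then show ?thesis
    using assms(1,2) by (simp add: factorization_dist_def)
qed

definition catenary_degree :: "('a, 'b) monoid_scheme \<Rightarrow> 'a \<Rightarrow> enat" where
  "catenary_degree H a =
     (LEAST N. \<forall>z\<in>factorizations H a. \<forall>z'\<in>factorizations H a.
        (\<lambda>x y. x \<in> factorizations H a \<and> y \<in> factorizations H a \<and>
               enat (factorization_dist x y) \<le> N)\<^sup>*\<^sup>* z z')"

definition catenary_degrees :: "('a, 'b) monoid_scheme \<Rightarrow> enat set" where
  "catenary_degrees H = {catenary_degree H a | a. a \<in> carrier H \<and> 0 < catenary_degree H a}"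


section \<open>Almost arithmetical (multi)progressions\<close>

text \<open>The central part of an almost arithmetical progression is a (finite or one-sided infinite)
  arithmetical progression with minimum 0, that is, the image of an initial segment
  of the natural numbers.\<close>

definition is_AAP :: "nat \<Rightarrow> nat \<Rightarrow> int set \<Rightarrow> bool" where
  "is_AAP d M L \<longleftrightarrow> 0 < d \<and>
     (\<exists>y L' Ls L''.
        (\<exists>I. (I = UNIV \<or> (\<exists>n. I = {..n})) \<and> Ls = (\<lambda>i::nat. int d * int i) ` I) \<and>
        L' \<subseteq> {- int M..-1} \<and>
        (if finite Ls then L'' \<subseteq> {Max Ls + 1..Max Ls + int M} else L'' = {}) \<and>
        L = (+) y ` (L' \<union> Ls \<union> L'') \<and>
        L \<subseteq> {y + int d * k | k. True})"

definition is_AAMP_period :: "nat \<Rightarrow> int set \<Rightarrow> nat \<Rightarrow> int set \<Rightarrow> bool" where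
  "is_AAMP_period d D M L \<longleftrightarrow> 0 < d \<and> {0, int d} \<subseteq> D \<and> D \<subseteq> {0..int d} \<and>
     (\<exists>y L' Ls L''.
        finite Ls \<and> Ls \<noteq> {} \<and> Min Ls = 0 \<and>
        Ls = {x + int d * k | x k. x \<in> D} \<inter> {0..Max Ls} \<and>
        L' \<subseteq> {- int M..-1} \<and>
        L'' \<subseteq> {Max Ls + 1..Max Ls + int M} \<and>
        L = (+) y ` (L' \<union> Ls \<union> L'') \<and>
        L \<subseteq> {y + x + int d * k | x k. x \<in> D})"

definition is_AAMP :: "nat \<Rightarrow> nat \<Rightarrow> int set \<Rightarrow> bool" where
  "is_AAMP d M L \<longleftrightarrow> (\<exists>D. is_AAMP_period d D M L)"


section \<open>The quotient and the factorization homomorphism behave as intended\<close>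

lemma (in comm_monoid) mult_unit_cosets:
  assumes "a \<in> carrier G" "b \<in> carrier G"
  shows "(Units G #> a) <#> (Units G #> b) = Units G #> (a \<otimes> b)"
proof
  show "(Units G #> a) <#> (Units G #> b) \<subseteq> Units G #> (a \<otimes> b)"
  proof
    fix x assume "x \<in> (Units G #> a) <#> (Units G #> b)"
    then obtain u v where uv: "u \<in> Units G" "v \<in> Units G" "x = (u \<otimes> a) \<otimes> (v \<otimes> b)"
      by (auto simp: set_mult_def r_coset_def)
    then have "x = (u \<otimes> v) \<otimes> (a \<otimes> b)" "u \<otimes> v \<in> Units G"
      using assms by (simp_all add: m_ac Units_closed)
    then show "x \<in> Units G #> (a \<otimes> b)"
      by (auto simp: r_coset_def)
  qed
  show "Units G #> (a \<otimes> b) \<subseteq> (Units G #> a) <#> (Units G #> b)"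
  proof
    fix x assume "x \<in> Units G #> (a \<otimes> b)"
    then obtain u where u: "u \<in> Units G" "x = u \<otimes> (a \<otimes> b)"
      by (auto simp: r_coset_def)
    then have "x = (u \<otimes> a) \<otimes> (\<one> \<otimes> b)"
      using assms by (simp add: m_ac Units_closed)
    then show "x \<in> (Units G #> a) <#> (Units G #> b)"
      using u(1) Units_one_closed by (auto simp: set_mult_def r_coset_def)
  qed
qed

lemma (in comm_monoid) unit_coset_one: "Units G #> \<one> = Units G"
  by (auto simp: r_coset_def Units_closed)

lemma (in comm_monoid) comm_monoid_reduced: "comm_monoid (reduced_monoid G)"
proof -
  have car: "carrier (reduced_monoid G) = (\<lambda>a. Units G #> a) ` carrier G"
    and mult: "monoid.mult (reduced_monoid G) = set_mult G"
    and one: "one (reduced_monoid G) = Units G #> \<one>"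
    by (simp_all add: reduced_monoid_def carrier_FactGroup unit_coset_one)
  show ?thesis
    by (rule comm_monoidI)
      (auto simp: car mult one mult_unit_cosets m_ac simp del: unit_coset_one)
qed

lemma (in comm_monoid) factorization_hom_empty:
  "factorization_hom G {#} = one (reduced_monoid G)"
proof -
  interpret R: comm_monoid "reduced_monoid G" by (rule comm_monoid_reduced)
  show ?thesis by (simp add: factorization_hom_def)
qed

lemma (in comm_monoid) factorization_hom_single:
  assumes "u \<in> monoid_atoms (reduced_monoid G)"
  shows "factorization_hom G {#u#} = u"
proof -
  interpret R: comm_monoid "reduced_monoid G" by (rule comm_monoid_reduced)
  have "u \<in> carrier (reduced_monoid G)"
    using assms by (simp add: monoid_atoms_def)
  then show ?thesis by (simp add: factorization_hom_def)
qed

lemma (in comm_monoid) factorization_hom_union: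
  assumes "z \<in> factorization_monoid G" "z' \<in> factorization_monoid G"
  shows "factorization_hom G (z + z') =
           factorization_hom G z \<otimes>\<^bsub>reduced_monoid G\<^esub> factorization_hom G z'"
proof -
  let ?R = "reduced_monoid G"
  interpret R: comm_monoid ?R by (rule comm_monoid_reduced)
  let ?S = "set_mset z \<union> set_mset z'"
  have S: "?S \<subseteq> carrier ?R"
    using assms by (auto simp: factorization_monoid_def monoid_atoms_def)
  have ext: "factorization_hom G y = finprod ?R (\<lambda>u. u [^]\<^bsub>?R\<^esub> count y u) ?S"
    if "set_mset y \<subseteq> ?S" for y
    unfolding factorization_hom_def
    using that S by (intro R.finprod_mono_neutral_cong_left) (auto simp: not_in_iff)
  have "factorization_hom G (z + z') =
          finprod ?R (\<lambda>u. u [^]\<^bsub>?R\<^esub> count z u \<otimes>\<^bsub>?R\<^esub> u [^]\<^bsub>?R\<^esub> count z' u) ?S"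
    unfolding ext[of "z + z'", simplified]
    using S by (intro R.finprod_cong') (auto simp: R.nat_pow_mult)
  also have "\<dots> = finprod ?R (\<lambda>u. u [^]\<^bsub>?R\<^esub> count z u) ?S \<otimes>\<^bsub>?R\<^esub>
                  finprod ?R (\<lambda>u. u [^]\<^bsub>?R\<^esub> count z' u) ?S"
    using S by (intro R.finprod_multf) auto
  finally show ?thesis
    by (simp add: ext)
qed

end

theory Submission
  imports Defs "HOL-Library.Multiset_Order"
begin

text \<open>
  All lengths depend only on the finite set \<open>A\<close> of atoms of the reduced monoid and on the congruence
  \<open>x \<sim> y\<close> ("the atoms in \<open>x\<close> and those in \<open>y\<close> have the same product") on the multisets over \<open>A\<close>.
  Unit-cancellativity of the monoid says that \<open>x \<sim> x + w\<close> forces \<open>w\<close> to be empty, and cancellativity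
  says that the congruence is cancellative. So the theorem is about congruences on \<open>\<nat>\<^sup>n\<close>, and the
  source of every finiteness claim is Dickson's lemma.

  Catenary degrees and distances. With respect to a well-order of the multisets that is compatible
  with addition, the multisets that are not least in their class form an upward closed set. It has
  finitely many minimal elements \<open>g\<close>, and each has a smaller partner \<open>h\<close> with \<open>g \<sim> h\<close>. Rewriting \<open>g\<close> to
  \<open>h\<close> inside larger multisets leads every multiset to the least element of its class, so
  factorizations are joined by steps of bounded distance (\<open>catenary_bound\<close>), and gaps between
  neighbouring lengths are bounded.

  Elasticity. A cancellative congruence is generated as a monoid by finitely many pairs
  (\<open>finite_generation\<close>), so the quotients of lengths are at most the largest quotient over the
  generators. An arbitrary congruence is contained in the cancellative one given by \<open>x + w \<sim> y + w\<close>
  for some \<open>w\<close>; the quotients of the latter are approached along \<open>n x + w \<sim> n y + w\<close>. Hence the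
  elasticity is rational.

  Unions of sets of lengths. All differences of lengths are multiples of the least distance \<open>d\<close>.
  Repeating a relation with lengths \<open>l\<close> and \<open>l + d\<close> yields a progression with difference \<open>d\<close> that is
  longer than any gap; adding it to a set of lengths fills all gaps. Since the largest and the least
  element of the \<open>k\<close>-th union are \<open>\<rho> k\<close> and \<open>k / \<rho>\<close> up to a bounded error, only bounded parts at both
  ends escape (\<open>unions_are_AAPs\<close>).

  Sets of lengths of cancellative monoids. If \<open>z\<close> is a shortest factorization, then every other one
  arises from \<open>z\<close> by applying disjointly some lengthening generators, so the set of lengths is a
  linear image of the lattice points of a packing polytope (\<open>len_minimal\<close>). The atoms are split into
  those with large and those with small multiplicity in \<open>z\<close>. Generators that use only the former can
  be combined almost freely and produce a long progression, whose difference is the gcd of their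
  length differences and is itself a distance; the other generators occur a bounded number of
  times and only contribute finitely many shifts (\<open>long_regime_AAMP\<close>).

  Sets of elasticities. A pair of a longest and a shortest factorization is a sum of generators, and
  the multisets of generators that occur form a downward closed set. By Dickson's lemma, generators
  with large multiplicity in such a multiset may be repeated arbitrarily. Let \<open>r\<close> be the least
  quotient of a generator that can be repeated arbitrarily. Only finitely many elasticities lie below
  any \<open>s < r\<close>. For a rational \<open>q = s / t\<close> between \<open>r\<close> and \<open>\<rho>\<close>, the quantity
  \<open>t max L - s min L\<close> changes sign slowly along a path of elements from one with quotient \<open>r\<close> to one
  with quotient \<open>\<rho>\<close>. An element where it is small but the lengths are huge must use two freely
  repeatable generators with quotients on both sides of \<open>q\<close>, and a suitable combination of these has
  elasticity exactly \<open>q\<close> (\<open>balanced_extremal\<close>).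
\<close>

section \<open>Dickson's lemma and arithmetic progressions\<close>

text \<open>
  Induction on the number of coordinates. Let \<open>F\<close> work for all coordinates but \<open>j\<close>, and let \<open>N\<close> bound
  coordinate \<open>j\<close> on \<open>F\<close>. Then \<open>F\<close> serves all points whose coordinate \<open>j\<close> is at least \<open>N\<close>, and the
  remaining points lie in finitely many slices with constant coordinate \<open>j\<close>.
\<close>

lemma dickson:
  fixes m :: "'i \<Rightarrow> 'x \<Rightarrow> nat"
  assumes "finite I"
  shows "\<exists>F\<subseteq>S. finite F \<and> (\<forall>s\<in>S. \<exists>f\<in>F. \<forall>i\<in>I. m i f \<le> m i s)"
  using assms
proof (induction I arbitrary: S rule: finite_induct)
  case empty
  show ?case
  proof (cases "S = {}")
    case False
    then obtain s where "s \<in> S" by blast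
    then show ?thesis by (intro exI[of _ "{s}"]) auto
  qed auto
next
  case (insert j I)
  obtain F where F: "F \<subseteq> S" "finite F" "\<forall>s\<in>S. \<exists>f\<in>F. \<forall>i\<in>I. m i f \<le> m i s"
    using insert.IH[of S] by blast
  define N where "N = (\<Sum>f\<in>F. m j f)"
  have N: "m j f \<le> N" if "f \<in> F" for f
    unfolding N_def using that F(2) by (simp add: member_le_sum)
  have "\<forall>k. \<exists>F'. F' \<subseteq> {s \<in> S. m j s = k} \<and> finite F' \<and>
      (\<forall>s\<in>{s \<in> S. m j s = k}. \<exists>f\<in>F'. \<forall>i\<in>I. m i f \<le> m i s)"
    using insert.IH by blast
  from choice[OF this] obtain Fk where Fk0: "\<forall>k. Fk k \<subseteq> {s \<in> S. m j s = k} \<and> finite (Fk k) \<and>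
      (\<forall>s\<in>{s \<in> S. m j s = k}. \<exists>f\<in>Fk k. \<forall>i\<in>I. m i f \<le> m i s)"
    by (rule exE)
  have Fk: "Fk k \<subseteq> {s \<in> S. m j s = k}" "finite (Fk k)"
    "s \<in> S \<Longrightarrow> m j s = k \<Longrightarrow> \<exists>f\<in>Fk k. \<forall>i\<in>I. m i f \<le> m i s" for k s
    using spec[OF Fk0, of k] by auto
  have "\<exists>f\<in>F \<union> (\<Union>k<N. Fk k). \<forall>i\<in>insert j I. m i f \<le> m i s" if "s \<in> S" for s
  proof (cases "m j s < N")
    case True
    obtain f where "f \<in> Fk (m j s)" "\<forall>i\<in>I. m i f \<le> m i s"
      using Fk(3)[OF \<open>s \<in> S\<close>] by blast
    moreover from this(1) have "m j f = m j s" using Fk(1) by blast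
    ultimately show ?thesis using True by (intro bexI[of _ f]) auto
  next
    case False
    obtain f where f: "f \<in> F" "\<forall>i\<in>I. m i f \<le> m i s" using F(3) \<open>s \<in> S\<close> by blast
    then have "m j f \<le> m j s" using N[of f] False by linarith
    then show ?thesis using f by auto
  qed
  moreover have "F \<union> (\<Union>k<N. Fk k) \<subseteq> S" using F(1) Fk(1) by blast
  moreover have "finite (F \<union> (\<Union>k<N. Fk k))" using F(2) Fk(2) by auto
  ultimately show ?case by blast
qed

lemma dickson_mset:
  assumes "finite A" "\<And>s. s \<in> S \<Longrightarrow> set_mset s \<subseteq> A"
  shows "\<exists>F\<subseteq>S. finite F \<and> (\<forall>s\<in>S. \<exists>f\<in>F. f \<subseteq># s)"
proof -
  obtain F where F: "F \<subseteq> S" "finite F" "\<forall>s\<in>S. \<exists>f\<in>F. \<forall>i\<in>A. count f i \<le> count s i"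
    using dickson[OF assms(1), of S "\<lambda>i s. count s i"] by blast
  have "\<exists>f\<in>F. f \<subseteq># s" if "s \<in> S" for s
  proof -
    obtain f where f: "f \<in> F" "\<forall>i\<in>A. count f i \<le> count s i" using F(3) \<open>s \<in> S\<close> by blast
    moreover have "count f i = 0" if "i \<notin> A" for i
      using assms(2)[of f] f(1) F(1) that by (meson not_in_iff subsetD)
    ultimately have "f \<subseteq># s" by (metis mset_subset_eqI le0)
    then show ?thesis using f(1) by blast
  qed
  then show ?thesis using F by blast
qed

lemma subgroup_generator:
  fixes D :: "int set"
  assumes diff: "\<And>x y. x \<in> D \<Longrightarrow> y \<in> D \<Longrightarrow> x - y \<in> D" and "x0 \<in> D" "x0 \<noteq> 0"
  obtains d where "0 < d" "d \<in> D" "\<forall>x\<in>D. d dvd x"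
proof -
  have zero: "0 \<in> D" using diff[OF assms(2,2)] by simp
  have neg: "- x \<in> D" if "x \<in> D" for x using diff[OF zero that] by simp
  define P where "P n \<longleftrightarrow> 0 < n \<and> int n \<in> D" for n
  have "P (nat \<bar>x0\<bar>)" using assms(2,3) neg by (auto simp: P_def abs_if)
  then have PL: "P (LEAST n. P n)" by (rule LeastI)
  define d where "d = int (LEAST n. P n)"
  have d: "0 < d" "d \<in> D" using PL by (auto simp: P_def d_def)
  have mult: "d * int k \<in> D" for k
  proof (induction k)
    case (Suc k)
    have "d * int k - (- d) \<in> D" using diff[OF Suc neg[OF d(2)]] .
    then show ?case by (simp add: algebra_simps)
  qed (simp add: zero)
  have multi: "d * k \<in> D" for k
    using mult[of "nat k"] neg[OF mult[of "nat (- k)"]] by (cases "0 \<le> k") auto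
  have "d dvd x" if "x \<in> D" for x
  proof -
    have "x - d * (x div d) \<in> D" using diff[OF that multi] .
    then have *: "x mod d \<in> D" by (simp add: minus_mult_div_eq_mod)
    have "\<not> 0 < x mod d"
    proof
      assume pos: "0 < x mod d"
      then have "P (nat (x mod d))" using * by (simp add: P_def)
      then have "(LEAST n. P n) \<le> nat (x mod d)" by (rule Least_le)
      then have "d \<le> x mod d" using pos unfolding d_def by linarith
      then show False using pos_mod_bound[OF d(1), of x] by linarith
    qed
    then show ?thesis using pos_mod_sign[OF d(1), of x] by (simp add: dvd_eq_mod_eq_0)
  qed
  then show ?thesis using that d by blast
qed

lemma Int_interval_endpoints:
  fixes S :: "int set"
  assumes "a \<in> S" "b \<in> S" "a \<le> b" "\<And>v. v \<in> S \<inter> {a..b} \<Longrightarrow> v = a \<or> v = b"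
  shows "S \<inter> {a..b} = {a, b}"
proof
  show "S \<inter> {a..b} \<subseteq> {a, b}" using assms(4) by blast
qed (use assms(1,2,3) in auto)

text \<open>
  If the gaps of \<open>V\<close> are at most \<open>m * d\<close>, then translating \<open>V\<close> by the progression
  \<open>0, d, \<dots>, m * d\<close> closes all gaps: \<open>x\<close> is reached from the largest element of \<open>V\<close> below it.
\<close>

lemma progression_cover:
  fixes V :: "int set"
  assumes "0 < d" and cong: "\<And>v. v \<in> V \<Longrightarrow> d dvd v - y" and "a \<in> V"
    and gap: "\<And>v. v \<in> V \<Longrightarrow> v < b \<Longrightarrow> \<exists>v'\<in>V. v < v' \<and> v' \<le> v + int m * d"
    and x: "a \<le> x" "x \<le> b + int m * d" "d dvd x - y"
  shows "\<exists>v\<in>V. \<exists>i\<le>m. x = v + int i * d"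
proof -
  let ?W = "V \<inter> {a..x}"
  have W: "finite ?W" "?W \<noteq> {}" using assms(3) x(1) by auto
  define v where "v = Max ?W"
  have v: "v \<in> V" "a \<le> v" "v \<le> x" using Max_in[OF W] by (auto simp: v_def)
  have vmax: "w \<le> v" if "w \<in> V" "a \<le> w" "w \<le> x" for w
    using Max_ge[OF W(1), of w] that by (auto simp: v_def)
  have le: "x - v \<le> int m * d"
  proof (cases "v < b")
    case True
    then obtain v' where "v' \<in> V" "v < v'" "v' \<le> v + int m * d" using gap v(1) by blast
    then show ?thesis using vmax[of v'] v(2) by (cases "v' \<le> x") auto
  qed (use x(2) in linarith)
  have "d dvd (x - y) - (v - y)" by (intro dvd_diff x(3) cong v(1))
  then obtain k where k: "x - v = d * k" by auto
  have "0 \<le> k"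
  proof (rule ccontr)
    assume "\<not> 0 \<le> k"
    then have "d * k < 0" using assms(1) by (simp add: mult_pos_neg)
    then show False using k v(3) by linarith
  qed
  moreover have "k \<le> int m" using le assms(1) by (simp add: k mult.commute)
  ultimately have "nat k \<le> m" "x = v + int (nat k) * d" using k by (auto simp: algebra_simps)
  then show ?thesis using v(1) by blast
qed

section \<open>Congruences on factorizations\<close>

text \<open>
  The relation \<open>x \<sim> y\<close> abstracts "\<open>x\<close> and \<open>y\<close> are factorizations of the same element". The last
  assumption is what remains of unit-cancellativity; in particular the classes are antichains.
\<close>

locale factor_congruence =
  fixes A :: "'b set" and sim :: "'b multiset \<Rightarrow> 'b multiset \<Rightarrow> bool" (infix "\<sim>" 50)
  assumes finite_atoms: "finite A"
    and sim_set: "x \<sim> y \<Longrightarrow> set_mset x \<subseteq> A"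
    and sim_refl: "set_mset x \<subseteq> A \<Longrightarrow> x \<sim> x"
    and sim_sym: "x \<sim> y \<Longrightarrow> y \<sim> x"
    and sim_trans [trans]: "x \<sim> y \<Longrightarrow> y \<sim> z \<Longrightarrow> x \<sim> z"
    and sim_add: "x \<sim> y \<Longrightarrow> set_mset w \<subseteq> A \<Longrightarrow> x + w \<sim> y + w"
    and sim_unit: "x \<sim> x + w \<Longrightarrow> w = {#}"
begin

lemma sim_set': "x \<sim> y \<Longrightarrow> set_mset y \<subseteq> A"
  using sim_set sim_sym by blast

lemma sim_add2:
  assumes "x \<sim> y" "x' \<sim> y'"
  shows "x + x' \<sim> y + y'"
proof -
  have "x + x' \<sim> y + x'" using sim_add[OF assms(1) sim_set[OF assms(2)]] .
  moreover have "y + x' \<sim> y + y'"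
    using sim_add[OF assms(2) sim_set'[OF assms(1)]] by (simp add: add.commute)
  ultimately show ?thesis by (rule sim_trans)
qed

lemma sim_repeat: "x \<sim> y \<Longrightarrow> repeat_mset n x \<sim> repeat_mset n y"
  by (induction n) (auto intro: sim_add2 sim_refl)

lemma sim_empty: "x \<sim> {#} \<Longrightarrow> x = {#}" "{#} \<sim> x \<Longrightarrow> x = {#}"
  using sim_unit[of "{#}" x] sim_sym by auto

abbreviation len :: "'b multiset \<Rightarrow> nat set" where
  "len z \<equiv> size ` {z'. z \<sim> z'}"

abbreviation dists :: "nat set" where
  "dists \<equiv> \<Union>z\<in>{z. set_mset z \<subseteq> A}. set_distances (int ` len z)"

text \<open>
  This is a version of Redei's theorem: congruences on \<open>\<nat>\<^sup>n\<close> are finitely generated. The proof is the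
  argument for Groebner bases, with multisets in place of monomials. The multiset order is used as
  monomial order, after the atoms have been numbered.
\<close>

lemma catenary_bound:
  "\<exists>N. \<forall>x y. x \<sim> y \<longrightarrow> (\<lambda>u v. u \<sim> v \<and> factorization_dist u v \<le> N)\<^sup>*\<^sup>* x y"
proof -
  obtain f :: "'b \<Rightarrow> nat" where f: "inj_on f A"
    using finite_imp_inj_to_nat_seg[OF finite_atoms] by metis
  define key where "key = image_mset f"
  have key_inj: "x = y" if "set_mset x \<subseteq> A" "set_mset y \<subseteq> A" "key x = key y" for x y
  proof -
    have "image_mset (inv_into A f) (key z) = z" if "set_mset z \<subseteq> A" for z
      unfolding key_def multiset.map_comp comp_def
      using multiset.map_cong[of z z "\<lambda>x. inv_into A f (f x)" "\<lambda>x. x"] that f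
      by (auto simp: subset_eq)
    then show ?thesis using that by metis
  qed
  define I where "I = {z. \<exists>z'. z \<sim> z' \<and> key z' < key z}"
  have "\<And>z. z \<in> I \<Longrightarrow> set_mset z \<subseteq> A" by (auto simp: I_def dest: sim_set)
  then obtain F where F: "F \<subseteq> I" "finite F" "\<forall>s\<in>I. \<exists>f\<in>F. f \<subseteq># s"
    using dickson_mset[OF finite_atoms] by meson
  have "\<forall>g\<in>F. \<exists>h. g \<sim> h \<and> key h < key g" using F(1) by (auto simp: I_def)
  from bchoice[OF this] obtain h where h0: "\<forall>g\<in>F. g \<sim> h g \<and> key (h g) < key g" by (rule exE)
  then have h: "g \<sim> h g" "key (h g) < key g" if "g \<in> F" for g using that h0 by auto
  define N where "N = (\<Sum>g\<in>F. size g + size (h g))"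
  have N: "size g + size (h g) \<le> N" if "g \<in> F" for g
    unfolding N_def by (rule member_le_sum[where f = "\<lambda>g. size g + size (h g)"]) (use that F(2) in auto)
  let ?R = "\<lambda>u v. u \<sim> v \<and> factorization_dist u v \<le> N"
  have nf: "\<exists>m. ?R\<^sup>*\<^sup>* z m \<and> z \<sim> m \<and> m \<notin> I" if "set_mset z \<subseteq> A" for z
    using that
  proof (induction "key z" arbitrary: z rule: less_induct)
    case less
    show ?case
    proof (cases "z \<in> I")
      case False
      then show ?thesis using sim_refl[OF less.prems] by blast
    next
      case True
      then obtain g where g: "g \<in> F" "g \<subseteq># z" using F(3) by blast
      define w where "w = z - g"
      have z: "z = g + w" using g(2) by (simp add: w_def)
      have w: "set_mset w \<subseteq> A" using less.prems by (auto simp: z)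
      have s: "z \<sim> h g + w" unfolding z by (rule sim_add[OF h(1)[OF g(1)] w])
      have "factorization_dist z (h g + w) \<le> N"
        using N[OF g(1)] size_mset_mono[OF diff_subset_eq_self, of g "h g"] size_mset_mono[OF diff_subset_eq_self, of "h g" g]
        by (simp add: z factorization_dist_def)
      then have R: "?R z (h g + w)" using s by simp
      have "key (h g + w) < key z"
        unfolding z using h(2)[OF g(1)] by (simp add: key_def)
      from less.hyps[OF this sim_set'[OF s]] obtain m where
        "?R\<^sup>*\<^sup>* (h g + w) m" "h g + w \<sim> m" "m \<notin> I" by blast
      then show ?thesis
        using s sim_trans converse_rtranclp_into_rtranclp[of ?R, OF R] by blast
    qed
  qed
  have symR: "symp ?R" by (rule sympI) (auto simp: factorization_dist_def sim_sym max.commute)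
  have "?R\<^sup>*\<^sup>* x y" if "x \<sim> y" for x y
  proof -
    note xy = sim_set[OF that] sim_set'[OF that]
    obtain m where m: "?R\<^sup>*\<^sup>* x m" "x \<sim> m" "m \<notin> I" using nf[OF xy(1)] by blast
    obtain m' where m': "?R\<^sup>*\<^sup>* y m'" "y \<sim> m'" "m' \<notin> I" using nf[OF xy(2)] by blast
    have mm: "m \<sim> m'" using that m(2) m'(2) sim_sym sim_trans by blast
    have "\<not> key m < key m'" "\<not> key m' < key m"
      using m(3) m'(3) mm sim_sym[OF mm] by (auto simp: I_def)
    then have eq: "m = m'" using key_inj[OF sim_set[OF mm] sim_set'[OF mm]] by force
    have "?R\<^sup>*\<^sup>* m' y" by (rule sympD[OF symp_rtranclp[OF symR] m'(1)])
    with m(1) show ?thesis unfolding eq by (rule rtranclp_trans)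
  qed
  then show ?thesis by blast
qed

text \<open>
  Along a chain with steps of distance at most \<open>N\<close>, the first member that is longer than the start
  exceeds it by at most \<open>N\<close>.
\<close>

lemma bounded_gaps:
  "\<exists>N>0. \<forall>x y. x \<sim> y \<and> size x < size y \<longrightarrow> (\<exists>z. x \<sim> z \<and> size x < size z \<and> size z \<le> size x + N)"
proof -
  obtain N where N: "\<And>x y. x \<sim> y \<Longrightarrow> (\<lambda>u v. u \<sim> v \<and> factorization_dist u v \<le> N)\<^sup>*\<^sup>* x y"
    using catenary_bound by blast
  have "\<exists>z. x \<sim> z \<and> size x < size z \<and> size z \<le> size x + Suc N" if xy: "x \<sim> y" "size x < size y" for x y
  proof -
    have "x \<sim> y \<and> (size y \<le> size x \<or> (\<exists>z. x \<sim> z \<and> size x < size z \<and> size z \<le> size x + Suc N))"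
      using N[OF xy(1)]
    proof (induction rule: rtranclp_induct)
      case base
      then show ?case using sim_refl sim_set[OF xy(1)] by simp
    next
      case (step u v)
      then have xv: "x \<sim> v" using sim_trans by blast
      have "v = (u \<inter># v) + (v - u)" by (rule multiset_eqI) simp
      then have "size v = size (u \<inter># v) + size (v - u)" using size_union by metis
      moreover have "size (u \<inter># v) \<le> size u" by (simp add: size_mset_mono)
      ultimately have "size v \<le> size u + N" using step(2) by (simp add: factorization_dist_def)
      then show ?case using step.IH xv by force
    qed
    then show ?thesis using xy(2) by auto
  qed
  then show ?thesis by (intro exI[of _ "Suc N"]) blast
qed

lemma dists_iff:
  "d \<in> dists \<longleftrightarrow> 0 < d \<and> (\<exists>x y. x \<sim> y \<and> size y = size x + d \<and>
     (\<forall>w. x \<sim> w \<longrightarrow> size w \<le> size x \<or> size y \<le> size w))" (is "_ = (_ \<and> ?R)")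
proof
  assume "d \<in> dists"
  then obtain z a where a: "0 < d" "a \<in> int ` len z" "int ` len z \<inter> {a..a + int d} = {a, a + int d}"
    by (auto simp: set_distances_def)
  then obtain x where x: "z \<sim> x" "a = int (size x)" by auto
  have "a + int d \<in> int ` len z" using a(3) by blast
  then obtain y where y: "z \<sim> y" "a + int d = int (size y)" by auto
  have "size w \<le> size x \<or> size y \<le> size w" if "x \<sim> w" for w
  proof (rule ccontr)
    assume *: "\<not> (size w \<le> size x \<or> size y \<le> size w)"
    have "int (size w) \<in> int ` len z" using sim_trans[OF x(1) that] by auto
    moreover have "int (size w) \<in> {a..a + int d}" using * x(2) y(2) by auto
    ultimately have "int (size w) \<in> {a, a + int d}" using a(3) by blast
    then show False using * x(2) y(2) by auto
  qed
  moreover have "x \<sim> y" using x(1) y(1) sim_sym sim_trans by blast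
  moreover have "size y = size x + d" using x(2) y(2) by linarith
  ultimately show "0 < d \<and> ?R" using a(1) by blast
next
  assume "0 < d \<and> ?R"
  then obtain x y where d: "0 < d" and xy: "x \<sim> y" "size y = size x + d"
    and w: "\<And>w. x \<sim> w \<Longrightarrow> size w \<le> size x \<or> size y \<le> size w" by blast
  have mem: "int (size x) \<in> int ` len x" "int (size x) + int d \<in> int ` len x"
    using xy sim_refl[OF sim_set[OF xy(1)]] by (force, force)
  moreover have "v = int (size x) \<or> v = int (size x) + int d"
    if "v \<in> int ` len x \<inter> {int (size x)..int (size x) + int d}" for v
  proof -
    from that obtain u where "x \<sim> u" "v = int (size u)" by auto
    then show ?thesis using w[of u] that xy(2) by auto
  qed
  ultimately have "int ` len x \<inter> {int (size x)..int (size x) + int d} = {int (size x), int (size x) + int d}"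
    by (intro Int_interval_endpoints) simp_all
  then have "d \<in> set_distances (int ` len x)" using d mem(1) unfolding set_distances_def by blast
  then show "d \<in> dists" using sim_set[OF xy(1)] by blast
qed

lemma finite_dists: "finite dists"
proof -
  obtain N where N: "\<And>x y. x \<sim> y \<and> size x < size y \<Longrightarrow>
      (\<exists>z. x \<sim> z \<and> size x < size z \<and> size z \<le> size x + N)"
    using bounded_gaps by blast
  have "d \<le> N" if "d \<in> dists" for d
  proof -
    from that obtain x y where xy: "0 < d" "x \<sim> y" "size y = size x + d"
      "\<And>w. x \<sim> w \<Longrightarrow> size w \<le> size x \<or> size y \<le> size w" unfolding dists_iff by blast
    then obtain w where "x \<sim> w" "size x < size w" "size w \<le> size x + N" using N[of x y] by auto
    then show ?thesis using xy(3) xy(4)[of w] by linarith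
  qed
  then show ?thesis by (meson finite_nat_set_iff_bounded_le)
qed

end

section \<open>Finitely many relations generate a cancellative congruence\<close>

text \<open>
  A multiset of pairs \<open>(x, y)\<close> with \<open>x \<sim> y\<close> stands for a formal sum of relations; \<open>src\<close> and \<open>tgt\<close> are
  the two sides of the relation obtained by adding them up.
\<close>

definition src :: "('b multiset \<times> 'b multiset) multiset \<Rightarrow> 'b multiset" where
  "src E = \<Sum>\<^sub># (image_mset fst E)"

definition tgt :: "('b multiset \<times> 'b multiset) multiset \<Rightarrow> 'b multiset" where
  "tgt E = \<Sum>\<^sub># (image_mset snd E)"

lemma src_tgt_simps [simp]:
  "src {#} = {#}" "tgt {#} = {#}"
  "src (add_mset g E) = fst g + src E" "tgt (add_mset g E) = snd g + tgt E"
  "src (E + F) = src E + src F" "tgt (E + F) = tgt E + tgt F"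
  by (auto simp: src_def tgt_def)

lemma src_repeat: "src (repeat_mset n E) = repeat_mset n (src E)"
  by (induction n) auto

lemma set_src: "set_mset (src E) = (\<Union>g\<in>set_mset E. set_mset (fst g))"
  by (induction E) auto

locale cancel_factor_congruence = factor_congruence +
  assumes sim_cancel: "x + w \<sim> y + w \<Longrightarrow> x \<sim> y"
begin

text \<open>
  In a cancellative congruence, the difference of two related pairs, one below the other, is again
  related. So subtracting pairs that are minimal among the nonempty ones ends at the empty pair.
\<close>

lemma finite_generation:
  "\<exists>G. finite G \<and> (\<forall>g\<in>G. fst g \<sim> snd g \<and> fst g \<noteq> {#}) \<and>
     (\<forall>x y. x \<sim> y \<longrightarrow> (\<exists>E. set_mset E \<subseteq> G \<and> x = src E \<and> y = tgt E))"
proof -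
  define S where "S = {g. fst g \<sim> snd g \<and> fst g \<noteq> {#}}"
  define m :: "'a + 'a \<Rightarrow> 'a multiset \<times> 'a multiset \<Rightarrow> nat" where
    "m i g = (case i of Inl a \<Rightarrow> count (fst g) a | Inr a \<Rightarrow> count (snd g) a)" for i g
  obtain G where G: "G \<subseteq> S" "finite G" "\<forall>s\<in>S. \<exists>g\<in>G. \<forall>i\<in>A <+> A. m i g \<le> m i s"
    using dickson[of "A <+> A" S m] finite_atoms by auto
  have below: "\<exists>g\<in>G. fst g \<subseteq># x \<and> snd g \<subseteq># y" if "x \<sim> y" "x \<noteq> {#}" for x y
  proof -
    have "(x, y) \<in> S" using that by (simp add: S_def)
    then obtain g where g: "g \<in> G" "\<forall>i\<in>A <+> A. m i g \<le> m i (x, y)" using G(3) by blast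
    have gs: "fst g \<sim> snd g" using g(1) G(1) by (auto simp: S_def)
    note gA = sim_set[OF gs] sim_set'[OF gs]
    have "count (fst g) a \<le> count x a" for a
    proof (cases "a \<in> A")
      case True
      then have "m (Inl a) g \<le> m (Inl a) (x, y)" using g(2) by blast
      then show ?thesis by (simp add: m_def)
    next
      case False
      then show ?thesis using gA(1) by (metis count_eq_zero_iff le0 subsetD)
    qed
    moreover have "count (snd g) a \<le> count y a" for a
    proof (cases "a \<in> A")
      case True
      then have "m (Inr a) g \<le> m (Inr a) (x, y)" using g(2) by blast
      then show ?thesis by (simp add: m_def)
    next
      case False
      then show ?thesis using gA(2) by (metis count_eq_zero_iff le0 subsetD)
    qed
    ultimately show ?thesis using g(1) by (blast intro: mset_subset_eqI)
  qed
  have "\<exists>E. set_mset E \<subseteq> G \<and> x = src E \<and> y = tgt E" if "x \<sim> y" for x y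
    using that
  proof (induction "size x" arbitrary: x y rule: less_induct)
    case less
    show ?case
    proof (cases "x = {#}")
      case True
      then have "y = {#}" using less.prems sim_empty by blast
      then show ?thesis using True by (intro exI[of _ "{#}"]) auto
    next
      case False
      then obtain g where g: "g \<in> G" "fst g \<subseteq># x" "snd g \<subseteq># y" using below less.prems by blast
      have gs: "fst g \<sim> snd g" "fst g \<noteq> {#}" using G(1) g(1) by (auto simp: S_def)
      define x' y' where "x' = x - fst g" and "y' = y - snd g"
      have xy: "x = x' + fst g" "y = y' + snd g" using g by (auto simp: x'_def y'_def)
      have "y' + snd g \<sim> y' + fst g"
        using sim_add[OF sim_sym[OF gs(1)], of y'] sim_set'[OF less.prems]
        by (simp add: xy add.commute)
      then have "x' + fst g \<sim> y' + fst g" using less.prems sim_trans unfolding xy by blast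
      then have "x' \<sim> y'" by (rule sim_cancel)
      moreover have "size x' < size x" using gs(2) by (simp add: xy nonempty_has_size)
      ultimately obtain E where E: "set_mset E \<subseteq> G" "x' = src E" "y' = tgt E"
        using less.hyps by blast
      then show ?thesis using g(1) by (intro exI[of _ "add_mset g E"]) (auto simp: xy)
    qed
  qed
  then show ?thesis using G unfolding S_def by (intro exI[of _ G]) blast
qed

end

locale cancel_generated = cancel_factor_congruence +
  fixes G :: "('a multiset \<times> 'a multiset) set"
  assumes finite_G: "finite G" and G_sim: "g \<in> G \<Longrightarrow> fst g \<sim> snd g"
    and G_nonempty: "g \<in> G \<Longrightarrow> fst g \<noteq> {#}"
    and generated: "x \<sim> y \<Longrightarrow> \<exists>E. set_mset E \<subseteq> G \<and> x = src E \<and> y = tgt E"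
begin

lemma snd_G_nonempty: "g \<in> G \<Longrightarrow> snd g \<noteq> {#}"
  using G_nonempty G_sim sim_empty by fastforce

lemma src_sim_tgt: "set_mset E \<subseteq> G \<Longrightarrow> src E \<sim> tgt E"
  by (induction E) (simp_all add: sim_refl sim_add2 G_sim)

definition rho :: real where
  "rho = Max (insert 1 ((\<lambda>g. real (size (fst g)) / real (size (snd g))) ` G))"

lemma rho_ge_1: "1 \<le> rho"
  unfolding rho_def by (rule Max_ge) (auto simp: finite_G)

text \<open>
  The bound holds for each generator and is preserved by sums (the mediant inequality).
\<close>

lemma size_le_rho:
  assumes "x \<sim> y" shows "real (size x) \<le> rho * real (size y)"
proof -
  have g: "real (size (fst g)) \<le> rho * real (size (snd g))" if "g \<in> G" for g
  proof -
    have "real (size (fst g)) / real (size (snd g)) \<le> rho"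
      unfolding rho_def by (rule Max_ge) (use that in \<open>auto simp: finite_G\<close>)
    moreover have "0 < size (snd g)" using snd_G_nonempty[OF that] by (simp add: nonempty_has_size)
    ultimately show ?thesis by (simp add: divide_le_eq)
  qed
  obtain E where E: "set_mset E \<subseteq> G" "x = src E" "y = tgt E" using generated[OF assms] by blast
  have "real (size (src E)) \<le> rho * real (size (tgt E))"
    using E(1) g by (induction E) (auto simp: algebra_simps intro: add_mono)
  then show ?thesis using E by simp
qed

lemma rho_attained:
  "rho = 1 \<or> (\<exists>g\<in>G. real (size (fst g)) = rho * real (size (snd g)))"
proof -
  have "rho \<in> insert 1 ((\<lambda>g. real (size (fst g)) / real (size (snd g))) ` G)"
    unfolding rho_def by (rule Max_in) (auto simp: finite_G)
  then consider "rho = 1" | g where "g \<in> G" "rho = real (size (fst g)) / real (size (snd g))" by blast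
  then show ?thesis
  proof cases
    case 2
    then have "real (size (fst g)) = rho * real (size (snd g))" using snd_G_nonempty[of g] by simp
    then show ?thesis using 2(1) by blast
  qed simp
qed

lemma rho_rational: "rho \<in> \<rat>"
proof -
  have "rho \<in> insert 1 ((\<lambda>g. real (size (fst g)) / real (size (snd g))) ` G)"
    unfolding rho_def by (rule Max_in) (auto simp: finite_G)
  then show ?thesis by auto
qed

end

context factor_congruence
begin

text \<open>
  The summand \<open>w\<close> acts as a catalyst: it allows the copies of \<open>x\<close> to be replaced by \<open>y\<close> one by one.
\<close>

lemma sim_repeat_add:
  assumes "x + w \<sim> y + w"
  shows "repeat_mset n x + w \<sim> repeat_mset n y + w"
proof (induction n)
  case 0
  then show ?case using sim_refl sim_set[OF assms] by simp
next
  case (Suc n)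
  have xA: "set_mset x \<subseteq> A" and yA: "set_mset (repeat_mset n y) \<subseteq> A"
    using sim_set[OF assms] sim_set'[OF Suc] by auto
  have "(repeat_mset n x + w) + x \<sim> (repeat_mset n y + w) + x" using sim_add[OF Suc xA] .
  also have "(repeat_mset n y + w) + x = (x + w) + repeat_mset n y" by simp
  also have "(x + w) + repeat_mset n y \<sim> (y + w) + repeat_mset n y" using sim_add[OF assms yA] .
  finally show ?case by (simp add: ac_simps)
qed

text \<open>
  This is the cancellative hull. It is still unit-cancellative since \<open>x + v \<sim> x + v + w\<close> forces \<open>w\<close>
  to be empty, and this makes the results on cancellative congruences available in general.
\<close>

lemma eventual_cancel_factor_congruence:
  "cancel_factor_congruence A (\<lambda>x y. \<exists>w. x + w \<sim> y + w)"
proof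
  fix x y z w :: "'b multiset"
  show "finite A" by (rule finite_atoms)
  show "\<exists>w. x + w \<sim> y + w \<Longrightarrow> set_mset x \<subseteq> A" using sim_set by fastforce
  show "set_mset x \<subseteq> A \<Longrightarrow> \<exists>w. x + w \<sim> x + w" using sim_refl[of x] by (metis add_0_right)
  show "\<exists>w. x + w \<sim> y + w \<Longrightarrow> \<exists>w. y + w \<sim> x + w" using sim_sym by blast
  show "\<exists>w. x + w \<sim> z + w" if xy: "\<exists>w. x + w \<sim> y + w" and yz: "\<exists>w. y + w \<sim> z + w"
  proof -
    obtain u where u: "x + u \<sim> y + u" using xy by blast
    obtain v where v: "y + v \<sim> z + v" using yz by blast
    have "set_mset v \<subseteq> A" "set_mset u \<subseteq> A" using sim_set[OF v] sim_set[OF u] by auto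
    then have "x + u + v \<sim> y + u + v" "y + v + u \<sim> z + v + u" using sim_add u v by blast+
    then have "x + (u + v) \<sim> z + (u + v)" using sim_trans by (simp add: ac_simps)
    then show ?thesis by blast
  qed
  show "\<exists>v. x + w + v \<sim> y + w + v" if xy: "\<exists>w. x + w \<sim> y + w" and w: "set_mset w \<subseteq> A"
  proof -
    obtain u where "x + u \<sim> y + u" using xy by blast
    from sim_add[OF this w] have "x + w + u \<sim> y + w + u" by (simp add: ac_simps)
    then show ?thesis by blast
  qed
  show "w = {#}" if ex: "\<exists>v. x + v \<sim> x + w + v"
  proof -
    obtain v where "x + v \<sim> x + w + v" using ex by blast
    then have "x + v \<sim> x + v + w" by (simp add: ac_simps)
    then show ?thesis by (rule sim_unit)
  qed
  show "\<exists>w. x + w \<sim> y + w" if "\<exists>v. x + w + v \<sim> y + w + v"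
    using that by (metis add.assoc)
qed

text \<open>
  The bound \<open>\<rho>\<close> is the one of the cancellative hull. It need not be attained by a relation, but by one
  that holds after adding some \<open>w\<close>, and this suffices for all asymptotic purposes.
\<close>

lemma elasticity_bound:
  obtains \<rho> where "\<rho> \<in> \<rat>" "1 \<le> \<rho>" "\<forall>x y. x \<sim> y \<longrightarrow> real (size x) \<le> \<rho> * real (size y)"
    "\<rho> = 1 \<or> (\<exists>x y w. x + w \<sim> y + w \<and> y \<noteq> {#} \<and> real (size x) = \<rho> * real (size y))"
proof -
  define sim' where "sim' = (\<lambda>x y. \<exists>w. x + w \<sim> y + w)"
  interpret C: cancel_factor_congruence A sim'
    unfolding sim'_def by (rule eventual_cancel_factor_congruence)
  obtain G where G: "finite G" "\<forall>g\<in>G. sim' (fst g) (snd g) \<and> fst g \<noteq> {#}"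
    "\<forall>x y. sim' x y \<longrightarrow> (\<exists>E. set_mset E \<subseteq> G \<and> x = src E \<and> y = tgt E)"
    using C.finite_generation by (elim exE conjE)
  interpret C: cancel_generated A sim' G by unfold_locales (use G in auto)
  show ?thesis
  proof (rule that[of C.rho])
    show "\<forall>x y. x \<sim> y \<longrightarrow> real (size x) \<le> C.rho * real (size y)"
    proof (intro allI impI)
      fix x y assume that: "x \<sim> y"
      have "x + {#} \<sim> y + {#}" using that by simp
      then have "sim' x y" unfolding sim'_def by (rule exI)
      then show "real (size x) \<le> C.rho * real (size y)" by (rule C.size_le_rho)
    qed
    show "C.rho = 1 \<or> (\<exists>x y w. x + w \<sim> y + w \<and> y \<noteq> {#} \<and> real (size x) = C.rho * real (size y))"
      using C.rho_attained
    proof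
      assume "\<exists>g\<in>G. real (size (fst g)) = C.rho * real (size (snd g))"
      then obtain g where g: "g \<in> G" "real (size (fst g)) = C.rho * real (size (snd g))" by blast
      obtain w where "fst g + w \<sim> snd g + w" using C.G_sim[OF g(1)] unfolding sim'_def by (rule exE)
      then show ?thesis using g(2) C.snd_G_nonempty[OF g(1)] by metis
    qed blast
  qed (rule C.rho_rational C.rho_ge_1)+
qed

lemma finite_len: "finite (len z)"
proof -
  obtain \<rho> where "\<rho> \<in> \<rat>" "1 \<le> \<rho>"
    and r: "\<forall>x y. x \<sim> y \<longrightarrow> real (size x) \<le> \<rho> * real (size y)"
    and "\<rho> = 1 \<or> (\<exists>x y w. x + w \<sim> y + w \<and> y \<noteq> {#} \<and> real (size x) = \<rho> * real (size y))"
    by (rule elasticity_bound)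
  have "n \<le> nat \<lceil>\<rho> * real (size z)\<rceil>" if "n \<in> len z" for n
  proof -
    from that obtain y where "z \<sim> y" "n = size y" by blast
    then have "real n \<le> \<rho> * real (size z)" using r sim_sym by blast
    then show ?thesis by linarith
  qed
  then show ?thesis by (meson finite_nat_set_iff_bounded_le)
qed

end

section \<open>Unions of sets of lengths\<close>

text \<open>
  The central progression consists of the members of \<open>k + d \<int>\<close> in the interval from \<open>lo\<close> to \<open>hi\<close>.
  Its minimum may exceed \<open>lo\<close> by almost \<open>d\<close>, and similarly at the upper end, so \<open>d\<close> is added to the bound.
\<close>

lemma is_AAP_interval:
  fixes U :: "int set" and d :: nat
  assumes "0 < d" and cong: "\<And>u. u \<in> U \<Longrightarrow> int d dvd u - k"
    and full: "\<And>x. lo \<le> x \<Longrightarrow> x \<le> hi \<Longrightarrow> int d dvd x - k \<Longrightarrow> x \<in> U"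
    and k: "lo \<le> k" "k \<le> hi" and bounds: "\<And>u. u \<in> U \<Longrightarrow> lo - M \<le> u \<and> u \<le> hi + M"
    and M: "M + int d \<le> int M'"
  shows "is_AAP d M' U"
proof -
  define D where "D = int d"
  have D: "0 < D" using assms(1) by (simp add: D_def)
  define y where "y = k - D * ((k - lo) div D)"
  have ymod: "y = lo + (k - lo) mod D"
    using mult_div_mod_eq[of D "k - lo"] unfolding y_def by linarith
  then have y: "lo \<le> y" "y < lo + D" using D by (auto simp: pos_mod_sign pos_mod_bound)
  have "0 \<le> D * ((k - lo) div D)" using D k(1) by (simp add: pos_imp_zdiv_nonneg_iff)
  then have yk: "y \<le> k" by (simp add: y_def)
  have yd: "D dvd k - y" by (simp add: y_def)
  define n where "n = nat ((hi - y) div D)"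
  have "0 \<le> (hi - y) div D" using D yk k(2) by (simp add: pos_imp_zdiv_nonneg_iff)
  then have n0: "int n = (hi - y) div D" by (simp add: n_def)
  have n: "y + D * int n \<le> hi" "hi < y + D * int n + D"
    using mult_div_mod_eq[of D "hi - y"] pos_mod_sign[OF D, of "hi - y"] pos_mod_bound[OF D, of "hi - y"]
    unfolding n0 by linarith+
  let ?Ls = "(\<lambda>i::nat. int d * int i) ` {..n}"
  define L1 where "L1 = {u - y | u. u \<in> U \<and> u < y}"
  define L2 where "L2 = {u - y | u. u \<in> U \<and> y + D * int n < u}"
  have fin: "finite ?Ls" by simp
  have Max: "Max ?Ls = D * int n"
    by (rule Max_eqI) (auto simp: D_def mult_left_mono)
  have Uy: "D dvd u - y" if "u \<in> U" for u
    using dvd_add[OF cong[OF that] yd[unfolded D_def]] by (simp add: D_def)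
  have "U = (+) y ` (L1 \<union> ?Ls \<union> L2)"
  proof
    show "U \<subseteq> (+) y ` (L1 \<union> ?Ls \<union> L2)"
    proof
      fix u assume u: "u \<in> U"
      consider "u < y" | "y + D * int n < u" | "y \<le> u" "u \<le> y + D * int n" by linarith
      then show "u \<in> (+) y ` (L1 \<union> ?Ls \<union> L2)"
      proof cases
        case 1
        then have "u - y \<in> L1" using u by (auto simp: L1_def)
        then show ?thesis by (intro image_eqI[of _ _ "u - y"]) auto
      next
        case 2
        then have "u - y \<in> L2" using u by (auto simp: L2_def)
        then show ?thesis by (intro image_eqI[of _ _ "u - y"]) auto
      next
        case 3
        obtain i where i: "u - y = D * i" using Uy[OF u] by auto
        have "0 \<le> i" using 3(1) i D by (metis diff_ge_0_iff_ge zero_le_mult_iff not_less order_less_imp_le)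
        moreover have "D * i \<le> D * int n" using i 3 by linarith
        then have "i \<le> int n" using D by simp
        ultimately have "u - y \<in> ?Ls" using i by (intro image_eqI[of _ _ "nat i"]) (auto simp: D_def)
        then show ?thesis by (intro image_eqI[of _ _ "u - y"]) auto
      qed
    qed
    have "y + D * int i \<in> U" if "i \<le> n" for i
    proof (rule full)
      have "D * int i \<le> D * int n" "0 \<le> D * int i" using that D by (auto simp: mult_left_mono)
      then show "lo \<le> y + D * int i" "y + D * int i \<le> hi" using n y by linarith+
      have "int d dvd D * int i - (k - y)"
        by (rule dvd_diff[OF _ yd[unfolded D_def]]) (simp add: D_def)
      then show "int d dvd y + D * int i - k" by (simp add: algebra_simps)
    qed
    then show "(+) y ` (L1 \<union> ?Ls \<union> L2) \<subseteq> U"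
      by (auto simp: L1_def L2_def D_def)
  qed
  moreover have "L1 \<subseteq> {- int M'..-1}"
    using bounds y M by (fastforce simp: L1_def D_def)
  moreover have "L2 \<subseteq> {Max ?Ls + 1..Max ?Ls + int M'}"
    unfolding Max using bounds n M by (fastforce simp: L2_def D_def)
  moreover have "U \<subseteq> {y + int d * k | k. True}"
    using Uy unfolding D_def by (fastforce elim!: dvdE simp: algebra_simps)
  ultimately show ?thesis
    unfolding is_AAP_def
    apply (intro conjI[OF assms(1)])
    apply (rule exI[of _ y], rule exI[of _ L1], rule exI[of _ ?Ls], rule exI[of _ L2])
    apply (intro conjI exI[of _ "{..n}"] disjI2)
    apply (simp_all only: if_P[OF fin])
    apply (rule exI, rule refl)
    done
qed

lemma is_AAP_singleton: "0 < d \<Longrightarrow> is_AAP d M {k}"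
  unfolding is_AAP_def
  by (intro conjI exI[of _ k] exI[of _ "{}"] exI[of _ "{0}"] exI[of _ "{..0::nat}"])
     (auto intro: exI[of _ 0])

context factor_congruence
begin

abbreviation lens_with :: "nat \<Rightarrow> nat set" where
  "lens_with k \<equiv> {size y | y. \<exists>x. x \<sim> y \<and> size x = k}"

lemma lens_withI: "x \<sim> y \<Longrightarrow> size y \<in> lens_with (size x)"
  by blast

text \<open>
  The differences of lengths of related multisets form a subgroup of the integers, because relations
  can be added. A relation that realizes the positive generator joins neighbouring lengths.
\<close>

lemma min_distance:
  assumes "x0 \<sim> y0" "size x0 \<noteq> size y0"
  obtains d p q where "d \<in> dists" "d = (LEAST d. d \<in> dists)" "q \<sim> p" "size p = size q + d"
    "\<forall>x y. x \<sim> y \<longrightarrow> int d dvd int (size y) - int (size x)"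
proof -
  define D where "D = {int (size y) - int (size x) | x y. x \<sim> y}"
  have "u - v \<in> D" if "u \<in> D" "v \<in> D" for u v
  proof -
    from that obtain x y x' y' where *: "x \<sim> y" "x' \<sim> y'"
      "u = int (size y) - int (size x)" "v = int (size y') - int (size x')" by (auto simp: D_def)
    have "x + y' \<sim> y + x'" by (rule sim_add2[OF *(1) sim_sym[OF *(2)]])
    moreover have "u - v = int (size (y + x')) - int (size (x + y'))" using * by simp
    ultimately show ?thesis unfolding D_def by blast
  qed
  moreover have "int (size y0) - int (size x0) \<in> D" unfolding D_def using assms(1) by blast
  moreover have "int (size y0) - int (size x0) \<noteq> 0" using assms(2) by simp
  ultimately obtain e where e: "0 < e" "e \<in> D" "\<forall>x\<in>D. e dvd x"
    by (rule subgroup_generator)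
  define d where "d = nat e"
  have ed: "e = int d" using e(1) by (simp add: d_def)
  obtain p q where pq: "q \<sim> p" "size p = size q + d" using e(1,2) ed by (auto simp: D_def)
  have dv: "int d dvd int (size y) - int (size x)" if "x \<sim> y" for x y
    using e(3) that unfolding ed D_def by blast
  have d0: "0 < d" using e(1) by (simp add: d_def)
  have "size w \<le> size q \<or> size p \<le> size w" if "q \<sim> w" for w
  proof (rule ccontr)
    assume "\<not> (size w \<le> size q \<or> size p \<le> size w)"
    then have "0 < int (size w) - int (size q)" "int (size w) - int (size q) < int d" using pq(2) by auto
    then show False using dv[OF that] zdvd_not_zless by blast
  qed
  then have dd: "d \<in> dists" unfolding dists_iff using d0 pq by blast
  have "d \<le> d'" if "d' \<in> dists" for d'
  proof -
    from that obtain x y where "0 < d'" "x \<sim> y" "size y = size x + d'" unfolding dists_iff by blast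
    then show ?thesis using dv[of x y] by (simp add: dvd_imp_le)
  qed
  then have "d = (LEAST d. d \<in> dists)" using dd by (intro Least_equality[symmetric]) auto
  then show ?thesis using that dd pq dv by blast
qed

lemma dists_empty_iff: "dists = {} \<longleftrightarrow> (\<forall>x y. x \<sim> y \<longrightarrow> size x = size y)"
proof
  assume "dists = {}"
  then show "\<forall>x y. x \<sim> y \<longrightarrow> size x = size y" using min_distance by (metis empty_iff)
next
  assume *: "\<forall>x y. x \<sim> y \<longrightarrow> size x = size y"
  have "d \<notin> dists" for d unfolding dists_iff using * by auto
  then show "dists = {}" by blast
qed

text \<open>
  Replacing \<open>i\<close> of the \<open>m\<close> copies of \<open>q\<close> by the longer \<open>p\<close> changes the length by \<open>i * d\<close>.
\<close>

lemma progression_element: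
  assumes "q \<sim> p" "size p = size q + d" "i \<le> m"
  shows "repeat_mset m q \<sim> repeat_mset i p + repeat_mset (m - i) q"
    and "size (repeat_mset i p + repeat_mset (m - i) q) = m * size q + i * d"
proof -
  have "repeat_mset m q = repeat_mset i q + repeat_mset (m - i) q"
    using assms(3) by (simp flip: repeat_mset_distrib)
  moreover have "repeat_mset (m - i) q \<sim> repeat_mset (m - i) q"
    by (rule sim_repeat) (rule sim_refl[OF sim_set[OF assms(1)]])
  ultimately show "repeat_mset m q \<sim> repeat_mset i p + repeat_mset (m - i) q"
    using sim_add2[OF sim_repeat[OF assms(1), of i]] by metis
  show "size (repeat_mset i p + repeat_mset (m - i) q) = m * size q + i * d"
    using assms(2,3) by (simp add: algebra_simps flip: add_mult_distrib2)
qed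

text \<open>
  The relations \<open>n x + w \<sim> n y + w\<close> have nearly optimal quotients of lengths. All other large \<open>k\<close> are
  reached from these by padding both sides with boundedly many copies of an atom.
\<close>

lemma union_bounds:
  assumes "A \<noteq> {}"
  obtains \<rho> C :: real where "1 \<le> \<rho>" "0 \<le> C"
    "\<forall>x y. x \<sim> y \<longrightarrow> real (size x) \<le> \<rho> * real (size y)"
    "\<forall>k. \<exists>l\<in>lens_with k. \<rho> * real k - C \<le> real l"
    "\<forall>k. \<exists>l\<in>lens_with k. real l \<le> real k / \<rho> + C"
proof -
  obtain u where u: "u \<in> A" using assms by blast
  obtain \<rho> where "\<rho> \<in> \<rat>" and r: "1 \<le> \<rho>"
    "\<forall>x y. x \<sim> y \<longrightarrow> real (size x) \<le> \<rho> * real (size y)"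
    "\<rho> = 1 \<or> (\<exists>x y w. x + w \<sim> y + w \<and> y \<noteq> {#} \<and> real (size x) = \<rho> * real (size y))"
    by (rule elasticity_bound)
  have self: "k \<in> lens_with k" for k
  proof -
    have "replicate_mset k u \<sim> replicate_mset k u" using u by (intro sim_refl) (auto split: if_splits)
    then show ?thesis by (metis (mono_tags, lifting) mem_Collect_eq size_replicate_mset)
  qed
  from r(3) show ?thesis
  proof
    assume "\<rho> = 1"
    show ?thesis
    proof (rule that[of 1 0])
      show "\<forall>x y. x \<sim> y \<longrightarrow> real (size x) \<le> 1 * real (size y)" using r(2) unfolding \<open>\<rho> = 1\<close> .
      show "\<forall>k. \<exists>l\<in>lens_with k. 1 * real k - 0 \<le> real l"
        by (intro allI bexI[OF _ self]) simp
      show "\<forall>k. \<exists>l\<in>lens_with k. real l \<le> real k / 1 + 0"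
        by (intro allI bexI[OF _ self]) simp
    qed simp_all
  next
    assume "\<exists>x y w. x + w \<sim> y + w \<and> y \<noteq> {#} \<and> real (size x) = \<rho> * real (size y)"
    then obtain x y w where xy: "x + w \<sim> y + w" "y \<noteq> {#}" "real (size x) = \<rho> * real (size y)" by blast
    have y0: "0 < size y" using xy(2) by (simp add: nonempty_has_size)
    then have "0 < real (size x)" unfolding xy(3) using r(1) by simp
    then have x0: "0 < size x" by simp
    define C where "C = \<rho> * (real (size w) + real (size y)) + real (size x)"
    have \<rho>0: "0 < \<rho>" using r(1) by simp
    have C0: "0 \<le> C" using r(1) by (simp add: C_def)
    have Cw: "\<rho> * real (size w) \<le> C" "real (size w) \<le> C"
    proof -
      have "real (size w) \<le> \<rho> * real (size w)" using r(1) by (simp add: mult_le_cancel_right1)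
      moreover have "0 \<le> \<rho> * real (size y)" using r(1) by simp
      moreover have "C = \<rho> * real (size w) + \<rho> * real (size y) + real (size x)"
        by (simp add: C_def algebra_simps)
      ultimately show "\<rho> * real (size w) \<le> C" "real (size w) \<le> C" by linarith+
    qed
    have pad: "repeat_mset n x + w + replicate_mset r u \<sim> repeat_mset n y + w + replicate_mset r u" for n r
      using sim_add[OF sim_repeat_add[OF xy(1)], of "replicate_mset r u"] u by (simp split: if_splits)
    have mem: "n * size y + size w + r \<in> lens_with (n * size x + size w + r)"
      "n * size x + size w + r \<in> lens_with (n * size y + size w + r)" for n r
      using lens_withI[OF pad[of n r]] lens_withI[OF sim_sym[OF pad[of n r]]]
      by (simp_all only: size_union size_repeat_mset size_replicate_mset)
    have up: "\<exists>l\<in>lens_with k. \<rho> * real k - C \<le> real l" for k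
    proof (cases "size w \<le> k")
      case True
      define n r where "n = (k - size w) div size y" and "r = (k - size w) mod size y"
      have k: "k = n * size y + size w + r" using True by (simp add: n_def r_def)
      have "r < size y" using y0 by (simp add: r_def)
      then have "\<rho> * (real (size w) + real r) \<le> \<rho> * (real (size w) + real (size y))"
        using r(1) by (intro mult_left_mono) auto
      then have "\<rho> * real k - C \<le> real (n * size x + size w + r)"
        unfolding k C_def using xy(3) by (simp add: algebra_simps)
      then show ?thesis using mem(2)[of n r] unfolding k by blast
    next
      case False
      then have "\<rho> * real k \<le> \<rho> * real (size w)" using r(1) by (intro mult_left_mono) auto
      then have "\<rho> * real k - C \<le> real k" using Cw(1) by linarith
      then show ?thesis using self[of k] by blast
    qed
    have down: "\<exists>l\<in>lens_with k. real l \<le> real k / \<rho> + C" for k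
    proof (cases "size w \<le> k")
      case True
      define n r where "n = (k - size w) div size x" and "r = (k - size w) mod size x"
      have k: "k = n * size x + size w + r" using True by (simp add: n_def r_def)
      have "r < size x" using x0 by (simp add: r_def)
      moreover have "real n * real (size y) \<le> real k / \<rho>"
        using \<rho>0 xy(3) unfolding k by (simp add: field_simps)
      moreover have "real (size w) + real (size x) \<le> C"
      proof -
        have "real (size w) \<le> \<rho> * real (size w)" using r(1) by (simp add: mult_le_cancel_right1)
        moreover have "0 \<le> \<rho> * real (size y)" using r(1) by simp
        moreover have "C = \<rho> * real (size w) + \<rho> * real (size y) + real (size x)"
          by (simp add: C_def algebra_simps)
        ultimately show ?thesis by linarith
      qed
      ultimately have "real (n * size y + size w + r) \<le> real k / \<rho> + C" by simp
      then show ?thesis using mem(1)[of n r] unfolding k by blast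
    next
      case False
      then have "real k \<le> C" using Cw(2) by linarith
      moreover have "0 \<le> real k / \<rho>" using \<rho>0 by simp
      ultimately show ?thesis using self[of k] by (intro bexI[of _ k]) auto
    qed
    show ?thesis by (rule that[OF r(1) C0 r(2)]) (use up down in \<open>simp_all only: all_simps simp_thms\<close>)
  qed
qed

lemma length_gap:
  obtains N where "0 < N"
    "\<forall>x. \<forall>v\<in>len x. \<forall>b\<in>len x. v < b \<longrightarrow> (\<exists>v'\<in>len x. v < v' \<and> v' \<le> v + N)"
proof -
  obtain N where N: "0 < N" "\<And>x y. x \<sim> y \<and> size x < size y \<Longrightarrow>
      (\<exists>z. x \<sim> z \<and> size x < size z \<and> size z \<le> size x + N)"
    using bounded_gaps by blast
  have "\<exists>v'\<in>len x. v < v' \<and> v' \<le> v + N" if vb: "v \<in> len x" "b \<in> len x" "v < b" for x v b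
  proof -
    obtain y z where yz: "x \<sim> y" "v = size y" "x \<sim> z" "b = size z" using vb by blast
    have "y \<sim> z" using sim_trans[OF sim_sym[OF yz(1)] yz(3)] .
    then obtain w where w: "y \<sim> w" "size y < size w" "size w \<le> size y + N"
      using N(2)[of y z] vb(3) yz by auto
    have "size w \<in> len x" using sim_trans[OF yz(1) w(1)] by blast
    then show ?thesis using w(2,3) yz(2) by blast
  qed
  then show ?thesis by (intro that[OF N(1)]) blast
qed

text \<open>
  A set of lengths that contains \<open>k - t\<close> and a nearly maximal element of the union for \<open>k - t\<close>,
  translated by the lengths \<open>t, t + d, \<dots>, t + m * d\<close> of one element, covers the upper half of the
  union for \<open>k\<close>; the lower half is obtained in the same way, now starting from
  the last of these lengths.
\<close>

theorem unions_are_AAPs: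
  assumes "A \<noteq> {}"
  shows "\<exists>M. \<forall>k>0. finite (lens_with k) \<and>
    (if dists = {} then \<forall>d>0. is_AAP d M (int ` lens_with k)
     else is_AAP (LEAST d. d \<in> dists) M (int ` lens_with k))"
proof -
  obtain \<rho> C where r0: "1 \<le> \<rho>" "0 \<le> C" "\<forall>x y. x \<sim> y \<longrightarrow> real (size x) \<le> \<rho> * real (size y)"
    "\<forall>k. \<exists>l\<in>lens_with k. \<rho> * real k - C \<le> real l"
    "\<forall>k. \<exists>l\<in>lens_with k. real l \<le> real k / \<rho> + C"
    by (rule union_bounds[OF assms])
  note r = r0[rule_format]
  have ub: "real l \<le> \<rho> * real k" "real k \<le> \<rho> * real l" if "l \<in> lens_with k" for k l
  proof -
    from that obtain x y where "x \<sim> y" "size x = k" "size y = l" by blast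
    then show "real l \<le> \<rho> * real k" "real k \<le> \<rho> * real l" using r(3) sim_sym by blast+
  qed
  have fin: "finite (lens_with k)" for k
  proof -
    have "l \<le> nat \<lceil>\<rho> * real k\<rceil>" if "l \<in> lens_with k" for l using ub(1)[OF that] by linarith
    then show ?thesis unfolding finite_nat_set_iff_bounded_le by blast
  qed
  show ?thesis
  proof (cases "dists = {}")
    case True
    have "int ` lens_with k = {int k}" for k
    proof -
      have "\<forall>x y. x \<sim> y \<longrightarrow> size x = size y" using True by (rule iffD1[OF dists_empty_iff])
      then have "lens_with k \<subseteq> {k}" by auto
      then have "lens_with k = {} \<or> lens_with k = {k}" by (rule subset_singletonD)
      moreover have "S \<noteq> {}" if "\<exists>l\<in>S. P l" for S :: "nat set" and P using that by blast
      from this[OF r(4)[of k]] have "lens_with k \<noteq> {}" .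
      ultimately have "lens_with k = {k}" by (simp only: simp_thms)
      then show ?thesis by simp
    qed
    then have "is_AAP d 0 (int ` lens_with k)" if "0 < d" for d k
      using is_AAP_singleton[OF that] by metis
    then show ?thesis using True fin by (intro exI[of _ 0]) auto
  next
    case False
    then obtain x0 y0 where "x0 \<sim> y0" "size x0 \<noteq> size y0" using dists_empty_iff by blast
    then obtain d p q where d: "d \<in> dists" "d = (LEAST d. d \<in> dists)"
      and qp: "q \<sim> p" "size p = size q + d"
      and dv0: "\<forall>x y. x \<sim> y \<longrightarrow> int d dvd int (size y) - int (size x)"
      by (rule min_distance)
    note dv = dv0[rule_format]
    have d0: "0 < d" using d(1) dists_iff by blast
    obtain m where m: "0 < m"
      "\<forall>x. \<forall>v\<in>len x. \<forall>b\<in>len x. v < b \<longrightarrow> (\<exists>v'\<in>len x. v < v' \<and> v' \<le> v + m)"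
      by (rule length_gap)
    define t where "t = m * size q"
    have step: "l + (t + i * d) \<in> lens_with (k + (t + j * d))"
      if that: "l \<in> lens_with k" "i \<le> m" "j \<le> m" for k l i j
    proof -
      obtain x y where xy: "x \<sim> y" "size x = k" "size y = l" using \<open>l \<in> lens_with k\<close> by blast
      let ?p = "\<lambda>i. repeat_mset i p + repeat_mset (m - i) q"
      have "?p j \<sim> ?p i"
        using progression_element(1)[OF qp] that(2,3) sim_sym sim_trans by blast
      then have "x + ?p j \<sim> y + ?p i" by (rule sim_add2[OF xy(1)])
      moreover have "size (x + ?p j) = k + (t + j * d)" "size (y + ?p i) = l + (t + i * d)"
        using progression_element(2)[OF qp] that(2,3) xy by (auto simp: t_def)
      ultimately show ?thesis by (metis (mono_tags, lifting) mem_Collect_eq)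
    qed
    have cover: "x \<in> int ` lens_with (k + (t + j * d))"
      if ab: "a \<in> len z" "b \<in> len z" "k \<in> len z" "j \<le> m"
        "int a + int t \<le> x" "x \<le> int b + int t + int m * int d" "int d dvd x - int t - int k" for x k j a b z
    proof -
      have len_mem: "l \<in> lens_with k" if "l \<in> len z" for l
      proof -
        obtain v w where "z \<sim> v" "size v = l" "z \<sim> w" "size w = k" using \<open>l \<in> len z\<close> ab(3) by blast
        then show ?thesis using sim_sym sim_trans by blast
      qed
      have "\<exists>v\<in>int ` len z. \<exists>i\<le>m. x - int t = v + int i * int d"
      proof (rule progression_cover[where y = "int k" and a = "int a" and b = "int b"])
        show "int d dvd v - int k" if "v \<in> int ` len z" for v
        proof -
          obtain l where l: "v = int l" "l \<in> len z" using \<open>v \<in> int ` len z\<close> by blast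
          obtain x y where "x \<sim> y" "size x = k" "size y = l" using len_mem[OF l(2)] by blast
          then show ?thesis using dv l(1) by blast
        qed
        show "\<exists>v'\<in>int ` len z. v < v' \<and> v' \<le> v + int m * int d"
          if v: "v \<in> int ` len z" "v < int b" for v
        proof -
          obtain l where l: "v = int l" "l \<in> len z" "l < b" using v by auto
          then obtain l' where l': "l' \<in> len z" "l < l'" "l' \<le> l + m" using m(2) ab(2) by blast
          have "m \<le> m * d" using d0 by simp
          then have "l' \<le> l + m * d" using l'(3) by linarith
          then have "int l' \<le> int l + int m * int d" by (metis of_nat_add of_nat_le_iff of_nat_mult)
          then show ?thesis using l' l(1) by (intro bexI[of _ "int l'"]) auto
        qed
      qed (use ab d0 in \<open>auto simp: algebra_simps\<close>)
      then obtain l i where li: "l \<in> len z" "i \<le> m" "x - int t = int l + int i * int d" by auto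
      have "x = int (l + (t + i * d))" using li(3) by simp
      then show ?thesis using step[OF len_mem[OF li(1)] li(2) ab(4)] by blast
    qed
    \<comment> \<open>The greatest length of the repeated relation; for smaller \<open>k\<close> the unions are bounded.\<close>
    define t' where "t' = t + m * d"
    define M where "M = \<lceil>C\<rceil> + \<lceil>\<rho> * real t'\<rceil> + int t'"
    have M0: "0 \<le> M" "C + \<rho> * real t' + real t' \<le> M" "int t' \<le> M"
    proof -
      have *: "0 \<le> \<rho> * real t'" using r(1) by simp
      have "real_of_int M = real_of_int \<lceil>C\<rceil> + real_of_int \<lceil>\<rho> * real t'\<rceil> + real t'" by (simp add: M_def)
      then show "C + \<rho> * real t' + real t' \<le> M"
        using le_of_int_ceiling[of C] le_of_int_ceiling[of "\<rho> * real t'"] by linarith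
      have "0 \<le> \<lceil>C\<rceil>" "0 \<le> \<lceil>\<rho> * real t'\<rceil>" using * r(2) by linarith+
      then show "0 \<le> M" "int t' \<le> M" by (auto simp: M_def)
    qed
    have "is_AAP d (nat (M + int d)) (int ` lens_with k)" if "0 < k" for k
    proof -
      have kk: "k \<in> lens_with k"
      proof -
        obtain x y where xy: "x \<sim> y" "size x = k" using r(4)[of k] by auto
        show ?thesis using lens_withI[OF sim_refl[OF sim_set[OF xy(1)]]] unfolding xy(2) .
      qed
      have dk: "int d dvd u - int k" if "u \<in> int ` lens_with k" for u using that dv by blast
      show ?thesis
      proof (cases "k < t'")
        case True
        have "\<rho> * real k \<le> \<rho> * real t'" using True r(1) by (intro mult_left_mono) auto
        then have "int k - M \<le> u \<and> u \<le> int k + M" if "u \<in> int ` lens_with k" for u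
        proof -
          obtain l where l: "u = int l" "l \<in> lens_with k" using \<open>u \<in> int ` lens_with k\<close> by blast
          have "real l \<le> \<rho> * real t'" using ub(1)[OF l(2)] \<open>\<rho> * real k \<le> \<rho> * real t'\<close> by linarith
          then have "real_of_int u \<le> M" using M0(2) r(2) l(1) by simp
          then have "u \<le> M" by simp
          moreover have "int k \<le> M" using True M0(3) by linarith
          ultimately show ?thesis using l(1) by simp
        qed
        then show ?thesis
          by (intro is_AAP_interval[where k = "int k" and lo = "int k" and hi = "int k" and M = M])
             (use d0 dk kk M0 in auto)
      next
        case False
        have upk: "k - t + (t + 0 * d) = k" using False by (simp add: t'_def)
        have dnk: "k - t' + (t + m * d) = k" using False by (simp add: t'_def)
        obtain l1 where l1: "l1 \<in> lens_with (k - t)" "\<rho> * real (k - t) - C \<le> real l1" using r(4) by blast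
        obtain l2 where l2: "l2 \<in> lens_with (k - t')" "real l2 \<le> real (k - t') / \<rho> + C" using r(5) by blast
        define hi where "hi = max (int k) (int (l1 + t))"
        define lo where "lo = min (int k) (int (l2 + t))"
        have full: "x \<in> int ` lens_with k" if x: "lo \<le> x" "x \<le> hi" "int d dvd x - int k" for x
        proof (cases "int k \<le> x")
          case True
          obtain z y where zy: "z \<sim> y" "size z = k - t" "size y = l1" using l1(1) by blast
          have zl: "k - t \<in> len z" "l1 \<in> len z"
            using zy sim_refl[OF sim_set[OF zy(1)]]
            by (auto intro: image_eqI[of _ size z] image_eqI[of _ size y])
          have md: "0 \<le> int m * int d" by simp
          show ?thesis
          proof (cases "x = int k")
            case False
            have kt: "int (k - t) = int k - int t" using \<open>\<not> k < t'\<close> by (simp add: t'_def of_nat_diff)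
            have "x \<in> int ` lens_with (k - t + (t + 0 * d))"
            proof (rule cover[OF zl zl(1) le0])
              show "int (k - t) + int t \<le> x" using True kt by linarith
              have "x \<le> int l1 + int t" using x(2) True False by (simp add: hi_def)
              then show "x \<le> int l1 + int t + int m * int d" using md by linarith
              show "int d dvd x - int t - int (k - t)" using x(3) kt by (simp add: algebra_simps)
            qed
            then show ?thesis unfolding upk .
          qed (use kk in auto)
        next
          case xk: False
          obtain z y where zy: "z \<sim> y" "size z = k - t'" "size y = l2" using l2(1) by blast
          have zl: "k - t' \<in> len z" "l2 \<in> len z"
            using zy sim_refl[OF sim_set[OF zy(1)]]
            by (auto intro: image_eqI[of _ size z] image_eqI[of _ size y])
          have md: "0 \<le> int m * int d" by simp
          have kt: "int (k - t') = int k - int t - int m * int d" using False by (simp add: t'_def of_nat_diff)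
          have "x \<in> int ` lens_with (k - t' + (t + m * d))"
          proof (rule cover[OF zl(2,1,1) order_refl])
            show "int l2 + int t \<le> x" using x(1) xk by (simp add: lo_def)
            show "x \<le> int (k - t') + int t + int m * int d" using xk unfolding kt by linarith
            have "int d dvd x - int k + int m * int d" using x(3) by simp
            moreover have "x - int t - int (k - t') = x - int k + int m * int d" unfolding kt by simp
            ultimately show "int d dvd x - int t - int (k - t')" by (simp only:)
          qed
          then show ?thesis unfolding dnk .
        qed
        have bounds: "lo - M \<le> u \<and> u \<le> hi + M" if "u \<in> int ` lens_with k" for u
        proof -
          obtain l where l: "u = int l" "l \<in> lens_with k" using \<open>u \<in> int ` lens_with k\<close> by blast
          have tt: "t \<le> t'" by (simp add: t'_def)
          have "real l \<le> \<rho> * real (k - t) + \<rho> * real t"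
            using ub(1)[OF l(2)] False tt by (simp add: of_nat_diff algebra_simps)
          also have "\<rho> * real t \<le> \<rho> * real t'" using tt r(1) by (intro mult_left_mono) auto
          finally have "real l \<le> real l1 + C + \<rho> * real t'" using l1(2) by linarith
          then have "real_of_int u \<le> real_of_int (int (l1 + t) + M)" using M0(2) l(1) by simp
          then have "u \<le> int (l1 + t) + M" by linarith
          moreover have "real (k - t') / \<rho> \<le> real k / \<rho>" using r(1) by (intro divide_right_mono) auto
          then have "real (k - t') / \<rho> \<le> real l" using ub(2)[OF l(2)] r(1) by (simp add: divide_le_eq mult.commute)
          then have "real l2 \<le> real l + C" using l2(2) by linarith
          moreover have "0 \<le> \<rho> * real t'" using r(1) by simp
          ultimately have "real_of_int (int (l2 + t) - M) \<le> real_of_int u"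
            using M0(2) l(1) tt by simp
          then have "int (l2 + t) - M \<le> u" by linarith
          with \<open>u \<le> int (l1 + t) + M\<close> show ?thesis by (auto simp: lo_def hi_def)
        qed
        show ?thesis
        proof (rule is_AAP_interval[OF d0 dk full _ _ bounds])
          show "lo \<le> int k" "int k \<le> hi" by (simp_all add: lo_def hi_def)
          show "M + int d \<le> int (nat (M + int d))" using M0(1) by simp
        qed
      qed
    qed
    then show ?thesis using fin False d(2) by (intro exI[of _ "nat (M + int d)"]) auto
  qed
qed

end

section \<open>Almost arithmetical multiprogressions\<close>

lemma is_AAMP_mono:
  assumes "is_AAMP d M L" "M \<le> M'" shows "is_AAMP d M' L"
proof -
  obtain D y L1 Ls L2 where *: "0 < d" "{0, int d} \<subseteq> D" "D \<subseteq> {0..int d}"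
    "finite Ls" "Ls \<noteq> {}" "Min Ls = 0" "Ls = {x + int d * k | x k. x \<in> D} \<inter> {0..Max Ls}"
    "L1 \<subseteq> {- int M..-1}" "L2 \<subseteq> {Max Ls + 1..Max Ls + int M}" "L = (+) y ` (L1 \<union> Ls \<union> L2)"
    "L \<subseteq> {y + x + int d * k | x k. x \<in> D}"
    using assms(1) unfolding is_AAMP_def is_AAMP_period_def by (elim exE conjE)
  have M': "L1 \<subseteq> {- int M'..-1}" "L2 \<subseteq> {Max Ls + 1..Max Ls + int M'}"
    using *(8,9) assms(2) by force+
  show ?thesis unfolding is_AAMP_def is_AAMP_period_def
    apply (rule exI[of _ D])
    apply (intro conjI *(1-3))
    apply (rule exI[of _ y], rule exI[of _ L1], rule exI[of _ Ls], rule exI[of _ L2])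
    apply (intro conjI *(4-6) *(7) M' *(10-11))
    done
qed

lemma is_AAMP_singleton:
  assumes "0 < d" shows "is_AAMP d M {k}"
proof -
  have "{0} = {x + int d * k | x k. x \<in> {0..int d}} \<inter> {0..Max {0}}"
    by (auto intro!: exI[of _ 0])
  then show ?thesis unfolding is_AAMP_def is_AAMP_period_def
    apply (intro exI[of _ "{0..int d}"])
    apply (intro conjI assms)
      apply simp
     apply simp
    apply (rule exI[of _ k], rule exI[of _ "{}"], rule exI[of _ "{0}"], rule exI[of _ "{}"])
    apply (intro conjI)
           apply simp_all
    apply (rule exI[of _ 0], simp)
    done
qed

text \<open>
  A nonempty set that agrees with a periodic set \<open>T\<close> on an interval and stays close to it is an AAMP.
  If the interval is shorter than the period, the set is bounded: a single point then serves as the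
  central part, and the full period \<open>[0, d]\<close> admits all other elements.
\<close>

lemma is_AAMP_interval:
  fixes L T :: "int set" and d :: nat
  assumes d: "0 < d" and L: "L \<noteq> {}" and per: "\<And>x k. x \<in> T \<Longrightarrow> x + int d * k \<in> T" and sub: "L \<subseteq> T"
    and full: "\<And>x. x \<in> T \<Longrightarrow> lo \<le> x \<Longrightarrow> x \<le> hi \<Longrightarrow> x \<in> L"
    and bounds: "\<And>u. u \<in> L \<Longrightarrow> lo - M \<le> u \<and> u \<le> hi + M"
    and M: "0 \<le> M" "2 * M + int d \<le> int M'"
  shows "is_AAMP d M' L"
proof -
  define P where "P = int d"
  have P: "0 < P" using d by (simp add: P_def)
  obtain u where u: "u \<in> L" using L by blast
  show ?thesis
  proof (cases "hi - lo < P")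
    case True
    define D where "D = {0..P}"
    define L1 L2 where "L1 = {v - u | v. v \<in> L \<and> v < u}" and "L2 = {v - u | v. v \<in> L \<and> u < v}"
    have near: "\<bar>v - u\<bar> \<le> int M'" if "v \<in> L" for v
      using bounds[OF that] bounds[OF u] True M by (auto simp: P_def)
    have res: "\<exists>x k. v = x + P * k \<and> x \<in> D" for v
      using mult_div_mod_eq[of P v] pos_mod_sign[OF P, of v] pos_mod_bound[OF P, of v]
      by (intro exI[of _ "v mod P"] exI[of _ "v div P"]) (simp add: D_def)
    have eq: "L = (+) u ` (L1 \<union> {0} \<union> L2)"
    proof
      show "L \<subseteq> (+) u ` (L1 \<union> {0} \<union> L2)"
      proof
        fix v assume "v \<in> L"
        then have "v - u \<in> L1 \<union> {0} \<union> L2" by (auto simp: L1_def L2_def)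
        then show "v \<in> (+) u ` (L1 \<union> {0} \<union> L2)" by (intro image_eqI[of _ _ "v - u"]) simp_all
      qed
    qed (use u in \<open>auto simp: L1_def L2_def\<close>)
    have L12: "L1 \<subseteq> {- int M'..-1}" "L2 \<subseteq> {Max {0} + 1..Max {0} + int M'}"
      using near by (fastforce simp: L1_def L2_def)+
    have sub0: "L \<subseteq> {u + x + P * k | x k. x \<in> D}"
    proof
      fix v assume "v \<in> L"
      obtain x k where "v - u = x + P * k" "x \<in> D" using res[of "v - u"] by blast
      then have "v = u + x + P * k" "x \<in> D" by auto
      then show "v \<in> {u + x + P * k | x k. x \<in> D}" by blast
    qed
    have Ls: "{0} = {x + P * k | x k. x \<in> D} \<inter> {0..Max {0}}"
      using res[of 0] by auto
    show ?thesis unfolding is_AAMP_def is_AAMP_period_def P_def[symmetric]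
      apply (rule exI[of _ D])
      apply (intro conjI d)
        apply (use P in \<open>simp add: D_def\<close>)
       apply (simp add: D_def)
      apply (rule exI[of _ u], rule exI[of _ L1], rule exI[of _ "{0}"], rule exI[of _ L2])
      apply (intro conjI L12 eq sub0 Ls)
        apply simp_all
      done
  next
    case False
    \<comment> \<open>The least member of \<open>u + P \<int>\<close> that is at least \<open>lo\<close>.\<close>
    define y where "y = lo + (u - lo) mod P"
    have "y = u + P * (- ((u - lo) div P))"
      using mult_div_mod_eq[of P "u - lo"] unfolding y_def by linarith
    then have yT: "y \<in> T" using per[of u "- ((u - lo) div P)"] sub u by (auto simp: P_def)
    have y: "lo \<le> y" "y < lo + P" "y \<le> hi"
      using pos_mod_sign[OF P, of "u - lo"] pos_mod_bound[OF P, of "u - lo"] False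
      unfolding y_def by linarith+
    define D where "D = {x \<in> {0..P}. y + x \<in> T}"
    define Ls where "Ls = {x \<in> {0..hi - y}. y + x \<in> T}"
    have per': "x + P * k \<in> T" if "x \<in> T" for x k using per[OF that] by (simp add: P_def)
    have D0: "{x + P * k | x k. x \<in> D} = {x. y + x \<in> T}"
    proof
      show "{x + P * k | x k. x \<in> D} \<subseteq> {x. y + x \<in> T}"
        using per' unfolding D_def by (auto simp: add.assoc[symmetric])
      show "{x. y + x \<in> T} \<subseteq> {x + P * k | x k. x \<in> D}"
      proof
        fix x assume "x \<in> {x. y + x \<in> T}"
        then have "y + x + P * (- (x div P)) \<in> T" using per'[of "y + x" "- (x div P)"] by simp
        also have "y + x + P * (- (x div P)) = y + x mod P"
          by (simp add: minus_mult_div_eq_mod)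
        finally have "x mod P \<in> D"
          using pos_mod_sign[OF P, of x] pos_mod_bound[OF P, of x] by (simp add: D_def)
        moreover have "x = x mod P + P * (x div P)" by simp
        ultimately show "x \<in> {x + P * k | x k. x \<in> D}" by blast
      qed
    qed
    have "Ls \<subseteq> {0..hi - y}" by (auto simp: Ls_def)
    then have fin: "finite Ls" by (rule finite_subset) simp
    have z: "0 \<in> Ls" using yT y by (simp add: Ls_def)
    then have ne: "Ls \<noteq> {}" by blast
    have Min: "Min Ls = 0" by (rule Min_eqI[OF fin _ z]) (simp add: Ls_def)
    have MaxLs: "Max Ls \<in> Ls" by (rule Max_in[OF fin ne])
    then have Max_le: "Max Ls \<le> hi - y" "0 \<le> Max Ls" by (auto simp: Ls_def)
    have "P * ((hi - y) div P) \<in> Ls"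
    proof -
      have "y + P * ((hi - y) div P) \<in> T" by (rule per'[OF yT])
      moreover have "0 \<le> P * ((hi - y) div P)" using P y by (simp add: pos_imp_zdiv_nonneg_iff)
      moreover have "P * ((hi - y) div P) \<le> hi - y"
        using mult_div_mod_eq[of P "hi - y"] pos_mod_sign[OF P, of "hi - y"] by linarith
      ultimately show ?thesis by (simp add: Ls_def)
    qed
    then have "P * ((hi - y) div P) \<le> Max Ls" by (rule Max_ge[OF fin])
    then have Max_gt: "hi - y - P < Max Ls"
      using mult_div_mod_eq[of P "hi - y"] pos_mod_bound[OF P, of "hi - y"] by linarith
    have Ls: "Ls = {x + P * k | x k. x \<in> D} \<inter> {0..Max Ls}"
    proof -
      have *: "x \<in> Ls \<longleftrightarrow> y + x \<in> T \<and> 0 \<le> x \<and> x \<le> Max Ls" for x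
        using Max_ge[OF fin, of x] Max_le(1) by (auto simp: Ls_def)
      show ?thesis unfolding D0
        by (rule Set.set_eqI) (unfold Int_iff mem_Collect_eq atLeastAtMost_iff, rule *)
    qed
    define L1 L2 where "L1 = {v - y | v. v \<in> L \<and> v < y}"
      and "L2 = {v - y | v. v \<in> L \<and> y + Max Ls < v}"
    have eq: "L = (+) y ` (L1 \<union> Ls \<union> L2)"
    proof
      show "L \<subseteq> (+) y ` (L1 \<union> Ls \<union> L2)"
      proof
        fix v assume v: "v \<in> L"
        have "v - y \<in> Ls" if "y \<le> v" "v \<le> y + Max Ls" using that v sub Max_le by (auto simp: Ls_def)
        moreover have "v - y \<in> L1" if "v < y" using that v unfolding L1_def by blast
        moreover have "v - y \<in> L2" if "y + Max Ls < v" using that v unfolding L2_def by blast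
        ultimately have "v - y \<in> L1 \<union> Ls \<union> L2" by (meson UnCI not_le)
        then show "v \<in> (+) y ` (L1 \<union> Ls \<union> L2)" by (intro image_eqI[of _ _ "v - y"]) simp_all
      qed
      have "y + x \<in> L" if "x \<in> Ls" for x using that y full[of "y + x"] by (auto simp: Ls_def)
      then show "(+) y ` (L1 \<union> Ls \<union> L2) \<subseteq> L" by (auto simp: L1_def L2_def)
    qed
    have L1: "L1 \<subseteq> {- int M'..-1}"
    proof
      fix x assume "x \<in> L1"
      then obtain v where v: "x = v - y" "v \<in> L" "v < y" by (auto simp: L1_def)
      have "lo - M \<le> v" using bounds[OF v(2)] by blast
      then have "- int M' \<le> x" using v(1) y(2) M unfolding P_def by linarith
      then show "x \<in> {- int M'..-1}" using v(1,3) by simp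
    qed
    have L2: "L2 \<subseteq> {Max Ls + 1..Max Ls + int M'}"
    proof
      fix x assume "x \<in> L2"
      then obtain v where v: "x = v - y" "v \<in> L" "y + Max Ls < v" by (auto simp: L2_def)
      have "v \<le> hi + M" using bounds[OF v(2)] by blast
      then have "x \<le> Max Ls + int M'" using v(1) Max_gt M unfolding P_def by linarith
      then show "x \<in> {Max Ls + 1..Max Ls + int M'}" using v(1,3) by simp
    qed
    have sub0: "L \<subseteq> {y + x + P * k | x k. x \<in> D}"
    proof
      fix v assume "v \<in> L"
      then have "v - y \<in> {x. y + x \<in> T}" using sub by auto
      then obtain x k where "v - y = x + P * k" "x \<in> D" unfolding D0[symmetric] by blast
      then have "v = y + x + P * k" "x \<in> D" by auto
      then show "v \<in> {y + x + P * k | x k. x \<in> D}" by blast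
    qed
    have "y + P \<in> T" using per'[OF yT, of 1] by simp
    then have D1: "{0, P} \<subseteq> D" "D \<subseteq> {0..P}" using yT P by (auto simp: D_def)
    show ?thesis unfolding is_AAMP_def is_AAMP_period_def P_def[symmetric]
      apply (rule exI[of _ D])
      apply (intro conjI d D1)
      apply (rule exI[of _ y], rule exI[of _ L1], rule exI[of _ Ls], rule exI[of _ L2])
      apply (intro conjI fin ne Min L1 L2 eq sub0)
      apply (rule Ls)
      done
  qed
qed

text \<open>
  Start with \<open>S = A\<close> and \<open>K = 0\<close>. As long as some element of \<open>S\<close> has a value below \<open>h K\<close>, it leaves \<open>S\<close>
  and \<open>K\<close> is raised to \<open>h K\<close>, which can happen at most \<open>card A\<close> times.
\<close>

lemma separating_threshold:
  fixes h c :: "_ \<Rightarrow> nat"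
  assumes "finite A" and h: "\<And>k. k \<le> h k"
  shows "\<exists>S\<subseteq>A. \<exists>K\<le>(h ^^ card A) 0. (\<forall>u\<in>A - S. c u \<le> K) \<and> (\<forall>u\<in>S. h K \<le> c u)"
proof -
  have "\<exists>S'\<subseteq>S. \<exists>i\<le>card S. (\<forall>u\<in>A - S'. c u \<le> (h ^^ i) K) \<and> (\<forall>u\<in>S'. h ((h ^^ i) K) \<le> c u)"
    if "S \<subseteq> A" "\<forall>u\<in>A - S. c u \<le> K" for S K
    using that
  proof (induction "card S" arbitrary: S K)
    case 0
    then have "S = {}" using finite_subset[OF 0(2) assms(1)] by simp
    then show ?case using 0 by (intro exI[of _ "{}"] conjI exI[of _ 0]) auto
  next
    case (Suc n)
    show ?case
    proof (cases "\<forall>u\<in>S. h K \<le> c u")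
      case True
      then show ?thesis using Suc.prems by (intro exI[of _ S] conjI exI[of _ 0]) auto
    next
      case False
      then obtain u where u: "u \<in> S" "c u < h K" by force
      have fin: "finite S" using finite_subset[OF Suc.prems(1) assms(1)] .
      have c: "n = card (S - {u})" using Suc.hyps(2) u(1) fin by simp
      have "\<forall>v\<in>A - (S - {u}). c v \<le> h K"
        using Suc.prems(2) u h[of K] by (metis Diff_iff insertCI insertE insert_Diff le_trans less_imp_le)
      then obtain S' i where S': "S' \<subseteq> S - {u}" "i \<le> n"
        "\<forall>u\<in>A - S'. c u \<le> (h ^^ i) (h K)" "\<forall>u\<in>S'. h ((h ^^ i) (h K)) \<le> c u"
        using Suc.hyps(1)[OF c, of "h K"] Suc.prems(1) unfolding c by blast
      have "(h ^^ Suc i) K = (h ^^ i) (h K)" by (simp add: funpow_swap1)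
      moreover have "Suc i \<le> card S" using S'(2) Suc.hyps(2) by linarith
      moreover have "S' \<subseteq> S" using S'(1) by blast
      ultimately show ?thesis using S'(3,4)
        by (intro exI[of _ S'] conjI exI[of _ "Suc i"]) simp_all
    qed
  qed
  from this[of A 0] obtain S i where S: "S \<subseteq> A" "i \<le> card A"
    "\<forall>u\<in>A - S. c u \<le> (h ^^ i) 0" "\<forall>u\<in>S. h ((h ^^ i) 0) \<le> c u" by auto
  have "(h ^^ i) 0 \<le> (h ^^ card A) 0"
    by (rule lift_Suc_mono_le[OF _ S(2)]) (simp add: h)
  then show ?thesis using S by blast
qed

lemma src_mono: "E \<subseteq># F \<Longrightarrow> src E \<subseteq># src F"
  by (metis mset_subset_eq_exists_conv src_tgt_simps(5))

lemma count_src_le_size: "count (src E) u \<le> size (src E)"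
  by (rule count_le_size)

text \<open>
  Each removed relation that uses the atom \<open>u\<close> lowers the consumption of \<open>u\<close> by at least one, and if
  no such relation is left, then \<open>u\<close> is not consumed at all.
\<close>

lemma room_at_atom:
  assumes "src E \<subseteq># z" "R \<le> count z u"
  shows "\<exists>E'. E' \<subseteq># E \<and> size E \<le> size E' + R \<and> count (src E') u + R \<le> count z u"
  using assms(2)
proof (induction R)
  case 0
  then show ?case using mset_subset_eq_count[OF assms(1)] by (intro exI[of _ E]) auto
next
  case (Suc R)
  then obtain E' where E': "E' \<subseteq># E" "size E \<le> size E' + R" "count (src E') u + R \<le> count z u" by auto
  show ?case
  proof (cases "count (src E') u + Suc R \<le> count z u")
    case True
    then show ?thesis using E' by (intro exI[of _ E']) auto
  next
    case False
    then have "0 < count (src E') u" using Suc.prems by linarith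
    then have "u \<in># src E'" by (simp add: count_greater_zero_iff)
    then obtain g where g: "g \<in># E'" "u \<in># fst g" unfolding set_src by blast
    define E'' where "E'' = E' - {#g#}"
    have E'g: "E' = add_mset g E''" using g(1) by (simp add: E''_def)
    have "0 < count (fst g) u" using g(2) by (simp add: count_greater_zero_iff)
    moreover have "count (src E') u = count (fst g) u + count (src E'') u" by (simp add: E'g)
    ultimately have "count (src E'') u + Suc R \<le> count z u" using E'(3) by linarith
    moreover have "E'' \<subseteq># E" using E'(1) unfolding E'g by (meson mset_subset_eq_add_mset_cancel mset_subset_eq_insertD subset_mset.less_imp_le)
    moreover have "size E \<le> size E'' + Suc R" using E'(2) by (simp add: E'g)
    ultimately show ?thesis by blast
  qed
qed

lemma room_at_atoms:
  assumes "finite S" "src E \<subseteq># z" "\<forall>u\<in>S. R \<le> count z u"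
  shows "\<exists>E'. E' \<subseteq># E \<and> size E \<le> size E' + card S * R \<and> (\<forall>u\<in>S. count (src E') u + R \<le> count z u)"
  using assms(1,3)
proof (induction S rule: finite_induct)
  case empty
  then show ?case by auto
next
  case (insert u S)
  then obtain E' where E': "E' \<subseteq># E" "size E \<le> size E' + card S * R"
    "\<forall>u\<in>S. count (src E') u + R \<le> count z u" by auto
  have "src E' \<subseteq># z" using src_mono[OF E'(1)] assms(2) by (rule subset_mset.order_trans)
  then obtain E'' where E'': "E'' \<subseteq># E'" "size E' \<le> size E'' + R" "count (src E'') u + R \<le> count z u"
    using room_at_atom[of E' z R u] insert.prems by auto
  have "count (src E'') v + R \<le> count z v" if "v \<in> S" for v
    using mset_subset_eq_count[OF src_mono[OF E''(1)], of v] E'(3) that by fastforce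
  moreover have "size E \<le> size E'' + card (insert u S) * R"
    using E'(2) E''(2) insert.hyps by simp
  ultimately show ?case using E''(1,3) E'(1) subset_mset.order_trans by blast
qed

text \<open>
  The subtraction is truncated, so relations that shorten have growth \<open>0\<close>.
\<close>

abbreviation growth :: "'b multiset \<times> 'b multiset \<Rightarrow> nat" where
  "growth g \<equiv> size (snd g) - size (fst g)"

definition total_growth :: "('b multiset \<times> 'b multiset) multiset \<Rightarrow> nat" where
  "total_growth E = (\<Sum>g\<in>#E. growth g)"

lemma total_growth_simps [simp]:
  "total_growth {#} = 0" "total_growth (add_mset g E) = growth g + total_growth E"
  "total_growth (E + F) = total_growth E + total_growth F"
  by (auto simp: total_growth_def)

lemma total_growth_repeat: "total_growth (repeat_mset n E) = n * total_growth E"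
  by (induction n) auto

lemma total_growth_le:
  assumes "\<And>g. g \<in># E \<Longrightarrow> growth g \<le> m" shows "total_growth E \<le> m * size E"
  using assms by (induction E) (auto simp: add_le_mono)

lemma total_growth_dvd:
  assumes "\<And>g. g \<in># E \<Longrightarrow> d dvd growth g" shows "d dvd total_growth E"
  using assms by (induction E) auto

context cancel_generated
begin

definition lengthening :: "('a multiset \<times> 'a multiset) set" where
  "lengthening = {g \<in> G. size (fst g) < size (snd g)}"

definition minimal :: "'a multiset \<Rightarrow> bool" where
  "minimal z \<longleftrightarrow> set_mset z \<subseteq> A \<and> (\<forall>y. z \<sim> y \<longrightarrow> size z \<le> size y)"

text \<open>
  Otherwise a part could be replaced by a shorter one.
\<close>

lemma minimal_sub:
  assumes "minimal z" "x \<subseteq># z" shows "minimal x"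
proof -
  define w where "w = z - x"
  have z: "z = x + w" using assms(2) by (simp add: w_def)
  have sets: "set_mset x \<subseteq> A" "set_mset w \<subseteq> A" using assms(1) by (auto simp: z minimal_def)
  have "size x \<le> size y" if "x \<sim> y" for y
  proof -
    have "z \<sim> y + w" unfolding z by (rule sim_add[OF that sets(2)])
    then have "size z \<le> size (y + w)" using assms(1) unfolding minimal_def by blast
    then show ?thesis by (simp add: z)
  qed
  then show ?thesis using sets by (simp add: minimal_def)
qed

lemma size_tgt_growth:
  assumes "\<And>g. g \<in># E \<Longrightarrow> size (fst g) \<le> size (snd g)"
  shows "size (tgt E) = size (src E) + total_growth E"
  using assms
proof (induction E)
  case (add g E)
  have "size (fst g) \<le> size (snd g)" using add.prems by simp
  moreover have "size (tgt E) = size (src E) + total_growth E" using add by simp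
  ultimately show ?case by simp
qed simp

text \<open>
  The relation between \<open>z\<close> and another factorization is a sum of generators. None of them shortens,
  because its left-hand side is part of the shortest factorization \<open>z\<close>; those that preserve
  the length can be omitted. Conversely, relations whose left-hand sides fit disjointly into \<open>z\<close> can
  be applied simultaneously.
\<close>

lemma len_minimal:
  assumes "minimal z"
  shows "len z = {size z + total_growth E | E. set_mset E \<subseteq> lengthening \<and> src E \<subseteq># z}"
proof (intro equalityI subsetI)
  fix n assume "n \<in> len z"
  then obtain y where y: "z \<sim> y" "n = size y" by blast
  obtain E where E: "set_mset E \<subseteq> G" "z = src E" "y = tgt E" using generated[OF y(1)] by blast
  have up: "size (fst g) \<le> size (snd g)" if "g \<in># E" for g
  proof -
    obtain F where F: "E = add_mset g F" using \<open>g \<in># E\<close> by (meson multi_member_split)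
    then have "fst g \<subseteq># z" using E(2) by simp
    then have "minimal (fst g)" by (rule minimal_sub[OF assms])
    moreover have "fst g \<sim> snd g" using G_sim E(1) \<open>g \<in># E\<close> by blast
    ultimately show ?thesis by (simp add: minimal_def)
  qed
  define F where "F = filter_mset (\<lambda>g. g \<in> lengthening) E"
  define F' where "F' = filter_mset (\<lambda>g. g \<notin> lengthening) E"
  have EF: "E = F + F'" by (simp add: F_def F'_def multiset_partition)
  have "growth g \<le> 0" if "g \<in># F'" for g
    using that up E(1) by (auto simp: F'_def lengthening_def)
  then have "total_growth F' \<le> 0 * size F'" by (rule total_growth_le)
  then have "total_growth E = total_growth F" by (simp add: EF)
  moreover have "n = size z + total_growth E" using size_tgt_growth[OF up] E y(2) by simp
  moreover have "set_mset F \<subseteq> lengthening" by (auto simp: F_def)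
  moreover have "src F \<subseteq># z" unfolding E(2) EF by simp
  ultimately show "n \<in> {size z + total_growth E | E. set_mset E \<subseteq> lengthening \<and> src E \<subseteq># z}" by auto
next
  fix n assume "n \<in> {size z + total_growth E | E. set_mset E \<subseteq> lengthening \<and> src E \<subseteq># z}"
  then obtain E where E: "n = size z + total_growth E" "set_mset E \<subseteq> lengthening" "src E \<subseteq># z" by blast
  have EG: "set_mset E \<subseteq> G" using E(2) by (auto simp: lengthening_def)
  have sz: "size (tgt E) = size (src E) + total_growth E"
    by (rule size_tgt_growth) (use E(2) in \<open>auto simp: lengthening_def\<close>)
  define w where "w = z - src E"
  have z: "z = src E + w" using E(3) by (simp add: w_def)
  have "set_mset w \<subseteq> A" using assms unfolding minimal_def by (auto simp: z)
  then have "z \<sim> tgt E + w" unfolding z by (rule sim_add[OF src_sim_tgt[OF EG]])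
  moreover have "size (tgt E + w) = n" using sz E(1) z by simp
  ultimately show "n \<in> len z" by blast
qed

definition lengthening_on :: "'a set \<Rightarrow> ('a multiset \<times> 'a multiset) set" where
  "lengthening_on S = {g \<in> lengthening. set_mset (fst g) \<subseteq> S}"

abbreviation inside where "inside S \<equiv> filter_mset (\<lambda>g. g \<in> lengthening_on S)"
abbreviation outside where "outside S \<equiv> filter_mset (\<lambda>g. g \<notin> lengthening_on S)"

lemma growth_period:
  assumes "lengthening_on S \<noteq> {}"
  obtains d p q where "0 < d" "set_mset p \<subseteq> lengthening_on S" "set_mset q \<subseteq> lengthening_on S"
    "total_growth p = total_growth q + d" "\<forall>g\<in>lengthening_on S. d dvd growth g"
proof -
  \<comment> \<open>Unlike the growths themselves, their differences form a group; its generator plays the role of the gcd.\<close>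
  define D where "D = {int (total_growth p) - int (total_growth q) | p q.
      set_mset p \<subseteq> lengthening_on S \<and> set_mset q \<subseteq> lengthening_on S}"
  obtain g0 where g0: "g0 \<in> lengthening_on S" using assms by blast
  have gD: "int (growth g) \<in> D" if "g \<in> lengthening_on S" for g
    unfolding D_def by (rule CollectI, rule exI[of _ "{#g#}"], rule exI[of _ "{#}"]) (use that in auto)
  have "u - v \<in> D" if uv: "u \<in> D" "v \<in> D" for u v
  proof -
    obtain p q p' q' where "set_mset p \<subseteq> lengthening_on S" "set_mset q \<subseteq> lengthening_on S"
      "set_mset p' \<subseteq> lengthening_on S" "set_mset q' \<subseteq> lengthening_on S"
      "u = int (total_growth p) - int (total_growth q)" "v = int (total_growth p') - int (total_growth q')"
      using uv unfolding D_def by blast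
    then show ?thesis unfolding D_def
      by (intro CollectI exI[of _ "p + q'"] exI[of _ "q + p'"]) auto
  qed
  moreover have "int (growth g0) \<noteq> 0" using g0 by (auto simp: lengthening_on_def lengthening_def)
  ultimately obtain e where e: "0 < e" "e \<in> D" "\<forall>x\<in>D. e dvd x"
    using subgroup_generator[OF _ gD[OF g0]] by (metis (no_types, lifting))
  obtain p q where pq: "e = int (total_growth p) - int (total_growth q)"
    "set_mset p \<subseteq> lengthening_on S" "set_mset q \<subseteq> lengthening_on S" using e(2) unfolding D_def by blast
  show ?thesis
  proof (rule that[of "nat e" p q])
    have "e dvd int (growth g)" if "g \<in> lengthening_on S" for g using e(3) gD[OF that] by blast
    then show "\<forall>g\<in>lengthening_on S. nat e dvd growth g" using e(1) by (simp add: nat_dvd_iff)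
  qed (use e(1) pq in auto)
qed

text \<open>
  The element with the factorization \<open>src p + src q\<close> only admits lengthening relations that are
  supported in \<open>S\<close>. Hence all its length differences are multiples of \<open>d\<close>, while \<open>p\<close> and \<open>q\<close>
  produce two lengths that differ by \<open>d\<close>.
\<close>

lemma growth_period_is_distance:
  assumes z: "minimal z" and d: "0 < d" and p: "set_mset p \<subseteq> lengthening_on S" and q: "set_mset q \<subseteq> lengthening_on S"
    and pq: "total_growth p = total_growth q + d" and dvd: "\<forall>g\<in>lengthening_on S. d dvd growth g"
    and le: "src p + src q \<subseteq># z"
  shows "d \<in> dists"
proof -
  define x where "x = src p + src q"
  have x: "minimal x" unfolding x_def by (rule minimal_sub[OF z le])
  have supp: "set_mset x \<subseteq> S" using p q by (auto simp: x_def set_src lengthening_on_def)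
  have lenx: "d dvd n - size x" "size x \<le> n" if n: "n \<in> len x" for n
  proof -
    obtain E where E: "n = size x + total_growth E" "set_mset E \<subseteq> lengthening" "src E \<subseteq># x"
      using n unfolding len_minimal[OF x] by blast
    have "set_mset (src E) \<subseteq> S" using supp set_mset_mono[OF E(3)] by blast
    then have "g \<in> lengthening_on S" if "g \<in># E" for g using that E(2) unfolding set_src lengthening_on_def by blast
    then have "d dvd total_growth E" using dvd by (intro total_growth_dvd) blast
    then show "d dvd n - size x" "size x \<le> n" using E(1) by auto
  qed
  have in_len: "size x + total_growth E \<in> len x" if "set_mset E \<subseteq> lengthening_on S" "src E \<subseteq># x" for E
    unfolding len_minimal[OF x] using that by (auto simp: lengthening_on_def)
  have "size x + total_growth q \<in> len x" "size x + total_growth p \<in> len x"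
    using in_len[OF q] in_len[OF p] by (auto simp: x_def)
  then obtain y1 y2 where y: "x \<sim> y1" "size y1 = size x + total_growth q"
    "x \<sim> y2" "size y2 = size x + total_growth p" by (metis (no_types, lifting) imageE mem_Collect_eq)
  have "size w \<le> size y1 \<or> size y2 \<le> size w" if "y1 \<sim> w" for w
  proof (rule ccontr)
    assume *: "\<not> (size w \<le> size y1 \<or> size y2 \<le> size w)"
    have "x \<sim> w" by (rule sim_trans[OF y(1) that])
    then have "size w \<in> len x" by blast
    then have "d dvd size w - size x" by (rule lenx)
    moreover have "d dvd total_growth q" using q dvd by (intro total_growth_dvd) blast
    ultimately have "d dvd (size w - size x) - total_growth q" by (rule dvd_diff_nat)
    moreover have "0 < (size w - size x) - total_growth q" "(size w - size x) - total_growth q < d"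
      using * y pq by auto
    ultimately show False using nat_dvd_not_less by blast
  qed
  moreover have "y1 \<sim> y2" by (rule sim_trans[OF sim_sym[OF y(1)] y(3)])
  moreover have "size y2 = size y1 + d" using y pq by simp
  ultimately show ?thesis unfolding dists_iff using d by blast
qed

text \<open>
  Every relation that is counted consumes an atom outside \<open>S\<close>, and these are scarce in \<open>z\<close>.
\<close>

lemma few_outside_support:
  assumes "set_mset E \<subseteq> lengthening" "src E \<subseteq># z" "set_mset z \<subseteq> A" "\<forall>u\<in>A - S. count z u \<le> K"
  shows "size (outside S E) \<le> card A * K"
proof -
  define F where "F = outside S E"
  have FE: "F \<subseteq># E" by (simp add: F_def)
  have FA: "set_mset (src F) \<subseteq> A" using src_mono[OF FE] assms(2,3) by (meson order_trans set_mset_mono subset_mset.order_trans)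
  have "size F' \<le> (\<Sum>u\<in>A - S. count (src F') u)" if "F' \<subseteq># F" for F'
    using that
  proof (induction F')
    case (add g F')
    have gF: "g \<in># F" using add.prems by (rule mset_subset_eq_insertD[THEN conjunct1])
    have "g \<notin> lengthening_on S" "g \<in> lengthening" using gF assms(1) by (auto simp: F_def)
    then obtain u where u: "u \<in># fst g" "u \<notin> S" by (auto simp: lengthening_on_def)
    then have uA: "u \<in> A - S" using gF FA unfolding set_src by blast
    have "F' \<subseteq># F" using add.prems by (meson mset_subset_eq_insertD subset_mset.less_imp_le)
    then have IH: "size F' \<le> (\<Sum>u\<in>A - S. count (src F') u)" by (rule add.IH)
    have "1 \<le> count (fst g) u" using u(1) by (simp add: Suc_le_eq count_greater_zero_iff)
    also have "\<dots> \<le> (\<Sum>u\<in>A - S. count (fst g) u)"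
      using uA finite_atoms by (intro member_le_sum) auto
    finally show ?case using IH by (simp add: sum.distrib)
  qed simp
  then have "size F \<le> (\<Sum>u\<in>A - S. count (src F) u)" by simp
  also have "\<dots> \<le> (\<Sum>u\<in>A - S. K)"
  proof (rule sum_mono)
    fix u assume "u \<in> A - S"
    have "count (src F) u \<le> count z u"
      using src_mono[OF FE] assms(2) by (meson mset_subset_eq_count subset_mset.order_trans)
    also have "count z u \<le> K" using assms(4) \<open>u \<in> A - S\<close> by blast
    finally show "count (src F) u \<le> K" .
  qed
  also have "\<dots> \<le> card A * K" using finite_atoms by (simp add: card_mono)
  finally show ?thesis by (simp add: F_def)
qed

text \<open>
  Only boundedly many lengthening relations can be applied, so the set of lengths is short and any
  difference will do.
\<close>

lemma short_regime_AAMP: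
  assumes "lengthening_on S = {}" "e \<in> dists"
  shows "\<exists>M. \<forall>z. minimal z \<and> (\<forall>u\<in>A - S. count z u \<le> K) \<longrightarrow> is_AAMP e M (int ` len z)"
proof -
  define m where "m = (\<Sum>g\<in>G. growth g)"
  define W where "W = m * (card A * K)"
  have e0: "0 < e" using assms(2) dists_iff by blast
  have "is_AAMP e (2 * W + e) (int ` len z)"
    if z: "minimal z" and K: "\<forall>u\<in>A - S. count z u \<le> K" for z
  proof (rule is_AAMP_interval[where T = UNIV and lo = "int (size z)" and hi = "int (size z)" and M = "int W", OF e0])
    have zA: "set_mset z \<subseteq> A" using z by (simp add: minimal_def)
    have mem: "size z \<in> len z" using sim_refl[OF zA] by blast
    then show "int ` len z \<noteq> {}" by blast
    show "x \<in> int ` len z" if "int (size z) \<le> x" "x \<le> int (size z)" for x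
      using mem that by force
    show "int (size z) - int W \<le> u \<and> u \<le> int (size z) + int W" if u: "u \<in> int ` len z" for u
    proof -
      obtain E where E: "u = int (size z + total_growth E)" "set_mset E \<subseteq> lengthening" "src E \<subseteq># z"
        using u unfolding len_minimal[OF z] by blast
      have "outside S E = E" using assms(1) by simp
      then have "size E \<le> card A * K" using few_outside_support[OF E(2,3) zA K] by simp
      moreover have "growth g \<le> m" if "g \<in># E" for g
        unfolding m_def
        by (rule member_le_sum[of g G growth]) (use that E(2) finite_G in \<open>auto simp: lengthening_def\<close>)
      then have "total_growth E \<le> m * size E" by (rule total_growth_le)
      ultimately have "total_growth E \<le> W" unfolding W_def by (meson mult_le_mono2 order_trans)
      then show ?thesis using E(1) by simp
    qed
  qed auto
  then show ?thesis by blast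
qed

text \<open>
  Let \<open>E\<close> be a way to reach the greatest length. Dropping from \<open>E\<close> the relations not supported in \<open>S\<close>
  and a bounded number of others leaves \<open>e'\<close>, after which every atom of \<open>S\<close> still has the
  remaining multiplicity \<open>R K\<close>. The
  lengths reached by parts of \<open>e'\<close> have gaps at most \<open>m\<close>, and the reserve is used
  for two purposes: combinations of \<open>p\<close> and \<open>q\<close> fill these gaps by multiples of \<open>d\<close>, and any
  admissible collection \<open>f\<close> of relations outside \<open>S\<close> can be applied to reach another residue class.
\<close>

lemma long_regime_AAMP:
  assumes "lengthening_on S \<noteq> {}" and SA: "S \<subseteq> A"
  shows "\<exists>h. \<forall>K. \<exists>M. \<forall>z. minimal z \<and> (\<forall>u\<in>A - S. count z u \<le> K) \<and> (\<forall>u\<in>S. h K \<le> count z u) \<longrightarrow>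
     (\<exists>d\<in>dists. is_AAMP d M (int ` len z))"
proof -
  obtain d p q where d: "0 < d" and p: "set_mset p \<subseteq> lengthening_on S" and q: "set_mset q \<subseteq> lengthening_on S"
    and pq: "total_growth p = total_growth q + d" and dvd: "\<forall>g\<in>lengthening_on S. d dvd growth g"
    by (rule growth_period[OF assms(1)])
  define m where "m = (\<Sum>g\<in>G. growth g)"
  define c where "c = (\<Sum>g\<in>G. size (fst g))"
  have m: "growth g \<le> m" if "g \<in> G" for g
    unfolding m_def by (rule member_le_sum[of g G growth]) (use that finite_G in auto)
  have c: "size (fst g) \<le> c" if "g \<in> G" for g
    unfolding c_def by (rule member_le_sum[of g G "\<lambda>g. size (fst g)"]) (use that finite_G in auto)
  have GG: "lengthening_on S \<subseteq> lengthening" "lengthening \<subseteq> G" by (auto simp: lengthening_on_def lengthening_def)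
  obtain g0 where g0: "g0 \<in> lengthening_on S" using assms(1) by blast
  have "0 < growth g0" using g0 by (simp add: lengthening_on_def lengthening_def)
  then have m0: "0 < m" using m[of g0] g0 GG by (meson less_le_trans subsetD)
  define B where "B = m * (size (src p) + size (src q))"
  \<comment> \<open>\<open>B\<close> pays for a combination of \<open>p\<close> and \<open>q\<close>, the first summand for the relations outside \<open>S\<close>.\<close>
  define R where "R K = c * (card A * K) + B" for K
  have grow_le: "total_growth E \<le> m * size E" if "set_mset E \<subseteq> G" for E
    by (rule total_growth_le) (use that m in blast)
  have supp: "count (src E) u = 0" if "set_mset E \<subseteq> lengthening_on S" "u \<notin> S" for E u
  proof -
    have "u \<notin># src E" using that unfolding set_src lengthening_on_def by blast
    then show ?thesis by (simp add: not_in_iff)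
  qed
  have src_le: "size (src E) \<le> c * size E" if "set_mset E \<subseteq> G" for E
    using that c by (induction E) (auto simp: add_le_mono)
  have main: "is_AAMP d M' (int ` len z) \<and> d \<in> dists"
    if z: "minimal z" and K: "\<forall>u\<in>A - S. count z u \<le> K" and big: "\<forall>u\<in>S. R K \<le> count z u"
      and M': "M' = 2 * (m * (card A * K) + m * total_growth q + m * (card A * R K)) + d" for z K M'
  proof
    have zA: "set_mset z \<subseteq> A" using z by (simp add: minimal_def)
    have "count (src p + src q) u \<le> count z u" for u
    proof (cases "u \<in> S")
      case True
      have "count (src p + src q) u \<le> size (src p) + size (src q)"
        using count_src_le_size[of p u] count_src_le_size[of q u] by simp
      also have "\<dots> \<le> B" unfolding B_def using m0 by simp
      also have "\<dots> \<le> count z u" using big True unfolding R_def by force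
      finally show ?thesis .
    qed (simp add: supp p q)
    then have "src p + src q \<subseteq># z" by (rule mset_subset_eqI)
    then show "d \<in> dists" by (rule growth_period_is_distance[OF z d p q pq dvd])
    have good: "set_mset (inside S E) \<subseteq> lengthening_on S" for E by auto
    have split: "E = inside S E + outside S E" for E
      by (rule multiset_partition)
    have dvd_good: "d dvd total_growth E" if "set_mset E \<subseteq> lengthening_on S" for E
      by (rule total_growth_dvd) (use that dvd in blast)
    have bad: "size (outside S E) \<le> card A * K"
      "total_growth (outside S E) \<le> m * (card A * K)"
      if E: "set_mset E \<subseteq> lengthening" "src E \<subseteq># z" for E
    proof -
      show s: "size (outside S E) \<le> card A * K"
        by (rule few_outside_support[OF E zA K])
      have "total_growth (outside S E) \<le> m * size (outside S E)"
        by (rule grow_le) (use E(1) GG in auto)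
      also have "\<dots> \<le> m * (card A * K)" using s by (rule mult_le_mono2)
      finally show "total_growth (outside S E) \<le> m * (card A * K)" .
    qed
    have ne: "size z \<in> len z" using sim_refl[OF zA] by blast
    then have Max: "Max (len z) \<in> len z" "\<And>n. n \<in> len z \<Longrightarrow> n \<le> Max (len z)"
      using finite_len[of z] by (auto intro: Max_in)
    obtain E where E: "Max (len z) = size z + total_growth E" "set_mset E \<subseteq> lengthening" "src E \<subseteq># z"
      using Max(1) unfolding len_minimal[OF z] by blast
    define e where "e = inside S E"
    have eE: "e \<subseteq># E" by (simp add: e_def)
    have eS: "set_mset e \<subseteq> lengthening_on S" by (auto simp: e_def)
    have e_src: "src e \<subseteq># z" using src_mono[OF eE] E(3) by (rule subset_mset.order_trans)
    obtain e' where e': "e' \<subseteq># e" "size e \<le> size e' + card S * R K"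
      "\<forall>u\<in>S. count (src e') u + R K \<le> count z u"
      using room_at_atoms[OF finite_subset[OF SA finite_atoms] e_src big] by blast
    have e'S: "set_mset e' \<subseteq> lengthening_on S" using set_mset_mono[OF e'(1)] eS by blast
    have grow_E: "total_growth E \<le> total_growth e' + m * (card A * R K) + m * (card A * K)"
    proof -
      define r where "r = e - e'"
      have er: "e = e' + r" using e'(1) by (simp add: r_def)
      have "set_mset r \<subseteq> G" using eS GG by (auto simp: er)
      then have "total_growth r \<le> m * size r" by (rule grow_le)
      also have "size r \<le> card S * R K" using e'(2) unfolding er by simp
      also have "card S * R K \<le> card A * R K" using card_mono[OF finite_atoms SA] by (rule mult_le_mono1)
      finally have "total_growth r \<le> m * (card A * R K)" by simp
      then have "total_growth e \<le> total_growth e' + m * (card A * R K)" by (simp add: er)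
      moreover have "total_growth E = total_growth e + total_growth (outside S E)"
        using split[of E] unfolding e_def by (metis total_growth_simps(3))
      ultimately show ?thesis using bad(2)[OF E(2,3)] by linarith
    qed
    define T where "T = {x. \<exists>F. set_mset F \<subseteq> lengthening \<and> src F \<subseteq># z \<and> int d dvd x - int (size z + total_growth F)}"
    show "is_AAMP d M' (int ` len z)"
    proof (rule is_AAMP_interval[where T = T and lo = "int (size z + m * (card A * K) + m * total_growth q)"
          and hi = "int (size z + total_growth e')"
          and M = "int (m * (card A * K) + m * total_growth q + m * (card A * R K))", OF d])
      show "int ` len z \<noteq> {}" using ne by blast
      show "x + int d * k \<in> T" if x: "x \<in> T" for x k
      proof -
        obtain F where F: "set_mset F \<subseteq> lengthening" "src F \<subseteq># z" "int d dvd x - int (size z + total_growth F)"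
          using x unfolding T_def by blast
        have "int d dvd (x - int (size z + total_growth F)) + int d * k" using F(3) by (rule dvd_add) simp
        then have "int d dvd x + int d * k - int (size z + total_growth F)" by (simp only: algebra_simps)
        then show ?thesis using F(1,2) unfolding T_def by blast
      qed
      show "int ` len z \<subseteq> T"
      proof
        fix x assume "x \<in> int ` len z"
        then obtain F where "x = int (size z + total_growth F)" "set_mset F \<subseteq> lengthening" "src F \<subseteq># z"
          unfolding len_minimal[OF z] by blast
        then show "x \<in> T" unfolding T_def by (intro CollectI exI[of _ F]) simp
      qed
      show "int (size z + m * (card A * K) + m * total_growth q) -
          int (m * (card A * K) + m * total_growth q + m * (card A * R K)) \<le> u \<and>
          u \<le> int (size z + total_growth e') + int (m * (card A * K) + m * total_growth q + m * (card A * R K))"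
        if u: "u \<in> int ` len z" for u
      proof -
        obtain n where n: "u = int n" "n \<in> len z" using u by blast
        obtain F where "n = size z + total_growth F" "set_mset F \<subseteq> lengthening" "src F \<subseteq># z" using n(2) unfolding len_minimal[OF z] by blast
        then have "int (size z) \<le> u" using n(1) by simp
        moreover have "n \<le> size z + total_growth E" using Max(2)[OF n(2)] E(1) by simp
        then have "u \<le> int (size z + total_growth e' + m * (card A * R K) + m * (card A * K))"
          using grow_E n(1) by linarith
        moreover have "int (a + c1 + c2) - int (c1 + c2 + c3) \<le> u \<and> u \<le> int (a + b) + int (c1 + c2 + c3)"
          if "int a \<le> u" "u \<le> int (a + b + c3 + c1)" for a b c1 c2 c3 :: nat
          using that by simp
        ultimately show ?thesis by blast
      qed
      show "x \<in> int ` len z" if x: "x \<in> T" "int (size z + m * (card A * K) + m * total_growth q) \<le> x"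
        "x \<le> int (size z + total_growth e')" for x
      proof -
        obtain F where F: "set_mset F \<subseteq> lengthening" "src F \<subseteq># z" "int d dvd x - int (size z + total_growth F)"
          using x(1) unfolding T_def by blast
        define f where "f = outside S F"
        have fF: "f \<subseteq># F" by (simp add: f_def)
        have fG: "set_mset f \<subseteq> lengthening" using F(1) by (auto simp: f_def)
        have "total_growth F = total_growth (inside S F) + total_growth f"
          using split[of F] unfolding f_def by (metis total_growth_simps(3))
        moreover have "int d dvd int (total_growth (inside S F))"
          using dvd_good[OF good] by simp
        ultimately have "int d dvd (x - int (size z + total_growth F)) +
            int (total_growth (inside S F))" using F(3) by (intro dvd_add)
        then have fd: "int d dvd x - int (size z) - int (total_growth f)"
          using \<open>total_growth F = _\<close> by (simp add: algebra_simps)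
        define V where "V = {int (total_growth e'') | e''. e'' \<subseteq># e'}"
        define X where "X = x - int (size z) - int (total_growth f) - int m * int (total_growth q)"
        have "\<exists>v\<in>V. \<exists>i\<le>m. X = v + int i * int d"
        proof (rule progression_cover[where y = 0 and a = 0 and b = "int (total_growth e')"])
          show "0 < int d" using d by simp
          show "int d dvd v - 0" if v: "v \<in> V" for v
          proof -
            obtain e'' where "v = int (total_growth e'')" "e'' \<subseteq># e'" using v unfolding V_def by blast
            moreover from this(2) have "set_mset e'' \<subseteq> lengthening_on S" using set_mset_mono e'S by blast
            ultimately show ?thesis using dvd_good by simp
          qed
          show "0 \<in> V" unfolding V_def by (intro CollectI exI[of _ "{#}"]) simp
          show "\<exists>v'\<in>V. v < v' \<and> v' \<le> v + int m * int d" if v: "v \<in> V" "v < int (total_growth e')" for v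
          proof -
            obtain e'' where e'': "v = int (total_growth e'')" "e'' \<subseteq># e'" using v unfolding V_def by blast
            then have "e'' \<noteq> e'" using v(2) by auto
            then have "e' - e'' \<noteq> {#}" using e''(2) by (metis subset_mset.diff_add add_0)
            then obtain g where g: "g \<in># e' - e''" by blast
            have gS: "g \<in> lengthening_on S" using g e'S by (meson in_diffD subsetD)
            have "{#g#} \<subseteq># e' - e''" using g by simp
            then have "add_mset g e'' \<subseteq># e'"
              using e''(2) by (metis add_mset_add_single mset_subset_eq_mono_add subset_mset.add_diff_inverse subset_mset.order_refl)
            then have "int (growth g + total_growth e'') \<in> V" unfolding V_def
              by (intro CollectI exI[of _ "add_mset g e''"]) simp
            moreover have "0 < growth g" using gS by (simp add: lengthening_on_def lengthening_def)
            moreover have "growth g \<le> m * d" using m[of g] gS GG d by (metis (no_types, lifting) le_trans mult.right_neutral mult_le_mono2 subsetD Suc_leI One_nat_def)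
            then have "int (growth g) \<le> int m * int d" by (metis of_nat_le_iff of_nat_mult)
            ultimately show ?thesis using e''(1) by (intro bexI[of _ "int (growth g + total_growth e'')"]) auto
          qed
          have "total_growth f \<le> m * (card A * K)" using bad(2)[OF F(1,2)] by (simp add: f_def)
          then have "int (total_growth f) \<le> int (m * (card A * K))" by (rule of_nat_mono)
          moreover have "int m * int (total_growth q) = int (m * total_growth q)" by simp
          ultimately show "0 \<le> X" using x(2) unfolding X_def of_nat_add by linarith
          have "0 \<le> int m * int d" "0 \<le> int m * int (total_growth q)" by simp_all
          then show "X \<le> int (total_growth e') + int m * int d" using x(3) unfolding X_def by linarith
          have "int d dvd int m * int (total_growth q)" using dvd_good[OF q] by simp
          then show "int d dvd X - 0" unfolding X_def using fd by simp
        qed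
        then obtain e'' i where e'': "e'' \<subseteq># e'" "i \<le> m" "X = int (total_growth e'') + int i * int d"
          unfolding V_def by blast
        define w where "w = repeat_mset i p + repeat_mset (m - i) q"
        have e''S: "set_mset e'' \<subseteq> lengthening_on S" using set_mset_mono[OF e''(1)] e'S by blast
        have rep: "set_mset (repeat_mset n E) \<subseteq> set_mset E" for n and E :: "('a multiset \<times> 'a multiset) multiset"
          by (induction n) auto
        have wS: "set_mset w \<subseteq> lengthening_on S" unfolding w_def using p q rep[of i p] rep[of "m - i" q] by auto
        have grow_w: "total_growth w = m * total_growth q + i * d"
        proof -
          have "total_growth w = (i + (m - i)) * total_growth q + i * d"
            by (simp add: w_def total_growth_repeat pq algebra_simps)
          then show ?thesis using e''(2) by simp
        qed
        have size_w: "size (src w) \<le> B"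
        proof -
          have "size (src w) = i * size (src p) + (m - i) * size (src q)"
            by (simp add: w_def src_repeat)
          also have "\<dots> \<le> m * size (src p) + m * size (src q)"
            using e''(2) by (intro add_le_mono mult_le_mono1) auto
          finally show ?thesis by (simp add: B_def algebra_simps)
        qed
        have "count (src (e'' + f + w)) u \<le> count z u" for u
        proof (cases "u \<in> S")
          case True
          have "count (src e'') u \<le> count (src e') u" by (rule mset_subset_eq_count[OF src_mono[OF e''(1)]])
          moreover have "count (src f) u \<le> c * (card A * K)"
          proof -
            have "count (src f) u \<le> size (src f)" by (rule count_src_le_size)
            also have "\<dots> \<le> c * size f" by (rule src_le) (use fG GG in blast)
            also have "\<dots> \<le> c * (card A * K)" using bad(1)[OF F(1,2)] unfolding f_def by (rule mult_le_mono2)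
            finally show ?thesis .
          qed
          moreover have "count (src w) u \<le> B" using count_src_le_size[of w u] size_w by linarith
          moreover have "count (src e') u + R K \<le> count z u" using e'(3) True by blast
          ultimately show ?thesis by (simp add: R_def)
        next
          case False
          have "src f \<subseteq># z" using src_mono[OF fF] F(2) by (rule subset_mset.order_trans)
          then show ?thesis using supp[OF e''S False] supp[OF wS False] by (simp add: mset_subset_eq_count)
        qed
        then have "src (e'' + f + w) \<subseteq># z" by (rule mset_subset_eqI)
        moreover have "set_mset (e'' + f + w) \<subseteq> lengthening" using e''S wS fG GG by auto
        ultimately have "size z + total_growth (e'' + f + w) \<in> len z" unfolding len_minimal[OF z] by blast
        moreover have "x = int (size z + total_growth (e'' + f + w))"
          using e''(3) unfolding X_def by (simp add: grow_w)
        ultimately show ?thesis by blast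
      qed
    qed (simp_all add: M')
  qed
  show ?thesis
  proof (rule exI[of _ R], rule allI)
    fix K
    define M' where "M' = 2 * (m * (card A * K) + m * total_growth q + m * (card A * R K)) + d"
    have "\<exists>d\<in>dists. is_AAMP d M' (int ` len z)"
      if "minimal z \<and> (\<forall>u\<in>A - S. count z u \<le> K) \<and> (\<forall>u\<in>S. R K \<le> count z u)" for z
      using main[OF conjunct1[OF that] conjunct1[OF conjunct2[OF that]] conjunct2[OF conjunct2[OF that]] M'_def]
      by (intro bexI[of _ d]) (rule conjunct1 conjunct2, assumption)+
    then show "\<exists>M. \<forall>z. minimal z \<and> (\<forall>u\<in>A - S. count z u \<le> K) \<and> (\<forall>u\<in>S. R K \<le> count z u) \<longrightarrow>
     (\<exists>d\<in>dists. is_AAMP d M (int ` len z))"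
      by (intro exI[of _ M'] allI impI)
  qed
qed

text \<open>
  Each class has a shortest factorization, and separating its large from its small multiplicities
  leaves finitely many choices for \<open>S\<close> and \<open>K\<close>, hence a common bound.
\<close>

theorem length_sets_are_AAMPs:
  "\<exists>M. \<forall>z. set_mset z \<subseteq> A \<longrightarrow>
     (if dists = {} then \<forall>d>0. is_AAMP d M (int ` len z) else \<exists>d\<in>dists. is_AAMP d M (int ` len z))"
proof (cases "dists = {}")
  case True
  then have same: "\<forall>x y. x \<sim> y \<longrightarrow> size x = size y" by (rule iffD1[OF dists_empty_iff])
  have "is_AAMP d 0 (int ` len z)" if z: "set_mset z \<subseteq> A" and d: "0 < d" for z d
  proof -
    have "size y = size z" if "z \<sim> y" for y using same that by metis
    then have "len z \<subseteq> {size z}" by blast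
    moreover have "{size z} \<subseteq> len z" using sim_refl[OF z] by blast
    ultimately have "len z = {size z}" by (rule equalityI)
    then have "int ` len z = {int (size z)}" by simp
    then show ?thesis using is_AAMP_singleton[OF d] by metis
  qed
  then show ?thesis using True by (intro exI[of _ 0]) simp
next
  case False
  then obtain e where e: "e \<in> dists" by blast
  let ?Q = "\<lambda>S h K M. \<forall>z. minimal z \<and> (\<forall>u\<in>A - S. count z u \<le> K) \<and> (\<forall>u\<in>S. h K \<le> count z u) \<longrightarrow>
     (\<exists>d\<in>dists. is_AAMP d M (int ` len z))"
  have "\<exists>h. \<forall>K. \<exists>M. ?Q S h K M" if "S \<in> Pow A" for S
  proof (cases "lengthening_on S = {}")
    case True
    show ?thesis using short_regime_AAMP[OF True e] e by metis
  next
    case False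
    then show ?thesis using long_regime_AAMP that by blast
  qed
  then have "\<forall>S\<in>Pow A. \<exists>h. \<forall>K. \<exists>M. ?Q S h K M" by (rule ballI)
  from bchoice[OF this] obtain h where h: "\<forall>S\<in>Pow A. \<forall>K. \<exists>M. ?Q S (h S) K M" by (rule exE)
  have "\<forall>S\<in>Pow A. \<exists>M. \<forall>K. ?Q S (h S) K (M K)" using h by (intro ballI choice) (rule bspec)
  from bchoice[OF this] obtain M where M: "\<forall>S\<in>Pow A. \<forall>K. ?Q S (h S) K (M S K)" by (rule exE)
  define H where "H K = K + (\<Sum>S\<in>Pow A. h S K)" for K
  have HK: "K \<le> H K" for K by (simp add: H_def)
  define Kmax where "Kmax = (H ^^ card A) 0"
  define N where "N = (\<Sum>S\<in>Pow A. \<Sum>K\<le>Kmax. M S K)"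
  have fin: "finite (Pow A)" using finite_atoms by simp
  have "\<exists>d\<in>dists. is_AAMP d N (int ` len z)" if zA: "set_mset z \<subseteq> A" for z
  proof -
    obtain z0 where z0: "z \<sim> z0" "\<And>y. z \<sim> y \<Longrightarrow> size z0 \<le> size y"
      using ex_has_least_nat[of "\<lambda>y. z \<sim> y" z size] sim_refl[OF zA] by blast
    have same: "z \<sim> y \<longleftrightarrow> z0 \<sim> y" for y using z0(1) sim_sym sim_trans by blast
    have min: "minimal z0" unfolding minimal_def using sim_set'[OF z0(1)] z0(2) same by blast
    obtain S K where S: "S \<subseteq> A" "K \<le> Kmax" "\<forall>u\<in>A - S. count z0 u \<le> K" "\<forall>u\<in>S. H K \<le> count z0 u"
      using separating_threshold[OF finite_atoms, of H "count z0"] HK unfolding Kmax_def by blast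
    have SP: "S \<in> Pow A" using S(1) by blast
    have "h S K \<le> (\<Sum>S\<in>Pow A. h S K)" using SP fin by (intro member_le_sum) auto
    then have "h S K \<le> H K" by (simp add: H_def)
    then have "\<forall>u\<in>S. h S K \<le> count z0 u" using S(4) by fastforce
    then obtain d where d: "d \<in> dists" "is_AAMP d (M S K) (int ` len z0)"       using mp[OF spec[OF spec[OF bspec[OF M SP], of K], of z0]] min S(3) by blast
    have "M S K \<le> (\<Sum>K\<le>Kmax. M S K)" using S(2) by (intro member_le_sum) auto
    also have "\<dots> \<le> N" unfolding N_def using SP fin by (intro member_le_sum[of S]) auto
    finally have "is_AAMP d N (int ` len z0)" by (rule is_AAMP_mono[OF d(2)])
    moreover have "len z = len z0" using same by simp
    ultimately show ?thesis using d(1) by auto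
  qed
  then show ?thesis by (intro exI[of _ N] allI impI) (unfold if_not_P[OF False])
qed

end

section \<open>Sets of elasticities\<close>

lemma set_elasticity_eq:
  assumes "finite L" "M \<in> L" "\<And>l. l \<in> L \<Longrightarrow> l \<le> M" "n \<in> L" "\<And>l. l \<in> L \<Longrightarrow> n \<le> l" "0 < n"
  shows "set_elasticity L = ereal (real M / real n)"
proof -
  have L: "L \<inter> {0<..} = L" using assms(5,6) by (force simp: less_le_trans)
  have "(SUP k\<in>L. ereal (real k)) = ereal (real M)"
    by (rule SUP_eqI) (use assms in auto)
  moreover have "(LEAST k. k \<in> L) = n" by (rule Least_equality) (use assms in auto)
  ultimately show ?thesis using assms(2,6) unfolding set_elasticity_def L by auto
qed

lemma sum_mset_over_superset:
  fixes f :: "'c \<Rightarrow> 'd :: comm_semiring_1"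
  assumes "finite G" "set_mset E \<subseteq> G"
  shows "(\<Sum>g\<in>#E. f g) = (\<Sum>g\<in>G. of_nat (count E g) * f g)"
  using assms(2)
proof (induction E)
  case (add g E)
  have g: "g \<in> G" using add.prems by simp
  have "(\<Sum>h\<in>G. of_nat (count (add_mset g E) h) * f h) =
        (\<Sum>h\<in>G. (if h = g then f h else 0) + of_nat (count E h) * f h)"
    by (rule sum.cong) (auto simp: algebra_simps)
  also have "\<dots> = f g + (\<Sum>h\<in>G. of_nat (count E h) * f h)"
    using g assms(1) by (simp add: sum.distrib sum.delta)
  finally show ?case using add by simp
qed simp

context factor_congruence
begin

definition max_len :: "'b multiset \<Rightarrow> nat" where
  "max_len z = Max (len z)"

definition min_len :: "'b multiset \<Rightarrow> nat" where
  "min_len z = Min (len z)"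

lemma max_len: "z \<sim> y \<Longrightarrow> size y \<le> max_len z"
  unfolding max_len_def by (rule Max_ge[OF finite_len]) blast

lemma min_len: "z \<sim> y \<Longrightarrow> min_len z \<le> size y"
  unfolding min_len_def by (rule Min_le[OF finite_len]) blast

lemma max_len_attained:
  assumes "set_mset z \<subseteq> A" obtains y where "z \<sim> y" "size y = max_len z"
proof -
  have "len z \<noteq> {}" using sim_refl[OF assms] by blast
  then have "max_len z \<in> len z" unfolding max_len_def by (rule Max_in[OF finite_len])
  then show ?thesis using that by force
qed

lemma min_len_attained:
  assumes "set_mset z \<subseteq> A" obtains y where "z \<sim> y" "size y = min_len z"
proof -
  have "len z \<noteq> {}" using sim_refl[OF assms] by blast
  then have "min_len z \<in> len z" unfolding min_len_def by (rule Min_in[OF finite_len])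
  then show ?thesis using that by force
qed

abbreviation elast :: "'b multiset \<Rightarrow> ereal" where
  "elast z \<equiv> set_elasticity (len z)"

lemma len_elasticity:
  assumes "set_mset z \<subseteq> A"
  shows "z = {#} \<Longrightarrow> elast z = 1"
    and "z \<noteq> {#} \<Longrightarrow> elast z = ereal (real (max_len z) / real (min_len z))"
    and "z \<noteq> {#} \<Longrightarrow> 0 < min_len z"
proof -
  show "elast z = 1" if z: "z = {#}"
  proof -
    have "\<forall>y. z \<sim> y \<longrightarrow> y = {#}" using sim_empty z by blast
    then have "len z \<inter> {0<..} = {}" by auto
    then show ?thesis by (simp add: set_elasticity_def)
  qed
  assume z: "z \<noteq> {#}"
  obtain y where y: "z \<sim> y" "size y = min_len z" using assms by (rule min_len_attained)
  then show pos: "0 < min_len z" using z sim_empty(1)[of z] by (metis nonempty_has_size)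
  obtain x where x: "z \<sim> x" "size x = max_len z" using assms by (rule max_len_attained)
  show "elast z = ereal (real (max_len z) / real (min_len z))"
  proof (rule set_elasticity_eq[OF finite_len _ _ _ _ pos])
    show "max_len z \<in> len z" "min_len z \<in> len z" using x y by (metis (mono_tags) image_eqI mem_Collect_eq)+
  qed (auto intro: max_len min_len)
qed

lemma elasticity_between:
  assumes "set_mset z \<subseteq> A" "\<forall>x y. x \<sim> y \<longrightarrow> real (size x) \<le> \<rho> * real (size y)" "1 \<le> \<rho>"
  shows "1 \<le> elast z \<and> elast z \<le> ereal \<rho>"
proof (cases "z = {#}")
  case True
  then show ?thesis using len_elasticity(1)[OF assms(1)] assms(3) by simp
next
  case False
  obtain x where x: "z \<sim> x" "size x = max_len z" using assms(1) by (rule max_len_attained)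
  obtain y where y: "z \<sim> y" "size y = min_len z" using assms(1) by (rule min_len_attained)
  have "x \<sim> y" by (rule sim_trans[OF sim_sym[OF x(1)] y(1)])
  then have "real (max_len z) \<le> \<rho> * real (min_len z)" using assms(2) x(2) y(2) by metis
  moreover have "min_len z \<le> max_len z" using max_len[OF y(1)] y(2) by simp
  ultimately show ?thesis using len_elasticity(2,3)[OF assms(1) False]
    by (simp add: divide_le_eq le_divide_eq)
qed

text \<open>
  For a relation \<open>n x + w \<sim> n y + w\<close> of the best quotient, the elasticity tends to \<open>\<rho>\<close> as \<open>n\<close> grows.
\<close>

lemma elasticity_Sup:
  "\<exists>\<rho>\<in>\<rat>. (SUP z\<in>{z. set_mset z \<subseteq> A}. elast z) = ereal \<rho>"
proof -
  obtain \<rho> where \<rho>: "\<rho> \<in> \<rat>" "1 \<le> \<rho>" "\<forall>x y. x \<sim> y \<longrightarrow> real (size x) \<le> \<rho> * real (size y)"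
    "\<rho> = 1 \<or> (\<exists>x y w. x + w \<sim> y + w \<and> y \<noteq> {#} \<and> real (size x) = \<rho> * real (size y))"
    by (rule elasticity_bound)
  define S where "S = (SUP z\<in>{z. set_mset z \<subseteq> A}. elast z)"
  have upper: "S \<le> ereal \<rho>" unfolding S_def
    by (rule SUP_least) (use elasticity_between \<rho>(2,3) in blast)
  have mem: "elast z \<le> S" if "set_mset z \<subseteq> A" for z
    unfolding S_def by (rule SUP_upper) (use that in simp)
  have "1 \<le> S" using mem[of "{#}"] len_elasticity(1)[of "{#}"] by simp
  have "ereal \<rho> \<le> S" using \<rho>(4)
  proof
    assume "\<rho> = 1"
    then show ?thesis using \<open>1 \<le> S\<close> by (simp add: one_ereal_def)
  next
    assume "\<exists>x y w. x + w \<sim> y + w \<and> y \<noteq> {#} \<and> real (size x) = \<rho> * real (size y)"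
    then obtain x y w where xyw: "x + w \<sim> y + w" "y \<noteq> {#}" "real (size x) = \<rho> * real (size y)" by blast
    show ?thesis
    proof (rule ccontr)
      assume "\<not> ereal \<rho> \<le> S"
      then have "S < ereal \<rho>" by simp
      then obtain s where s: "S = ereal s" "s < \<rho>" using \<open>1 \<le> S\<close> by (cases S) auto
      have y0: "0 < real (size y)" using xyw(2) by (simp add: nonempty_has_size)
      then have pos: "0 < (\<rho> - s) * real (size y)" using s(2) by simp
      have "1 \<le> s" using \<open>1 \<le> S\<close> s(1) by simp
      have *: "real n * ((\<rho> - s) * real (size y)) \<le> (s - 1) * real (size w)" if "0 < n" for n
      proof -
        let ?z = "repeat_mset n y + w"
        have sim: "repeat_mset n x + w \<sim> ?z" by (rule sim_repeat_add[OF xyw(1)])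
        have A: "set_mset ?z \<subseteq> A" by (rule sim_set'[OF sim])
        have ne: "?z \<noteq> {#}" using that xyw(2) by (cases n) auto
        have "ereal (real (max_len ?z) / real (min_len ?z)) \<le> ereal s"
          using mem[OF A] len_elasticity(2)[OF A ne] s(1) by simp
        then have "real (max_len ?z) \<le> s * real (min_len ?z)"
          using len_elasticity(3)[OF A ne] by (simp add: divide_le_eq)
        moreover have "real (min_len ?z) \<le> real (size ?z)"
          using min_len[OF sim_refl[OF A]] by (simp only: of_nat_le_iff)
        then have "s * real (min_len ?z) \<le> s * real (size ?z)"
          using \<open>1 \<le> s\<close> by (intro mult_left_mono) auto
        moreover have "real (size (repeat_mset n x + w)) \<le> real (max_len ?z)"
          using max_len[OF sim_sym[OF sim]] by (simp only: of_nat_le_iff)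
        ultimately have "real (size (repeat_mset n x + w)) \<le> s * real (size ?z)" by linarith
        then show ?thesis using xyw(3) by (simp add: algebra_simps)
      qed
      obtain n :: nat where n: "(s - 1) * real (size w) < real n * ((\<rho> - s) * real (size y))"
        using ex_less_of_nat_mult[OF pos] by blast
      moreover have "0 \<le> (s - 1) * real (size w)" using \<open>1 \<le> s\<close> by simp
      ultimately have "0 < n" by (cases n) auto
      then show False using *[of n] n by linarith
    qed
  qed
  then have "S = ereal \<rho>" using upper by simp
  then show ?thesis using \<rho>(1) unfolding S_def by blast
qed

end

context cancel_generated
begin

text \<open>
  A sum of generators that relates a longest to a shortest factorization of the same element.
\<close>

definition extremal :: "('a multiset \<times> 'a multiset) multiset \<Rightarrow> bool" where
  "extremal E \<longleftrightarrow> set_mset E \<subseteq> G \<and> size (src E) = max_len (src E) \<and> size (tgt E) = min_len (src E)"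

lemma src_set: "set_mset E \<subseteq> G \<Longrightarrow> set_mset (src E) \<subseteq> A"
  by (rule sim_set[OF src_sim_tgt])

lemma len_cong: "x \<sim> y \<Longrightarrow> len x = len y"
  using sim_sym sim_trans by (intro arg_cong[where f = "image size"]) blast

lemma extremal_exists:
  assumes "set_mset z \<subseteq> A"
  obtains E where "extremal E" "z \<sim> src E"
proof -
  obtain x where x: "z \<sim> x" "size x = max_len z" using assms by (rule max_len_attained)
  obtain y where y: "z \<sim> y" "size y = min_len z" using assms by (rule min_len_attained)
  obtain E where E: "set_mset E \<subseteq> G" "x = src E" "y = tgt E"
    using generated[OF sim_trans[OF sim_sym[OF x(1)] y(1)]] by blast
  have "extremal E" unfolding extremal_def using E x(2) y(2) len_cong[OF x(1)]
    by (simp add: max_len_def min_len_def)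
  then show ?thesis using that x(1) E(2) by blast
qed

lemma extremal_iff:
  "extremal E \<longleftrightarrow> set_mset E \<subseteq> G \<and>
     (\<forall>y. src E \<sim> y \<longrightarrow> size y \<le> size (src E) \<and> size (tgt E) \<le> size y)"
proof
  assume "extremal E"
  then show "set_mset E \<subseteq> G \<and> (\<forall>y. src E \<sim> y \<longrightarrow> size y \<le> size (src E) \<and> size (tgt E) \<le> size y)"
    unfolding extremal_def using max_len min_len by metis
next
  assume *: "set_mset E \<subseteq> G \<and> (\<forall>y. src E \<sim> y \<longrightarrow> size y \<le> size (src E) \<and> size (tgt E) \<le> size y)"
  then have A: "set_mset (src E) \<subseteq> A" using src_set by blast
  have "size (src E) = max_len (src E)"
    using * max_len[OF sim_refl[OF A]] max_len_attained[OF A] by (metis order_antisym)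
  moreover have "size (tgt E) = min_len (src E)"
    using * min_len[OF src_sim_tgt[of E]] min_len_attained[OF A] by (metis order_antisym)
  ultimately show "extremal E" using * by (simp add: extremal_def)
qed

text \<open>
  Improving a part would improve the whole.
\<close>

lemma extremal_sub:
  assumes "extremal E" "F \<subseteq># E" shows "extremal F"
proof -
  define F' where "F' = E - F"
  have E: "E = F + F'" using assms(2) by (simp add: F'_def)
  have G: "set_mset F \<subseteq> G" "set_mset F' \<subseteq> G" using assms(1) by (auto simp: E extremal_def)
  have ext: "size y \<le> size (src E)" "size (tgt E) \<le> size y" if "src E \<sim> y" for y
    using assms(1) that unfolding extremal_iff by blast+
  have "size y \<le> size (src F) \<and> size (tgt F) \<le> size y" if y: "src F \<sim> y" for y
  proof -
    have "src E \<sim> y + src F'" "src E \<sim> y + tgt F'"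
      using sim_add2[OF y sim_refl[OF src_set[OF G(2)]]] sim_add2[OF y src_sim_tgt[OF G(2)]]
      by (simp_all add: E)
    then show ?thesis using ext(1)[of "y + src F'"] ext(2)[of "y + tgt F'"] by (simp add: E)
  qed
  then show ?thesis using G(1) unfolding extremal_iff by blast
qed

lemma extremal_elasticity:
  assumes "extremal E" "E \<noteq> {#}"
  shows "elast (src E) = ereal (real (size (src E)) / real (size (tgt E)))"
    and "0 < size (tgt E)"
proof -
  have A: "set_mset (src E) \<subseteq> A" using assms(1) src_set by (simp add: extremal_def)
  obtain g where g: "g \<in># E" using assms(2) by blast
  then have "g \<in> G" using assms(1) by (auto simp: extremal_def)
  then have "fst g \<noteq> {#}" by (rule G_nonempty)
  moreover have "set_mset (fst g) \<subseteq> set_mset (src E)" using g unfolding set_src by blast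
  ultimately have ne: "src E \<noteq> {#}" by auto
  show "elast (src E) = ereal (real (size (src E)) / real (size (tgt E)))"
    and "0 < size (tgt E)"
    using len_elasticity(2,3)[OF A ne] assms(1) by (simp_all add: extremal_def)
qed

text \<open>
  The sums that are not extremal form an upward closed set. If \<open>K\<close> bounds the
  multiplicities in its finitely many minimal elements, multiplicities above \<open>K\<close> cannot
  matter for membership.
\<close>

lemma extremal_threshold:
  obtains K where "\<forall>E F. extremal E \<longrightarrow> set_mset F \<subseteq> G \<longrightarrow>
    (\<forall>g. count F g \<le> count E g \<or> K < count E g) \<longrightarrow> extremal F"
proof -
  define S where "S = {E. set_mset E \<subseteq> G \<and> \<not> extremal E}"
  obtain C where C: "C \<subseteq> S" "finite C" "\<forall>s\<in>S. \<exists>f\<in>C. f \<subseteq># s"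
    using dickson_mset[OF finite_G, of S] unfolding S_def by blast
  define K where "K = (\<Sum>c\<in>C. size c)"
  have "extremal F" if E: "extremal E" and F: "set_mset F \<subseteq> G"
    and EF: "\<forall>g. count F g \<le> count E g \<or> K < count E g" for E F
  proof (rule ccontr)
    assume "\<not> extremal F"
    then have "F \<in> S" using F by (simp add: S_def)
    then obtain c where c: "c \<in> C" "c \<subseteq># F" using C(3) by blast
    have "size c \<le> K" unfolding K_def using c(1) C(2) by (intro member_le_sum) auto
    then have cK: "count c g \<le> K" for g using count_le_size[of c g] by linarith
    have "count c g \<le> count E g" for g
      using EF[rule_format, of g] mset_subset_eq_count[OF c(2), of g] cK[of g] by linarith
    then have "c \<subseteq># E" by (rule mset_subset_eqI)
    then have "extremal c" by (rule extremal_sub[OF E])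
    then show False using c(1) C(1) by (auto simp: S_def)
  qed
  then show ?thesis by (intro that[of K]) blast
qed

lemma elasticity_le_rho:
  assumes "set_mset z \<subseteq> A"
  shows "elast z \<le> ereal rho" "1 \<le> elast z"
  using elasticity_between[OF assms, of rho] size_le_rho rho_ge_1 by blast+

definition free :: "('a multiset \<times> 'a multiset) \<Rightarrow> bool" where
  "free g \<longleftrightarrow> (\<forall>n. extremal (replicate_mset n g))"

lemma src_tgt_replicate:
  "src (replicate_mset n g) = repeat_mset n (fst g)" "tgt (replicate_mset n g) = repeat_mset n (snd g)"
  by (induction n) auto

lemma maximal_ratio_free:
  assumes "g \<in> G" "real (size (fst g)) = rho * real (size (snd g))"
  shows "free g"
  unfolding free_def extremal_iff
proof (intro allI impI conjI)
  fix n
  show G: "set_mset (replicate_mset n g) \<subseteq> G" using assms(1) by simp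
  fix y assume y: "src (replicate_mset n g) \<sim> y"
  have r0: "0 < rho" using rho_ge_1 by simp
  have eq: "real (size (src (replicate_mset n g))) = rho * real (size (tgt (replicate_mset n g)))"
    using assms(2) by (simp add: src_tgt_replicate algebra_simps)
  have "y \<sim> tgt (replicate_mset n g)" by (rule sim_trans[OF sim_sym[OF y] src_sim_tgt[OF G]])
  from size_le_rho[OF this] show "size y \<le> size (src (replicate_mset n g))" using eq by simp
  from size_le_rho[OF y] show "size (tgt (replicate_mset n g)) \<le> size y" using eq r0 by simp
qed

lemma free_in_G: "free g \<Longrightarrow> g \<in> G"
  unfolding free_def by (drule spec[of _ 1]) (simp add: extremal_def)

text \<open>
  The factorizations \<open>z\<close> of multiples of \<open>b\<close> form an upward closed set. A minimal one, \<open>w\<close>, satisfies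
  \<open>w \<sim> D w + b\<close>, so \<open>b\<close> can be split off at the cost of a bounded part of \<open>z\<close>.
\<close>

lemma shift_by_element:
  assumes "set_mset b \<subseteq> A"
  obtains C where "\<forall>v z. v + b \<sim> z \<longrightarrow> (\<exists>z'. v \<sim> z' \<and> size z' \<le> size z + C \<and> size z \<le> size z' + C)"
proof -
  define S where "S = {z. \<exists>v. v + b \<sim> z}"
  have SA: "set_mset z \<subseteq> A" if "z \<in> S" for z using that sim_set' unfolding S_def by blast
  obtain F where F: "F \<subseteq> S" "finite F" "\<forall>s\<in>S. \<exists>f\<in>F. f \<subseteq># s"
    using dickson_mset[OF finite_atoms, of S] SA by blast
  have "\<forall>w\<in>F. \<exists>v. v + b \<sim> w" using F(1) by (auto simp: S_def)
  from bchoice[OF this] obtain D where D: "\<forall>w\<in>F. D w + b \<sim> w" by (rule exE)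
  define C where "C = (\<Sum>w\<in>F. size w + size (D w))"
  have "\<exists>z'. v \<sim> z' \<and> size z' \<le> size z + C \<and> size z \<le> size z' + C" if vz: "v + b \<sim> z" for v z
  proof -
    have "z \<in> S" using vz by (auto simp: S_def)
    then obtain w where w: "w \<in> F" "w \<subseteq># z" using F(3) by blast
    define u where "u = z - w"
    have z: "z = w + u" using w(2) by (simp add: u_def)
    have uA: "set_mset u \<subseteq> A" using sim_set'[OF vz] by (simp add: z)
    have "D w + b \<sim> w" using D w(1) by blast
    from sim_add[OF this uA] have "z \<sim> (D w + u) + b" using sim_sym by (simp add: z ac_simps)
    then have "v \<sim> D w + u" by (rule sim_cancel[OF sim_trans[OF vz]])
    moreover have "size w + size (D w) \<le> C" unfolding C_def
      by (rule member_le_sum[of w F "\<lambda>w. size w + size (D w)"]) (use w(1) F(2) in auto)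
    ultimately show ?thesis by (intro exI[of _ "D w + u"]) (simp add: z)
  qed
  then show ?thesis by (intro that[of C]) blast
qed

lemma len_bounds_shift:
  assumes "set_mset b \<subseteq> A"
  obtains C where "\<forall>v. set_mset v \<subseteq> A \<longrightarrow>
    max_len v \<le> max_len (v + b) \<and> max_len (v + b) \<le> max_len v + C \<and>
    min_len (v + b) \<le> min_len v + C \<and> min_len v \<le> min_len (v + b) + C"
proof -
  obtain C where C: "\<forall>v z. v + b \<sim> z \<longrightarrow> (\<exists>z'. v \<sim> z' \<and> size z' \<le> size z + C \<and> size z \<le> size z' + C)"
    using assms by (rule shift_by_element)
  have "max_len v \<le> max_len (v + b) \<and> max_len (v + b) \<le> max_len v + (C + size b) \<and>
    min_len (v + b) \<le> min_len v + (C + size b) \<and> min_len v \<le> min_len (v + b) + (C + size b)"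
    if v: "set_mset v \<subseteq> A" for v
  proof (intro conjI)
    have vb: "set_mset (v + b) \<subseteq> A" using v assms by simp
    obtain x where x: "v \<sim> x" "size x = max_len v" using v by (rule max_len_attained)
    show "max_len v \<le> max_len (v + b)" using max_len[OF sim_add[OF x(1) assms]] x(2) by simp
    obtain y where y: "v \<sim> y" "size y = min_len v" using v by (rule min_len_attained)
    show "min_len (v + b) \<le> min_len v + (C + size b)" using min_len[OF sim_add[OF y(1) assms]] y(2) by simp
    obtain x' where x': "v + b \<sim> x'" "size x' = max_len (v + b)" using vb by (rule max_len_attained)
    obtain x'' where "v \<sim> x''" "size x' \<le> size x'' + C" using C x'(1) by blast
    then show "max_len (v + b) \<le> max_len v + (C + size b)" using max_len[of v x''] x'(2) by linarith
    obtain y' where y': "v + b \<sim> y'" "size y' = min_len (v + b)" using vb by (rule min_len_attained)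
    obtain y'' where "v \<sim> y''" "size y'' \<le> size y' + C" using C y'(1) by blast
    then show "min_len v \<le> min_len (v + b) + (C + size b)" using min_len[of v y''] y'(2) by linarith
  qed
  then show ?thesis by (intro that[of "C + size b"]) blast
qed

text \<open>
  Suppose that no such \<open>E\<close> exists. By the choice of \<open>K\<close>, the generators with multiplicity above \<open>K\<close>
  in an extremal sum all have weights \<open>\<phi>\<close> of the same sign, since two of opposite sign could be
  combined to weight zero. So the total weight of an extremal sum is large if the sum is large. On
  the other hand, the weight \<open>\<Phi>\<close> is a Lipschitz function along the path from \<open>N\<close> copies of \<open>g2\<close> to \<open>N\<close>
  copies of \<open>g1\<close> and changes its sign, so it is small at some large element.
\<close>

lemma balanced_extremal:
  fixes s t :: nat
  assumes g1: "free g1" "int t * int (size (fst g1)) < int s * int (size (snd g1))"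
    and g2: "free g2" "int s * int (size (snd g2)) < int t * int (size (fst g2))"
  shows "\<exists>E. extremal E \<and> E \<noteq> {#} \<and> t * size (src E) = s * size (tgt E)"
proof (rule ccontr)
  assume none: "\<not> ?thesis"
  define \<phi> where "\<phi> g = int t * int (size (fst g)) - int s * int (size (snd g))" for g :: "'a multiset \<times> 'a multiset"
  have phi_sum: "(\<Sum>g\<in>#E. \<phi> g) = int t * int (size (src E)) - int s * int (size (tgt E))" for E
    by (induction E) (auto simp: \<phi>_def algebra_simps)
  have no_zero: "(\<Sum>g\<in>#E. \<phi> g) \<noteq> 0" if "extremal E" "E \<noteq> {#}" for E
  proof
    assume "(\<Sum>g\<in>#E. \<phi> g) = 0"
    then have "int (t * size (src E)) = int (s * size (tgt E))" unfolding phi_sum by simp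
    then show False using none that by (metis of_nat_eq_iff)
  qed
  obtain K where K: "\<forall>E F. extremal E \<longrightarrow> set_mset F \<subseteq> G \<longrightarrow>
    (\<forall>g. count F g \<le> count E g \<or> K < count E g) \<longrightarrow> extremal F"
    by (rule extremal_threshold)
  define K2 where "K2 = (\<Sum>g\<in>G. int K + int K * \<bar>\<phi> g\<bar>)"
  have large: "int (size E) - K2 \<le> \<bar>\<Sum>g\<in>#E. \<phi> g\<bar>" if E: "extremal E" for E
  proof -
    have EG: "set_mset E \<subseteq> G" using E by (simp add: extremal_def)
    have nz: "\<phi> g \<noteq> 0" if g: "g \<in> G" "K < count E g" for g
    proof -
      have "extremal {#g#}" by (rule K[rule_format, OF E]) (use g in auto)
      then show ?thesis using no_zero[of "{#g#}"] by simp
    qed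
    have sign: "\<not> (\<phi> g < 0 \<and> 0 < \<phi> h)" if g: "g \<in> G" "K < count E g" and h: "h \<in> G" "K < count E h" for g h
    proof
      assume gh: "\<phi> g < 0 \<and> 0 < \<phi> h"
      define F where "F = replicate_mset (nat (\<phi> h)) g + replicate_mset (nat (- \<phi> g)) h"
      have "set_mset F \<subseteq> G" using g h by (auto simp: F_def split: if_splits)
      moreover have "count F k \<le> count E k \<or> K < count E k" for k
        using g h by (auto simp: F_def)
      ultimately have "extremal F" by (intro K[rule_format, OF E])
      moreover have "F \<noteq> {#}" using gh by (simp add: F_def)
      moreover have "(\<Sum>g\<in>#F. \<phi> g) = 0" using gh by (simp add: F_def)
      ultimately show False using no_zero by blast
    qed
    have size_E: "int (size E) = (\<Sum>g\<in>G. int (count E g))"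
      using sum_mset_over_superset[OF finite_G EG, of "\<lambda>_. 1::int"] by simp
    have sum_E: "(\<Sum>g\<in>#E. \<phi> g) = (\<Sum>g\<in>G. int (count E g) * \<phi> g)"
      using sum_mset_over_superset[OF finite_G EG, of \<phi>] by simp
    have bound: "(\<Sum>g\<in>G. int (count E g) - (int K + int K * \<bar>\<phi> g\<bar>)) \<le> (\<Sum>g\<in>G. int (count E g) * (\<epsilon> * \<phi> g))"
      if \<epsilon>: "\<epsilon> = 1 \<or> \<epsilon> = - 1" "\<And>g. g \<in> G \<Longrightarrow> K < count E g \<Longrightarrow> 0 < \<epsilon> * \<phi> g" for \<epsilon>
    proof (rule sum_mono)
      fix g assume g: "g \<in> G"
      show "int (count E g) - (int K + int K * \<bar>\<phi> g\<bar>) \<le> int (count E g) * (\<epsilon> * \<phi> g)"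
      proof (cases "K < count E g")
        case True
        then have "1 \<le> \<epsilon> * \<phi> g" using \<epsilon>(2)[OF g] by simp
        then have "int (count E g) * 1 \<le> int (count E g) * (\<epsilon> * \<phi> g)" by (intro mult_left_mono) auto
        moreover have "0 \<le> int K * \<bar>\<phi> g\<bar>" by simp
        ultimately show ?thesis by linarith
      next
        case False
        have "- \<bar>\<phi> g\<bar> \<le> \<epsilon> * \<phi> g" using \<epsilon>(1) by auto
        then have "int (count E g) * (- \<bar>\<phi> g\<bar>) \<le> int (count E g) * (\<epsilon> * \<phi> g)" by (intro mult_left_mono) auto
        moreover have "int (count E g) * \<bar>\<phi> g\<bar> \<le> int K * \<bar>\<phi> g\<bar>" using False by (intro mult_right_mono) auto
        ultimately show ?thesis using False by simp
      qed
    qed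
    have lhs: "int (size E) - K2 = (\<Sum>g\<in>G. int (count E g) - (int K + int K * \<bar>\<phi> g\<bar>))"
      unfolding size_E K2_def by (simp only: sum_subtractf)
    show ?thesis
    proof (cases "\<exists>g\<in>G. K < count E g \<and> \<phi> g < 0")
      case True
      then obtain h where h: "h \<in> G" "K < count E h" "\<phi> h < 0" by blast
      have "0 < - 1 * \<phi> g" if "g \<in> G" "K < count E g" for g
        using sign[OF h(1,2) that] nz[OF that] h(3) by linarith
      from bound[OF _ this] have "int (size E) - K2 \<le> (\<Sum>g\<in>G. int (count E g) * (- 1 * \<phi> g))"
        unfolding lhs by blast
      also have "\<dots> = - (\<Sum>g\<in>#E. \<phi> g)" unfolding sum_E by (simp add: sum_negf)
      finally show ?thesis by linarith
    next
      case False
      have "0 < 1 * \<phi> g" if g: "g \<in> G" "K < count E g" for g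
      proof -
        have "\<not> \<phi> g < 0" using False g by blast
        then show ?thesis using nz[OF g] by simp
      qed
      from bound[OF _ this] have "int (size E) - K2 \<le> (\<Sum>g\<in>G. int (count E g) * (1 * \<phi> g))"
        unfolding lhs by blast
      also have "\<dots> = (\<Sum>g\<in>#E. \<phi> g)" unfolding sum_E by simp
      finally show ?thesis by linarith
    qed
  qed
  define \<Phi> where "\<Phi> z = int t * int (max_len z) - int s * int (min_len z)" for z
  have gG: "g1 \<in> G" "g2 \<in> G" using g1(1) g2(1) free_in_G by auto
  have fA: "set_mset (fst g1) \<subseteq> A" "set_mset (fst g2) \<subseteq> A" using sim_set[OF G_sim] gG by auto
  obtain C1 where C1: "\<forall>v. set_mset v \<subseteq> A \<longrightarrow>
    max_len v \<le> max_len (v + fst g1) \<and> max_len (v + fst g1) \<le> max_len v + C1 \<and>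
    min_len (v + fst g1) \<le> min_len v + C1 \<and> min_len v \<le> min_len (v + fst g1) + C1"
    using fA(1) by (rule len_bounds_shift)
  obtain C2 where C2: "\<forall>v. set_mset v \<subseteq> A \<longrightarrow>
    max_len v \<le> max_len (v + fst g2) \<and> max_len (v + fst g2) \<le> max_len v + C2 \<and>
    min_len (v + fst g2) \<le> min_len v + C2 \<and> min_len v \<le> min_len (v + fst g2) + C2"
    using fA(2) by (rule len_bounds_shift)
  define C3 where "C3 = int t * int (C1 + C2) + int s * int (C1 + C2)"
  have lip: "\<Phi> (v + fst g2) - \<Phi> (v + fst g1) \<le> C3" if v: "set_mset v \<subseteq> A" for v
  proof -
    note b1 = C1[rule_format, OF v] and b2 = C2[rule_format, OF v]
    have "int (max_len (v + fst g2)) \<le> int (max_len (v + fst g1)) + int (C1 + C2)" using b1 b2 by linarith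
    then have a: "int t * int (max_len (v + fst g2)) \<le> int t * (int (max_len (v + fst g1)) + int (C1 + C2))"
      by (rule mult_left_mono) simp
    have "int (min_len (v + fst g1)) \<le> int (min_len (v + fst g2)) + int (C1 + C2)" using b1 b2 by linarith
    then have b: "int s * int (min_len (v + fst g1)) \<le> int s * (int (min_len (v + fst g2)) + int (C1 + C2))"
      by (rule mult_left_mono) simp
    show ?thesis using a b unfolding \<Phi>_def C3_def by (simp only: distrib_left)
  qed
  define c where "c = (\<Sum>g\<in>G. size (fst g))"
  \<comment> \<open>Elements of length at least \<open>N\<close> need too many generators to have a weight of at most \<open>C3\<close>.\<close>
  define N where "N = Suc (c * nat (C3 + K2))"
  define z where "z i = repeat_mset i (fst g1) + repeat_mset (N - i) (fst g2)" for i
  have rep: "set_mset (repeat_mset n x) \<subseteq> A" if "set_mset x \<subseteq> A" for n x using that by (induction n) auto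
  have zA: "set_mset (z i) \<subseteq> A" for i using rep fA by (simp add: z_def)
  have ext: "\<Phi> (src E) = (\<Sum>g\<in>#E. \<phi> g)" if "extremal E" for E
    using that unfolding \<Phi>_def phi_sum extremal_def by simp
  have "\<Phi> (z 0) = int N * \<phi> g2"
    using ext[of "replicate_mset N g2"] g2(1) unfolding free_def by (simp add: z_def src_tgt_replicate)
  then have start: "0 \<le> \<Phi> (z 0)" using g2(2) by (simp add: \<phi>_def)
  have "\<Phi> (z N) = int N * \<phi> g1"
    using ext[of "replicate_mset N g1"] g1(1) unfolding free_def by (simp add: z_def src_tgt_replicate)
  moreover have "\<phi> g1 < 0" using g1(2) by (simp add: \<phi>_def)
  moreover have "0 < int N" by (simp only: N_def of_nat_0_less_iff zero_less_Suc)
  ultimately have stop: "\<Phi> (z N) < 0" by (simp only: mult_pos_neg)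
  define i where "i = (LEAST i. \<Phi> (z i) < 0)"
  have i: "\<Phi> (z i) < 0" unfolding i_def by (rule LeastI[of "\<lambda>i. \<Phi> (z i) < 0", OF stop])
  have iN: "i \<le> N" unfolding i_def by (rule Least_le) (rule stop)
  have "i \<noteq> 0"
  proof
    assume "i = 0"
    then have "\<Phi> (z 0) < 0" using i by (simp only:)
    then show False using start by linarith
  qed
  then obtain j where j: "i = Suc j" by (cases i) auto
  have pos: "0 \<le> \<Phi> (z j)" using not_less_Least[of j "\<lambda>i. \<Phi> (z i) < 0"] j unfolding i_def by simp
  define v where "v = repeat_mset j (fst g1) + repeat_mset (N - i) (fst g2)"
  have vA: "set_mset v \<subseteq> A" using rep fA by (simp add: v_def)
  have Nj: "N - j = Suc (N - i)" using iN j by simp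
  have "z i = v + fst g1" by (simp add: z_def v_def j)
  moreover have "z j = v + fst g2" by (simp add: z_def v_def Nj)
  ultimately have "\<Phi> (z j) \<le> C3" using lip[OF vA] i by simp
  obtain E where E: "extremal E" "z j \<sim> src E" using zA[of j] by (rule extremal_exists)
  have EG: "set_mset E \<subseteq> G" using E(1) by (simp add: extremal_def)
  have "\<Phi> (z j) = \<Phi> (src E)" using len_cong[OF E(2)] by (simp add: \<Phi>_def max_len_def min_len_def)
  then have "\<bar>\<Sum>g\<in>#E. \<phi> g\<bar> \<le> C3" using ext[OF E(1)] pos \<open>\<Phi> (z j) \<le> C3\<close> by simp
  then have "int (size E) \<le> C3 + K2" using large[OF E(1)] by linarith
  then have sE: "size E \<le> nat (C3 + K2)" by linarith
  have "size (src E) \<le> c * size E"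
  proof -
    have "size (fst g) \<le> c" if "g \<in> G" for g
      unfolding c_def by (rule member_le_sum[of g G "\<lambda>g. size (fst g)"]) (use that finite_G in auto)
    then show ?thesis using EG by (induction E) (auto simp: add_le_mono)
  qed
  also have "\<dots> \<le> c * nat (C3 + K2)" using sE by (rule mult_le_mono2)
  finally have "size (src E) < N" by (simp add: N_def)
  moreover have "size (z j) \<le> size (src E)"
    using E unfolding extremal_iff using sim_sym by blast
  moreover have "N \<le> size (z j)"
  proof -
    have "1 \<le> size (fst g1)" "1 \<le> size (fst g2)" using G_nonempty gG by (simp_all add: Suc_le_eq nonempty_has_size)
    then have "j * 1 + (N - j) * 1 \<le> j * size (fst g1) + (N - j) * size (fst g2)"
      by (intro add_le_mono mult_le_mono2)
    then show ?thesis using iN j by (simp add: z_def)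
  qed
  ultimately show False by linarith
qed

text \<open>
  The threshold \<open>r\<close> is the least quotient of a freely repeatable generator. In an extremal sum,
  generators with quotient below \<open>r\<close> have bounded multiplicity, so \<open>|src E| - r |tgt E|\<close> is bounded
  below; a quotient at most \<open>s < r\<close> then bounds the lengths.
\<close>

theorem elasticity_structure_above_one:
  assumes "1 < rho"
  obtains r where "1 \<le> r"
    "\<forall>q. q \<in> \<rat> \<and> r \<le> q \<and> q \<le> rho \<longrightarrow> (\<exists>z. set_mset z \<subseteq> A \<and> elast z = ereal q)"
    "\<forall>s<r. finite {elast z | z. set_mset z \<subseteq> A \<and> elast z \<le> ereal s}"
proof -
  define \<rho> where "\<rho> g = real (size (fst g)) / real (size (snd g))" for g :: "'a multiset \<times> 'a multiset"
  define Fr where "Fr = {g \<in> G. free g}"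
  have snd0: "0 < size (snd g)" if "g \<in> G" for g using snd_G_nonempty[OF that] by (simp add: nonempty_has_size)
  obtain g0 where g0: "g0 \<in> G" "real (size (fst g0)) = rho * real (size (snd g0))"
    using rho_attained assms by auto
  have free0: "free g0" by (rule maximal_ratio_free[OF g0])
  have "g0 \<in> Fr" using g0(1) free0 by (simp add: Fr_def)
  then have Fr: "finite (\<rho> ` Fr)" "\<rho> ` Fr \<noteq> {}" using finite_G by (simp add: Fr_def, blast)
  define r where "r = Min (\<rho> ` Fr)"
  obtain gr where gr: "gr \<in> G" "free gr" "r = \<rho> gr"
    using Min_in[OF Fr] unfolding r_def Fr_def by auto
  have r_le: "r \<le> \<rho> g" if "free g" for g
    unfolding r_def by (rule Min_le[OF Fr(1)]) (use that free_in_G in \<open>auto simp: Fr_def\<close>)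
  have single: "extremal {#g#}" if "free g" for g
    using that unfolding free_def by (metis replicate_mset_0 replicate_mset_Suc)
  have el_single: "elast (fst g) = ereal (\<rho> g)" if "free g" for g
    using extremal_elasticity(1)[OF single[OF that]] by (simp add: \<rho>_def)
  have fstA: "set_mset (fst g) \<subseteq> A" if "g \<in> G" for g using sim_set[OF G_sim[OF that]] .
  have r1: "1 \<le> r" using elasticity_le_rho(2)[OF fstA[OF gr(1)]] el_single[OF gr(2)] gr(3) by simp
  show ?thesis
  proof (rule that[OF r1])
    show "\<forall>q. q \<in> \<rat> \<and> r \<le> q \<and> q \<le> rho \<longrightarrow> (\<exists>z. set_mset z \<subseteq> A \<and> elast z = ereal q)"
    proof (intro allI impI, elim conjE)
      fix q assume q: "q \<in> \<rat>" "r \<le> q" "q \<le> rho"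
      consider "q = r" | "q = rho" | "r < q" "q < rho" using q by linarith
      then show "\<exists>z. set_mset z \<subseteq> A \<and> elast z = ereal q"
      proof cases
        case 1
        then show ?thesis using el_single[OF gr(2)] fstA[OF gr(1)] gr(3) by auto
      next
        case 2
        have "\<rho> g0 = rho" using g0(2) snd_G_nonempty[OF g0(1)] by (simp add: \<rho>_def)
        then show ?thesis using 2 el_single[OF free0] fstA[OF g0(1)] by auto
      next
        case 3
        obtain s t :: nat where st: "t \<noteq> 0" "\<bar>q\<bar> = real s / real t" using q(1) by (rule Rats_abs_nat_div_natE)
        have qst: "q * real t = real s" using st q(2) r1 by simp
        have t0: "0 < real t" using st(1) by simp
        have "real (size (fst gr)) < q * real (size (snd gr))"
          using 3(1) snd0[OF gr(1)] gr(3) by (simp add: \<rho>_def divide_less_eq)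
        then have "real t * real (size (fst gr)) < real t * (q * real (size (snd gr)))" using t0 by simp
        also have "\<dots> = real s * real (size (snd gr))" using qst by (simp add: mult.assoc[symmetric] mult.commute)
        finally have 1: "int t * int (size (fst gr)) < int s * int (size (snd gr))"
          by (simp flip: of_nat_mult)
        have "q * real (size (snd g0)) < real (size (fst g0))"
          using 3(2) snd0[OF g0(1)] unfolding g0(2) by simp
        then have "real t * (q * real (size (snd g0))) < real t * real (size (fst g0))" using t0 by simp
        moreover have "real t * (q * real (size (snd g0))) = real s * real (size (snd g0))"
          using qst by (simp add: mult.assoc[symmetric] mult.commute)
        ultimately have "real s * real (size (snd g0)) < real t * real (size (fst g0))" by simp
        then have 2: "int s * int (size (snd g0)) < int t * int (size (fst g0))"
          by (simp flip: of_nat_mult)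
        obtain E where E: "extremal E" "E \<noteq> {#}" "t * size (src E) = s * size (tgt E)"
          using balanced_extremal[OF gr(2) 1 free0 2] by blast
        have "real t * real (size (src E)) = real s * real (size (tgt E))"
          using E(3) by (metis of_nat_mult)
        then have "real t * real (size (src E)) = real t * (q * real (size (tgt E)))"
          using qst by (simp add: mult.assoc[symmetric] mult.commute)
        then have "real (size (src E)) = q * real (size (tgt E))" using t0 by simp
        moreover have "real (size (tgt E)) \<noteq> 0" using extremal_elasticity(2)[OF E(1,2)] by linarith
        ultimately have "real (size (src E)) / real (size (tgt E)) = q" using nonzero_divide_eq_eq by blast
        then show ?thesis using extremal_elasticity(1)[OF E(1,2)] src_set E(1)
          unfolding extremal_def by metis
      qed
    qed
    show "\<forall>s<r. finite {elast z | z. set_mset z \<subseteq> A \<and> elast z \<le> ereal s}"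
    proof (intro allI impI)
      fix s assume s: "s < r"
      obtain K where K: "\<forall>E F. extremal E \<longrightarrow> set_mset F \<subseteq> G \<longrightarrow>
        (\<forall>g. count F g \<le> count E g \<or> K < count E g) \<longrightarrow> extremal F"
        by (rule extremal_threshold)
      define C where "C = (\<Sum>g\<in>G. real K * (r * real (size (snd g))))"
      define N where "N = nat \<lceil>rho * (C / (r - s))\<rceil>"
      have bound: "size (src E) \<le> N \<and> size (tgt E) \<le> N"
        if E: "extremal E" "real (size (src E)) \<le> s * real (size (tgt E))" for E
      proof -
        have EG: "set_mset E \<subseteq> G" using E(1) by (simp add: extremal_def)
        define f where "f g = real (size (fst g)) - r * real (size (snd g))" for g :: "'a multiset \<times> 'a multiset"
        have "(\<Sum>g\<in>#E. f g) = real (size (src E)) - r * real (size (tgt E))"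
          by (induction E) (auto simp: f_def algebra_simps)
        moreover have "(\<Sum>g\<in>#E. f g) = (\<Sum>g\<in>G. real (count E g) * f g)"
          by (rule sum_mset_over_superset[OF finite_G EG])
        moreover have "(\<Sum>g\<in>G. - (real K * (r * real (size (snd g))))) \<le> (\<Sum>g\<in>G. real (count E g) * f g)"
        proof (rule sum_mono)
          fix g assume g: "g \<in> G"
          show "- (real K * (r * real (size (snd g)))) \<le> real (count E g) * f g"
          proof (cases "K < count E g")
            case True
            have "extremal (replicate_mset n g)" for n
              by (rule K[rule_format, OF E(1)]) (use g True in \<open>auto split: if_splits\<close>)
            then have "r \<le> \<rho> g" by (intro r_le) (simp add: free_def)
            then have "0 \<le> f g" using snd0[OF g] by (simp add: f_def \<rho>_def le_divide_eq)
            then have "0 \<le> real (count E g) * f g" by simp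
            moreover have "0 \<le> real K * (r * real (size (snd g)))" using r1 by simp
            ultimately show ?thesis by linarith
          next
            case False
            have "real (count E g) * (r * real (size (snd g))) \<le> real K * (r * real (size (snd g)))"
              using False r1 by (intro mult_right_mono) auto
            moreover have "real (count E g) * (- (r * real (size (snd g)))) \<le> real (count E g) * f g"
              by (intro mult_left_mono) (auto simp: f_def)
            ultimately show ?thesis by simp
          qed
        qed
        ultimately have "- C \<le> real (size (src E)) - r * real (size (tgt E))"
          unfolding C_def by (simp add: sum_negf)
        then have "(r - s) * real (size (tgt E)) \<le> C" using E(2) by (simp add: algebra_simps)
        then have t: "real (size (tgt E)) \<le> C / (r - s)" using s by (simp add: le_divide_eq mult.commute)
        have "real (size (src E)) \<le> rho * real (size (tgt E))" by (rule size_le_rho[OF src_sim_tgt[OF EG]])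
        also have "\<dots> \<le> rho * (C / (r - s))" using t rho_ge_1 by (intro mult_left_mono) auto
        finally have 1: "size (src E) \<le> N" unfolding N_def by linarith
        have "tgt E \<sim> src E" by (rule sim_sym[OF src_sim_tgt[OF EG]])
        then have "size (tgt E) \<le> size (src E)"
          using E(1) src_sim_tgt[OF EG] unfolding extremal_iff by blast
        then show ?thesis using 1 by simp
      qed
      let ?S = "{elast z | z. set_mset z \<subseteq> A \<and> elast z \<le> ereal s}"
      have "?S \<subseteq> insert 1 ((\<lambda>(a, b). ereal (real a / real b)) ` ({..N} \<times> {..N}))"
      proof
        fix x assume "x \<in> ?S"
        then obtain w where w: "x = elast w" "set_mset w \<subseteq> A" "x \<le> ereal s" by blast
        obtain E where E: "extremal E" "w \<sim> src E" using w(2) by (rule extremal_exists)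
        have x: "x = elast (src E)" using w(1) len_cong[OF E(2)] by simp
        show "x \<in> insert 1 ((\<lambda>(a, b). ereal (real a / real b)) ` ({..N} \<times> {..N}))"
        proof (cases "E = {#}")
          case True
          then show ?thesis using x len_elasticity(1)[of "{#}"] by simp
        next
          case False
          note el = extremal_elasticity[OF E(1) False]
          have "real (size (src E)) \<le> s * real (size (tgt E))"
            using w(3) el unfolding x by (simp add: divide_le_eq)
          from bound[OF E(1) this] show ?thesis unfolding x el(1)
            by (intro insertI2 image_eqI[of _ _ "(size (src E), size (tgt E))"]) auto
        qed
      qed
      then show "finite ?S" by (rule finite_subset) simp
    qed
  qed
qed

lemma rho_is_elasticity:
  "\<exists>z. set_mset z \<subseteq> A \<and> elast z = ereal rho"
  using rho_attained
proof
  assume "rho = 1"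
  then show ?thesis using len_elasticity(1)[of "{#}"] by (intro exI[of _ "{#}"]) (simp add: one_ereal_def)
next
  assume "\<exists>g\<in>G. real (size (fst g)) = rho * real (size (snd g))"
  then obtain g where g: "g \<in> G" "real (size (fst g)) = rho * real (size (snd g))" by blast
  have "extremal (replicate_mset 1 g)" using maximal_ratio_free[OF g] unfolding free_def by blast
  then have E: "extremal {#g#}" by simp
  have "real (size (fst g)) / real (size (snd g)) = rho"
    using g(2) snd_G_nonempty[OF g(1)] by simp
  then show ?thesis using extremal_elasticity(1)[OF E] sim_set[OF G_sim[OF g(1)]]
    by (intro exI[of _ "fst g"]) simp
qed

lemma elasticity_structure:
  obtains r where "1 \<le> r"
    "\<forall>q. q \<in> \<rat> \<and> r \<le> q \<and> q \<le> rho \<longrightarrow> (\<exists>z. set_mset z \<subseteq> A \<and> elast z = ereal q)"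
    "\<forall>s<r. finite {elast z | z. set_mset z \<subseteq> A \<and> elast z \<le> ereal s}"
proof (cases "1 < rho")
  case True
  then show ?thesis using elasticity_structure_above_one that by blast
next
  case False
  then have rho: "rho = 1" using rho_ge_1 by simp
  show ?thesis
  proof (rule that[of 1])
    show "\<forall>q. q \<in> \<rat> \<and> 1 \<le> q \<and> q \<le> rho \<longrightarrow> (\<exists>z. set_mset z \<subseteq> A \<and> elast z = ereal q)"
    proof (intro allI impI)
      fix q assume "q \<in> \<rat> \<and> 1 \<le> q \<and> q \<le> rho"
      then have "q = rho" using rho by simp
      then show "\<exists>z. set_mset z \<subseteq> A \<and> elast z = ereal q" using rho_is_elasticity by simp
    qed
    show "\<forall>s<1. finite {elast z | z. set_mset z \<subseteq> A \<and> elast z \<le> ereal s}"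
    proof (intro allI impI)
      fix s :: real assume s: "s < 1"
      have "\<not> elast z \<le> ereal s" if "set_mset z \<subseteq> A" for z
      proof
        assume "elast z \<le> ereal s"
        then have "1 \<le> ereal s" using elasticity_le_rho(2)[OF that] by (rule order_trans[rotated])
        then show False using s by simp
      qed
      then have "{elast z | z. set_mset z \<subseteq> A \<and> elast z \<le> ereal s} = {}" by blast
      then show "finite {elast z | z. set_mset z \<subseteq> A \<and> elast z \<le> ereal s}" by (simp only: finite.emptyI)
    qed
  qed simp
qed

end

lemma islimpt_only_at_top:
  fixes X :: "ereal set"
  assumes below: "\<And>y. y \<in> X \<Longrightarrow> y < ereal r" and fin: "\<And>s. s < r \<Longrightarrow> finite {y \<in> X. y \<le> ereal s}"
    and x: "x islimpt X"
  shows "x = ereal r"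
proof (rule antisym)
  show "x \<le> ereal r"
  proof (rule ccontr)
    assume "\<not> x \<le> ereal r"
    then have "x \<in> {ereal r<..}" by simp
    then obtain y where "y \<in> X" "y \<in> {ereal r<..}" using x by (metis islimptE open_greaterThan)
    then show False using below[of y] by simp
  qed
  show "ereal r \<le> x"
  proof (rule ccontr)
    assume "\<not> ereal r \<le> x"
    then have "x < ereal r" by simp
    then obtain s where s: "x < ereal s" "ereal s < ereal r" using ereal_dense2 by blast
    have "eventually (\<lambda>y. y \<in> {..<ereal s}) (at x)"
      using s(1) unfolding eventually_at_topological by (intro exI[of _ "{..<ereal s}"]) auto
    with x have "x islimpt X \<inter> {..<ereal s}" by (rule islimpt_Int_eventually)
    moreover have "finite (X \<inter> {..<ereal s})"
      by (rule finite_subset[OF _ fin[of s]]) (use s(2) in auto)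
    ultimately show False using islimpt_finite by blast
  qed
qed

section \<open>Finitely generated reduced monoids\<close>

text \<open>
  The quotient of a unit-cancellative monoid by its units has this form.
\<close>

locale reduced_comm_monoid = comm_monoid +
  assumes units: "Units G = {\<one>}"
    and cancel_one: "\<lbrakk>a \<in> carrier G; u \<in> carrier G; a = a \<otimes> u\<rbrakk> \<Longrightarrow> u = \<one>"
begin

lemma divisor_of_one:
  assumes "a \<in> carrier G" "b \<in> carrier G" "a \<otimes> b = \<one>" shows "a = \<one>" "b = \<one>"
proof -
  have "b \<otimes> a = \<one>" using assms m_comm by simp
  then have "a \<in> Units G" "b \<in> Units G" using assms unfolding Units_def by auto
  then show "a = \<one>" "b = \<one>" using units by auto
qed

lemma hull_submonoid:
  assumes "E \<subseteq> carrier G" shows "submonoid ((\<lambda>S. submonoid S G) hull E) G"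
proof
  show "((\<lambda>S. submonoid S G) hull E) \<subseteq> carrier G"
    by (rule hull_minimal[OF assms]) (unfold_locales, auto)
qed (auto simp: hull_def intro: submonoid.m_closed submonoid.one_closed)

text \<open>
  Removing an atom from the carrier leaves a submonoid.
\<close>

lemma atoms_subset_generators:
  assumes "E \<subseteq> carrier G" "(\<lambda>S. submonoid S G) hull E = carrier G"
  shows "monoid_atoms G \<subseteq> E"
proof
  fix u assume u: "u \<in> monoid_atoms G"
  show "u \<in> E"
  proof (rule ccontr)
    assume "u \<notin> E"
    have u1: "u \<noteq> \<one>" and irr: "\<And>b c. b \<in> carrier G \<Longrightarrow> c \<in> carrier G \<Longrightarrow> u = b \<otimes> c \<Longrightarrow> b = \<one> \<or> c = \<one>"
      using u units unfolding monoid_atoms_def by auto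
    have "submonoid (carrier G - {u}) G"
    proof
      show "x \<otimes> y \<in> carrier G - {u}" if "x \<in> carrier G - {u}" "y \<in> carrier G - {u}" for x y
        using that irr[of x y] by auto
    qed (use u1 in auto)
    then have "(\<lambda>S. submonoid S G) hull E \<subseteq> carrier G - {u}"
      by (intro hull_minimal) (use assms(1) \<open>u \<notin> E\<close> in auto)
    then show False using assms(2) u unfolding monoid_atoms_def by auto
  qed
qed

text \<open>
  Write both factors of \<open>e\<close> as a power of \<open>e\<close> times a product of the other generators. If \<open>e\<close> does not
  occur, then it is redundant. If it occurs, unit-cancellation shows that all
  remaining factors are trivial.
\<close>

lemma irredundant_generator_atom:
  assumes E: "E \<subseteq> carrier G" "(\<lambda>S. submonoid S G) hull E = carrier G"
    and e: "e \<in> E" "e \<noteq> \<one>" "e \<notin> (\<lambda>S. submonoid S G) hull (E - {e})"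
  shows "e \<in> monoid_atoms G"
proof -
  define N where "N = (\<lambda>S. submonoid S G) hull (E - {e})"
  interpret N: submonoid N G unfolding N_def by (rule hull_submonoid) (use E(1) in blast)
  have ec: "e \<in> carrier G" using e(1) E(1) by blast
  define M where "M = {e [^] (n::nat) \<otimes> s | n s. s \<in> N}"
  have N_M: "s \<in> M" if "s \<in> N" for s
    unfolding M_def using that N.subset by (intro CollectI exI[of _ 0] exI[of _ s]) auto
  have "submonoid M G"
  proof
    show "M \<subseteq> carrier G" using N.subset ec by (auto simp: M_def)
    show "\<one> \<in> M" using N_M N.one_closed .
    show "x \<otimes> y \<in> M" if xy: "x \<in> M" "y \<in> M" for x y
    proof -
      obtain i j :: nat and s t where st: "s \<in> N" "t \<in> N" "x = e [^] i \<otimes> s" "y = e [^] j \<otimes> t"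
        using xy unfolding M_def by blast
      have c: "s \<in> carrier G" "t \<in> carrier G" using st N.subset by auto
      have "x \<otimes> y = e [^] (i + j) \<otimes> (s \<otimes> t)"
        using c ec unfolding st nat_pow_mult[OF ec, symmetric] by (simp add: m_ac)
      then show ?thesis unfolding M_def using N.m_closed st(1,2) by blast
    qed
  qed
  moreover have "E \<subseteq> M"
  proof
    fix x assume x: "x \<in> E"
    show "x \<in> M"
    proof (cases "x = e")
      case True
      then show ?thesis unfolding M_def using ec N.one_closed
        by (intro CollectI exI[of _ 1] exI[of _ \<one>]) auto
    next
      case False
      then have "x \<in> N" unfolding N_def using x hull_subset[of "E - {e}"] by blast
      then show ?thesis by (rule N_M)
    qed
  qed
  ultimately have carM: "carrier G \<subseteq> M" using E(2) hull_minimal[of E M "\<lambda>S. submonoid S G"] by simp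
  have "b = \<one> \<or> c = \<one>" if bc: "b \<in> carrier G" "c \<in> carrier G" "e = b \<otimes> c" for b c
  proof -
    have "b \<in> M" by (rule subsetD[OF carM bc(1)])
    then obtain i :: nat and s where s: "s \<in> N" "b = e [^] i \<otimes> s" unfolding M_def by blast
    have "c \<in> M" by (rule subsetD[OF carM bc(2)])
    then obtain j :: nat and t where t: "t \<in> N" "c = e [^] j \<otimes> t" unfolding M_def by blast
    note st = s(1) t(1) s(2) t(2)
    have cc: "s \<in> carrier G" "t \<in> carrier G" using st N.subset by auto
    have prod: "e = e [^] (i + j) \<otimes> (s \<otimes> t)"
      using cc ec bc(3) unfolding st nat_pow_mult[OF ec, symmetric] by (simp add: m_ac)
    show ?thesis
    proof (cases "i + j")
      case 0
      then have "e = s \<otimes> t" using prod cc by simp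
      then have "e \<in> N" using N.m_closed st(1,2) by simp
      then show ?thesis using e(3) by (simp add: N_def)
    next
      case (Suc k)
      have "e = e \<otimes> (e [^] k \<otimes> (s \<otimes> t))"
        using prod cc ec unfolding Suc nat_pow_Suc by (simp add: m_ac)
      then have one: "e [^] k \<otimes> (s \<otimes> t) = \<one>" by (rule cancel_one[OF ec, rotated]) (use cc ec in simp)
      then have st1: "e [^] k = \<one>" "s \<otimes> t = \<one>" using divisor_of_one[OF _ _ one] cc ec by auto
      then have s1: "s = \<one>" "t = \<one>" using divisor_of_one[OF cc] by auto
      have "k = 0"
      proof (rule ccontr)
        assume "k \<noteq> 0"
        then obtain l where "k = Suc l" by (cases k) auto
        then have "e [^] l \<otimes> e = \<one>" using st1(1) by simp
        then show False using divisor_of_one(2)[of "e [^] l" e] ec e(2) by simp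
      qed
      then have "i = 0 \<or> j = 0" using Suc by linarith
      then show ?thesis using st s1 by auto
    qed
  qed
  then show ?thesis using ec e(2) units unfolding monoid_atoms_def by auto
qed

text \<open>
  A generating set of least cardinality consists of atoms, apart from possibly \<open>\<one>\<close>.
\<close>

lemma finitely_generated_atomic:
  assumes "fin_gen_monoid G"
  shows "finite (monoid_atoms G)"
    and "submonoid T G \<Longrightarrow> monoid_atoms G \<subseteq> T \<Longrightarrow> carrier G \<subseteq> T"
proof -
  let ?P = "\<lambda>E. finite E \<and> E \<subseteq> carrier G \<and> (\<lambda>S. submonoid S G) hull E = carrier G"
  obtain E0 where "?P E0" using assms unfolding fin_gen_monoid_def by blast
  then obtain E where E: "?P E" "\<And>E'. ?P E' \<Longrightarrow> card E \<le> card E'"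
    using ex_has_least_nat[of ?P E0 card] by blast
  have sub: "monoid_atoms G \<subseteq> E" using atoms_subset_generators E(1) by blast
  then show "finite (monoid_atoms G)" using E(1) finite_subset by blast
  assume T: "submonoid T G" "monoid_atoms G \<subseteq> T"
  have "E \<subseteq> T"
  proof
    fix e assume e: "e \<in> E"
    show "e \<in> T"
    proof (cases "e = \<one>")
      case True
      then show ?thesis using submonoid.one_closed[OF T(1)] by simp
    next
      case False
      have "e \<notin> (\<lambda>S. submonoid S G) hull (E - {e})"
      proof
        assume in_hull: "e \<in> (\<lambda>S. submonoid S G) hull (E - {e})"
        let ?N = "(\<lambda>S. submonoid S G) hull (E - {e})"
        have sN: "submonoid ?N G" by (rule hull_submonoid) (use E(1) in blast)
        have "E \<subseteq> ?N" using in_hull hull_subset[of "E - {e}" "\<lambda>S. submonoid S G"] by blast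
        then have "(\<lambda>S. submonoid S G) hull E \<subseteq> ?N" by (rule hull_minimal[of E ?N "\<lambda>S. submonoid S G", OF _ sN])
        then have "?N = carrier G" using E(1) submonoid.subset[OF sN] by auto
        then have "card E \<le> card (E - {e})" using E by (intro E(2)) auto
        then show False using e E(1) by (metis card_Diff1_less not_less)
      qed
      then show ?thesis using irredundant_generator_atom[of E e] E(1) e False T(2) by blast
    qed
  qed
  then have "(\<lambda>S. submonoid S G) hull E \<subseteq> T" using T(1) by (rule hull_minimal)
  then show "carrier G \<subseteq> T" using E(1) by simp
qed

end

section \<open>Factorizations in the monoid\<close>

context unit_cancel_comm_monoid
begin

abbreviation R where "R \<equiv> reduced_monoid G"
abbreviation cls where "cls a \<equiv> Units G #> a"

lemma carrier_R: "carrier R = cls ` carrier G"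
  by (simp add: reduced_monoid_def carrier_FactGroup)

lemma mult_R: "a \<in> carrier G \<Longrightarrow> b \<in> carrier G \<Longrightarrow> cls a \<otimes>\<^bsub>R\<^esub> cls b = cls (a \<otimes> b)"
  by (simp add: reduced_monoid_def mult_unit_cosets)

lemma one_R: "\<one>\<^bsub>R\<^esub> = cls \<one>"
  by (simp add: reduced_monoid_def unit_coset_one)

lemma cls_eq_iff:
  assumes "a \<in> carrier G" "b \<in> carrier G"
  shows "cls a = cls b \<longleftrightarrow> (\<exists>u\<in>Units G. a = u \<otimes> b)"
proof
  assume "cls a = cls b"
  moreover have "a \<in> cls a" using assms(1) by (force simp: r_coset_def)
  ultimately show "\<exists>u\<in>Units G. a = u \<otimes> b" by (auto simp: r_coset_def)
next
  assume "\<exists>u\<in>Units G. a = u \<otimes> b"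
  then obtain u where u: "u \<in> Units G" "a = u \<otimes> b" by blast
  show "cls a = cls b"
  proof (intro equalityI subsetI)
    fix x assume "x \<in> cls a"
    then obtain v where v: "v \<in> Units G" "x = v \<otimes> (u \<otimes> b)" using u(2) by (auto simp: r_coset_def)
    then have "x = (v \<otimes> u) \<otimes> b" "v \<otimes> u \<in> Units G" using u(1) assms(2) by (simp_all add: m_assoc Units_closed)
    then show "x \<in> cls b" by (auto simp: r_coset_def)
  next
    fix x assume "x \<in> cls b"
    then obtain v where v: "v \<in> Units G" "x = v \<otimes> b" by (auto simp: r_coset_def)
    have "b = inv u \<otimes> a" using u assms by (simp add: m_assoc[symmetric] Units_closed)
    then have "x = (v \<otimes> inv u) \<otimes> a" "v \<otimes> inv u \<in> Units G"
      using u(1) v assms by (simp_all add: m_assoc Units_closed)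
    then show "x \<in> cls a" by (auto simp: r_coset_def)
  qed
qed

lemma reduced_comm_monoid_R: "reduced_comm_monoid R"
proof -
  interpret R: comm_monoid R by (rule comm_monoid_reduced)
  have one_iff: "cls a = \<one>\<^bsub>R\<^esub> \<longleftrightarrow> a \<in> Units G" if "a \<in> carrier G" for a
    unfolding one_R cls_eq_iff[OF that one_closed] using Units_closed by auto
  show ?thesis
  proof
    show "Units R = {\<one>\<^bsub>R\<^esub>}"
    proof
      show "Units R \<subseteq> {\<one>\<^bsub>R\<^esub>}"
      proof
        fix x assume "x \<in> Units R"
        then obtain y where xy: "x \<in> carrier R" "y \<in> carrier R" "x \<otimes>\<^bsub>R\<^esub> y = \<one>\<^bsub>R\<^esub>"
          unfolding Units_def by auto
        obtain a b where ab: "a \<in> carrier G" "b \<in> carrier G" "x = cls a" "y = cls b"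
          using xy(1,2) unfolding carrier_R by blast
        have "a \<otimes> b \<in> Units G" using xy(3) one_iff[of "a \<otimes> b"] ab by (simp add: mult_R)
        then have "a \<in> Units G" using ab by (metis unit_factor)
        then show "x \<in> {\<one>\<^bsub>R\<^esub>}" using one_iff ab by simp
      qed
    qed auto
    show "u = \<one>\<^bsub>R\<^esub>" if au: "a \<in> carrier R" "u \<in> carrier R" "a = a \<otimes>\<^bsub>R\<^esub> u" for a u
    proof -
      obtain b v where b: "b \<in> carrier G" "v \<in> carrier G" "a = cls b" "u = cls v"
        using au(1,2) unfolding carrier_R by blast
      have "cls b = cls (b \<otimes> v)" using au(3) b by (simp add: mult_R)
      then obtain w where w: "w \<in> Units G" "b = w \<otimes> (b \<otimes> v)" using b cls_eq_iff by auto
      then have "b = b \<otimes> (w \<otimes> v)" using b Units_closed by (metis m_lcomm)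
      then have "w \<otimes> v \<in> Units G" by (rule unit_cancel[OF b(1) m_closed[OF Units_closed[OF w(1)] b(2)]])
      then have "v \<in> Units G" using w(1) b by (metis Units_closed m_comm unit_factor)
      then show ?thesis using one_iff b by simp
    qed
  qed
qed

definition fsim :: "'a set multiset \<Rightarrow> 'a set multiset \<Rightarrow> bool" where
  "fsim x y \<longleftrightarrow> x \<in> factorization_monoid G \<and> y \<in> factorization_monoid G \<and>
     factorization_hom G x = factorization_hom G y"

lemma factorization_hom_closed:
  "z \<in> factorization_monoid G \<Longrightarrow> factorization_hom G z \<in> carrier R"
proof -
  interpret R: comm_monoid R by (rule comm_monoid_reduced)
  assume "z \<in> factorization_monoid G"
  then show ?thesis unfolding factorization_hom_def factorization_monoid_def monoid_atoms_def
    by (intro R.finprod_closed) auto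
qed

lemma factorization_monoid_add:
  "x + y \<in> factorization_monoid G \<longleftrightarrow> x \<in> factorization_monoid G \<and> y \<in> factorization_monoid G"
  by (auto simp: factorization_monoid_def)

lemma factorization_hom_one:
  assumes z: "z \<in> factorization_monoid G" "factorization_hom G z = \<one>\<^bsub>R\<^esub>" shows "z = {#}"
proof (rule ccontr)
  interpret R: reduced_comm_monoid R by (rule reduced_comm_monoid_R)
  assume "z \<noteq> {#}"
  then obtain u w where zu: "z = {#u#} + w" by (metis add_mset_add_single add.commute multiset_cases)
  have m: "{#u#} \<in> factorization_monoid G" "w \<in> factorization_monoid G"
    using z(1) unfolding zu factorization_monoid_add by (rule conjunct1, rule conjunct2)
  then have u: "u \<in> monoid_atoms R" by (simp add: factorization_monoid_def)
  have "u \<otimes>\<^bsub>R\<^esub> factorization_hom G w = \<one>\<^bsub>R\<^esub>"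
    using z(2) factorization_hom_union[OF m] factorization_hom_single[OF u] zu by simp
  moreover have "u \<in> carrier R" "u \<notin> Units R" using u by (auto simp: monoid_atoms_def)
  ultimately show False using R.divisor_of_one(1) factorization_hom_closed[OF m(2)] R.units by blast
qed

lemma factor_congruence_fsim:
  assumes "fin_gen_monoid R"
  shows "factor_congruence (monoid_atoms R) fsim"
proof -
  interpret R: reduced_comm_monoid R by (rule reduced_comm_monoid_R)
  show ?thesis
  proof
    fix x y z w :: "'a set multiset"
    show "finite (monoid_atoms R)" by (rule R.finitely_generated_atomic(1)[OF assms])
    show "fsim x y \<Longrightarrow> set_mset x \<subseteq> monoid_atoms R" by (simp add: fsim_def factorization_monoid_def)
    show "set_mset x \<subseteq> monoid_atoms R \<Longrightarrow> fsim x x" by (simp add: fsim_def factorization_monoid_def)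
    show "fsim x y \<Longrightarrow> fsim y x" by (simp add: fsim_def)
    show "fsim x y \<Longrightarrow> fsim y z \<Longrightarrow> fsim x z" by (simp add: fsim_def)
    show "fsim (x + w) (y + w)" if "fsim x y" "set_mset w \<subseteq> monoid_atoms R"
    proof -
      have "w \<in> factorization_monoid G" using that(2) by (simp add: factorization_monoid_def)
      then show ?thesis using that(1) by (simp add: fsim_def factorization_monoid_add factorization_hom_union)
    qed
    show "w = {#}" if "fsim x (x + w)"
    proof -
      have m: "x \<in> factorization_monoid G" "w \<in> factorization_monoid G"
        using that by (auto simp: fsim_def factorization_monoid_add)
      have "factorization_hom G x = factorization_hom G x \<otimes>\<^bsub>R\<^esub> factorization_hom G w"
        using that factorization_hom_union[OF m] by (simp add: fsim_def)
      then have "factorization_hom G w = \<one>\<^bsub>R\<^esub>"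
        by (rule R.cancel_one[OF factorization_hom_closed[OF m(1)] factorization_hom_closed[OF m(2)]])
      then show ?thesis by (rule factorization_hom_one[OF m(2)])
    qed
  qed
qed

lemma cancel_factor_congruence_fsim:
  assumes "fin_gen_monoid R" "comm_monoid_cancel G"
  shows "cancel_factor_congruence (monoid_atoms R) fsim"
proof -
  interpret F: factor_congruence "monoid_atoms R" fsim by (rule factor_congruence_fsim[OF assms(1)])
  interpret C: comm_monoid_cancel G by (rule assms(2))
  have can: "x = y" if xyz: "x \<in> carrier R" "y \<in> carrier R" "z \<in> carrier R" "x \<otimes>\<^bsub>R\<^esub> z = y \<otimes>\<^bsub>R\<^esub> z" for x y z
  proof -
    obtain a b c where abc: "a \<in> carrier G" "b \<in> carrier G" "c \<in> carrier G" "x = cls a" "y = cls b" "z = cls c"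
      using xyz(1-3) unfolding carrier_R by blast
    then have "cls (a \<otimes> c) = cls (b \<otimes> c)" using xyz(4) by (simp add: mult_R)
    then obtain u where u: "u \<in> Units G" "a \<otimes> c = u \<otimes> (b \<otimes> c)" using abc cls_eq_iff by auto
    then have "a \<otimes> c = (u \<otimes> b) \<otimes> c" using abc Units_closed by (simp add: m_assoc)
    then have "a = u \<otimes> b" using C.r_cancel abc u(1) Units_closed by (metis m_closed)
    then show ?thesis using u(1) abc cls_eq_iff by blast
  qed
  show ?thesis
  proof
    show "fsim x y" if xy: "fsim (x + w) (y + w)" for x y w
    proof -
      have m: "x \<in> factorization_monoid G" "y \<in> factorization_monoid G" "w \<in> factorization_monoid G"
        using xy by (auto simp: fsim_def factorization_monoid_add)
      have "factorization_hom G x \<otimes>\<^bsub>R\<^esub> factorization_hom G w = factorization_hom G y \<otimes>\<^bsub>R\<^esub> factorization_hom G w"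
        using xy factorization_hom_union m by (simp add: fsim_def)
      then have "factorization_hom G x = factorization_hom G y"
        by (rule can[OF factorization_hom_closed[OF m(1)] factorization_hom_closed[OF m(2)]
            factorization_hom_closed[OF m(3)]])
      then show ?thesis using m by (simp add: fsim_def)
    qed
  qed
qed

lemma factorization_hom_surj:
  assumes "fin_gen_monoid R" "x \<in> carrier R"
  obtains z where "z \<in> factorization_monoid G" "factorization_hom G z = x"
proof -
  interpret R: reduced_comm_monoid R by (rule reduced_comm_monoid_R)
  let ?T = "factorization_hom G ` factorization_monoid G"
  have "submonoid ?T R"
  proof
    show "?T \<subseteq> carrier R" using factorization_hom_closed by blast
    have "{#} \<in> factorization_monoid G" by (simp add: factorization_monoid_def)
    then show "\<one>\<^bsub>R\<^esub> \<in> ?T" using factorization_hom_empty by (metis image_eqI)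
    show "a \<otimes>\<^bsub>R\<^esub> b \<in> ?T" if ab: "a \<in> ?T" "b \<in> ?T" for a b
    proof -
      obtain y z where yz: "y \<in> factorization_monoid G" "z \<in> factorization_monoid G"
        "a = factorization_hom G y" "b = factorization_hom G z" using ab by blast
      then have "a \<otimes>\<^bsub>R\<^esub> b = factorization_hom G (y + z)" by (simp add: factorization_hom_union)
      moreover have "y + z \<in> factorization_monoid G" using yz by (simp add: factorization_monoid_add)
      ultimately show ?thesis by blast
    qed
  qed
  moreover have "monoid_atoms R \<subseteq> ?T"
  proof
    fix u assume u: "u \<in> monoid_atoms R"
    then have "{#u#} \<in> factorization_monoid G" by (simp add: factorization_monoid_def)
    then show "u \<in> ?T" using factorization_hom_single[OF u] by (metis image_eqI)
  qed
  ultimately have "carrier R \<subseteq> ?T" by (rule R.finitely_generated_atomic(2)[OF assms(1)])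
  then show ?thesis using assms(2) that by blast
qed

lemma factorizations_class:
  assumes "z \<in> factorizations G a" shows "factorizations G a = {y. fsim z y}"
  using assms unfolding factorizations_def fsim_def by auto

lemma length_set_class:
  assumes "z \<in> factorizations G a" shows "length_set G a = size ` {y. fsim z y}"
  unfolding length_set_def factorizations_class[OF assms] ..

lemma factorizations_nonempty:
  assumes "fin_gen_monoid R" "a \<in> carrier G"
  obtains z where "z \<in> factorizations G a"
proof -
  have "cls a \<in> carrier R" using assms(2) by (simp add: carrier_R)
  then obtain z where "z \<in> factorization_monoid G" "factorization_hom G z = cls a"
    by (rule factorization_hom_surj[OF assms(1)])
  then show ?thesis using that by (simp add: factorizations_def)
qed

lemma length_sets_eq:
  assumes "fin_gen_monoid R"
  shows "length_sets G = {size ` {y. fsim z y} | z. set_mset z \<subseteq> monoid_atoms R}"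
proof (intro equalityI subsetI)
  fix L assume "L \<in> length_sets G"
  then obtain a where a: "a \<in> carrier G" "L = length_set G a" unfolding length_sets_def by blast
  obtain z where z: "z \<in> factorizations G a" using assms a(1) by (rule factorizations_nonempty)
  then have "set_mset z \<subseteq> monoid_atoms R" by (simp add: factorizations_def factorization_monoid_def)
  then show "L \<in> {size ` {y. fsim z y} | z. set_mset z \<subseteq> monoid_atoms R}"
    using length_set_class[OF z] a(2) by blast
next
  fix L assume "L \<in> {size ` {y. fsim z y} | z. set_mset z \<subseteq> monoid_atoms R}"
  then obtain z where z: "L = size ` {y. fsim z y}" "z \<in> factorization_monoid G"
    by (auto simp: factorization_monoid_def)
  obtain a where a: "a \<in> carrier G" "factorization_hom G z = cls a"
    using factorization_hom_closed[OF z(2)] unfolding carrier_R by blast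
  then have "z \<in> factorizations G a" using z(2) by (simp add: factorizations_def)
  then show "L \<in> length_sets G" using length_set_class z(1) a(1) unfolding length_sets_def by blast
qed

lemma monoid_distances_eq:
  assumes "fin_gen_monoid R"
  shows "monoid_distances G =
    (\<Union>z\<in>{z. set_mset z \<subseteq> monoid_atoms R}. set_distances (int ` size ` {y. fsim z y}))"
  unfolding monoid_distances_def length_sets_eq[OF assms] by blast

lemma union_of_lengths_eq:
  assumes "fin_gen_monoid R"
  shows "union_of_lengths G k = {size y | y. \<exists>x. fsim x y \<and> size x = k}"
proof -
  interpret F: factor_congruence "monoid_atoms R" fsim by (rule factor_congruence_fsim[OF assms])
  show ?thesis
  proof (intro equalityI subsetI)
    fix n assume "n \<in> union_of_lengths G k"
    then obtain z where z: "n \<in> size ` {y. fsim z y}" "k \<in> size ` {y. fsim z y}"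
      unfolding union_of_lengths_def length_sets_eq[OF assms] by auto
    then obtain x y where xy: "fsim z x" "k = size x" "fsim z y" "n = size y" by blast
    have "fsim x y" by (rule F.sim_trans[OF F.sim_sym[OF xy(1)] xy(3)])
    then show "n \<in> {size y | y. \<exists>x. fsim x y \<and> size x = k}" using xy by blast
  next
    fix n assume "n \<in> {size y | y. \<exists>x. fsim x y \<and> size x = k}"
    then obtain x y where xy: "fsim x y" "size x = k" "size y = n" by blast
    have A: "set_mset x \<subseteq> monoid_atoms R" by (rule F.sim_set[OF xy(1)])
    define L where "L = size ` {y. fsim x y}"
    have "k \<in> L" "n \<in> L" using xy F.sim_refl[OF A] by (auto simp: L_def)
    moreover have "L \<in> length_sets G" unfolding length_sets_eq[OF assms] L_def using A by blast
    ultimately show "n \<in> union_of_lengths G k" unfolding union_of_lengths_def by blast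
  qed
qed

lemma finite_catenary_degrees:
  assumes "fin_gen_monoid R"
  shows "finite (catenary_degrees G)"
proof -
  interpret F: factor_congruence "monoid_atoms R" fsim by (rule factor_congruence_fsim[OF assms])
  obtain N where N: "\<forall>x y. fsim x y \<longrightarrow> (\<lambda>u v. fsim u v \<and> factorization_dist u v \<le> N)\<^sup>*\<^sup>* x y"
    using F.catenary_bound by blast
  have "catenary_degree G a \<le> enat N" for a
    unfolding catenary_degree_def
  proof (rule Least_le, intro ballI)
    fix z z' assume z: "z \<in> factorizations G a" and z': "z' \<in> factorizations G a"
    let ?C = "\<lambda>x y. x \<in> factorizations G a \<and> y \<in> factorizations G a \<and>
               enat (factorization_dist x y) \<le> enat N"
    have "fsim z z'" using z' factorizations_class[OF z] by blast
    then have "(\<lambda>u v. fsim u v \<and> factorization_dist u v \<le> N)\<^sup>*\<^sup>* z z'" using N by blast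
    then have "z' \<in> factorizations G a \<and> ?C\<^sup>*\<^sup>* z z'"
    proof (induction rule: rtranclp_induct)
      case base
      then show ?case using z by blast
    next
      case (step u v)
      have u: "u \<in> factorizations G a" using step.IH by blast
      then have v: "v \<in> factorizations G a" using step.hyps(2) factorizations_class[OF u] by blast
      have "?C u v" using u v step.hyps(2) by simp
      then have "?C\<^sup>*\<^sup>* z v" by (rule rtranclp.rtrancl_into_rtrancl[OF conjunct2[OF step.IH]])
      then show ?case using v by (intro conjI)
    qed
    then show "?C\<^sup>*\<^sup>* z z'" by blast
  qed
  moreover have "n \<in> enat ` {..N}" if n: "n \<le> enat N" for n
  proof -
    obtain k where "n = enat k" using enat_ile[OF n] by blast
    then show ?thesis using n by simp
  qed
  ultimately have "catenary_degrees G \<subseteq> enat ` {..N}"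
    unfolding catenary_degrees_def by blast
  then show ?thesis by (rule finite_subset) simp
qed

lemma atoms_nonempty:
  assumes "fin_gen_monoid R" "carrier G \<noteq> Units G"
  shows "monoid_atoms R \<noteq> {}"
proof
  assume empty: "monoid_atoms R = {}"
  have "a \<in> Units G" if a: "a \<in> carrier G" for a
  proof -
    obtain z where z: "z \<in> factorizations G a" using assms(1) a by (rule factorizations_nonempty)
    then have "z = {#}" using empty by (simp add: factorizations_def factorization_monoid_def)
    then have "cls a = cls \<one>" using z factorization_hom_empty one_R by (simp add: factorizations_def)
    then show ?thesis using a cls_eq_iff[OF a one_closed] Units_closed by auto
  qed
  then show False using assms(2) Units_closed by blast
qed

lemma elasticity_set_eq:
  assumes "fin_gen_monoid R"
  shows "elasticity_set G =
    (\<lambda>z. set_elasticity (size ` {y. fsim z y})) ` {z. set_mset z \<subseteq> monoid_atoms R}"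
  unfolding elasticity_set_def length_sets_eq[OF assms] by blast

end

theorem theorem3p1:
  fixes H :: "('a, 'b) monoid_scheme"
  assumes "unit_cancel_comm_monoid H"
    and "fin_gen_monoid (reduced_monoid H)"
  shows
    "(finite (catenary_degrees H) \<and> finite (monoid_distances H) \<and>
      monoid_elasticity H \<in> ereal ` \<rat> \<and>
      (comm_monoid_cancel H \<longrightarrow>
         accepted_elasticity H \<and>
         (\<exists>r::real. 1 \<le> r \<and>
            {ereal q | q. q \<in> \<rat> \<and> r \<le> q \<and> ereal q \<le> monoid_elasticity H} \<subseteq> elasticity_set H \<and>
            (\<forall>x. x islimpt {set_elasticity L | L. L \<in> length_sets H \<and> set_elasticity L < ereal r}
                 \<longrightarrow> x = ereal r)))) \<and>
     (carrier H \<noteq> Units H \<longrightarrow>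
        (\<exists>M::nat. \<forall>k>0.
           finite (union_of_lengths H k) \<and>
           (if monoid_distances H = {} then \<forall>d>0. is_AAP d M (int ` union_of_lengths H k)
            else is_AAP (LEAST d. d \<in> monoid_distances H) M (int ` union_of_lengths H k)))) \<and>
     (comm_monoid_cancel H \<longrightarrow>
        (\<exists>M::nat. \<forall>L\<in>length_sets H.
           if monoid_distances H = {} then \<forall>d>0. is_AAMP d M (int ` L)
           else \<exists>d\<in>monoid_distances H. is_AAMP d M (int ` L)))"
proof -
  interpret unit_cancel_comm_monoid H by (rule assms(1))
  let ?A = "monoid_atoms (reduced_monoid H)"
  note fg = assms(2)
  interpret F: factor_congruence ?A fsim by (rule factor_congruence_fsim[OF fg])
  note dist = monoid_distances_eq[OF fg] and lens = length_sets_eq[OF fg]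
  have elast: "monoid_elasticity H = (SUP z\<in>{z. set_mset z \<subseteq> ?A}. set_elasticity (F.len z))"
    unfolding monoid_elasticity_def elasticity_set_eq[OF fg] ..
  have part2: "\<exists>M::nat. \<forall>k>0. finite (union_of_lengths H k) \<and>
           (if monoid_distances H = {} then \<forall>d>0. is_AAP d M (int ` union_of_lengths H k)
            else is_AAP (LEAST d. d \<in> monoid_distances H) M (int ` union_of_lengths H k))"
    if ne: "carrier H \<noteq> Units H"
    unfolding dist union_of_lengths_eq[OF fg] by (rule F.unions_are_AAPs[OF atoms_nonempty[OF fg ne]])
  have cancel: "accepted_elasticity H \<and>
         (\<exists>r::real. 1 \<le> r \<and>
            {ereal q | q. q \<in> \<rat> \<and> r \<le> q \<and> ereal q \<le> monoid_elasticity H} \<subseteq> elasticity_set H \<and>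
            (\<forall>x. x islimpt {set_elasticity L | L. L \<in> length_sets H \<and> set_elasticity L < ereal r}
                 \<longrightarrow> x = ereal r)) \<and>
        (\<exists>M::nat. \<forall>L\<in>length_sets H.
           if monoid_distances H = {} then \<forall>d>0. is_AAMP d M (int ` L)
           else \<exists>d\<in>monoid_distances H. is_AAMP d M (int ` L))"
    if can: "comm_monoid_cancel H"
  proof -
    interpret C: cancel_factor_congruence ?A fsim by (rule cancel_factor_congruence_fsim[OF fg can])
    obtain G where G: "finite G" "\<forall>g\<in>G. fsim (fst g) (snd g) \<and> fst g \<noteq> {#}"
      "\<forall>x y. fsim x y \<longrightarrow> (\<exists>E. set_mset E \<subseteq> G \<and> x = src E \<and> y = tgt E)"
      using C.finite_generation by (elim exE conjE)
    interpret C: cancel_generated ?A fsim G by unfold_locales (use G in auto)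
    obtain z where z: "set_mset z \<subseteq> ?A" "set_elasticity (F.len z) = ereal C.rho"
      using C.rho_is_elasticity by (elim exE conjE)
    have rho: "monoid_elasticity H = ereal C.rho"
    proof (rule antisym)
      show "monoid_elasticity H \<le> ereal C.rho"
        unfolding elast by (rule SUP_least) (use C.elasticity_le_rho(1) in simp)
      show "ereal C.rho \<le> monoid_elasticity H"
        unfolding elast z(2)[symmetric] by (rule SUP_upper) (use z(1) in simp)
    qed
    have 1: "accepted_elasticity H"
      unfolding accepted_elasticity_def rho using z unfolding lens by blast
    obtain r where r: "1 \<le> r"
      "\<forall>q. q \<in> \<rat> \<and> r \<le> q \<and> q \<le> C.rho \<longrightarrow> (\<exists>z. set_mset z \<subseteq> ?A \<and> set_elasticity (F.len z) = ereal q)"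
      "\<forall>s<r. finite {set_elasticity (F.len z) | z. set_mset z \<subseteq> ?A \<and> set_elasticity (F.len z) \<le> ereal s}"
      by (rule C.elasticity_structure)
    have 2: "{ereal q | q. q \<in> \<rat> \<and> r \<le> q \<and> ereal q \<le> monoid_elasticity H} \<subseteq> elasticity_set H"
    proof
      fix x assume "x \<in> {ereal q | q. q \<in> \<rat> \<and> r \<le> q \<and> ereal q \<le> monoid_elasticity H}"
      then obtain q where q: "x = ereal q" "q \<in> \<rat> \<and> r \<le> q \<and> q \<le> C.rho" unfolding rho by auto
      then obtain z where "set_mset z \<subseteq> ?A" "set_elasticity (F.len z) = ereal q" using r(2) by blast
      then show "x \<in> elasticity_set H" unfolding elasticity_set_eq[OF fg] q(1) by (intro image_eqI[of _ _ z]) simp_all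
    qed
    have 3: "x = ereal r"
      if x: "x islimpt {set_elasticity L | L. L \<in> length_sets H \<and> set_elasticity L < ereal r}" for x
    proof (rule islimpt_only_at_top[OF _ _ x])
      let ?X = "{set_elasticity L | L. L \<in> length_sets H \<and> set_elasticity L < ereal r}"
      show "y < ereal r" if "y \<in> ?X" for y using that by blast
      show "finite {y \<in> ?X. y \<le> ereal s}" if "s < r" for s
        by (rule finite_subset[OF _ r(3)[rule_format, OF that]]) (unfold lens, blast)
    qed
    have 4: "\<exists>M::nat. \<forall>L\<in>length_sets H.
           if monoid_distances H = {} then \<forall>d>0. is_AAMP d M (int ` L)
           else \<exists>d\<in>monoid_distances H. is_AAMP d M (int ` L)"
    proof -
      obtain M where M: "\<forall>z. set_mset z \<subseteq> ?A \<longrightarrow>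
        (if monoid_distances H = {} then \<forall>d>0. is_AAMP d M (int ` F.len z)
         else \<exists>d\<in>monoid_distances H. is_AAMP d M (int ` F.len z))"
        using C.length_sets_are_AAMPs unfolding dist[symmetric] by (elim exE)
      show ?thesis
      proof (intro exI[of _ M] ballI)
        fix L assume "L \<in> length_sets H"
        then obtain z where z: "L = F.len z" "set_mset z \<subseteq> ?A" unfolding lens by blast
        show "if monoid_distances H = {} then \<forall>d>0. is_AAMP d M (int ` L)
           else \<exists>d\<in>monoid_distances H. is_AAMP d M (int ` L)"
          unfolding z(1) using z(2) by (rule M[rule_format])
      qed
    qed
    show ?thesis using 1 r(1) 2 3 4 by blast
  qed
  have "finite (monoid_distances H)" unfolding dist by (rule F.finite_dists)
  moreover have "monoid_elasticity H \<in> ereal ` \<rat>" unfolding elast using F.elasticity_Sup by auto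
  ultimately show ?thesis using finite_catenary_degrees[OF fg] part2 cancel
    by (intro conjI impI) blast+
qed

end
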